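(* Let $G$ be a countable discrete sofic group and let $(A^{\mathbb Z},\nu)$ be a uniformly mixing $\mathbb Z$-process with finite state space $A$. Let $H\le G$ be a subgroup isomorphic to $\mathbb Z$ and identify $A^{\mathbb Z}$ with $A^H$ (via an isomorphism $\mathbb Z\cong H$). Then for any sofic approximation $\Sigma=(\sigma_n:G\to\mathrm{Sym}(V_n))$ to $G$, there is a uniformly model-mixing sequence of measures $(\mu_n)_{n=1}^\infty$, $\mu_n\in\mathrm{Prob}(A^{V_n})$, which locally and empirically converges to $\mathrm{CInd}^G_H(\nu)$ over $\Sigma$.
   Context: Processes. For a countable group $G$ and a finite set $A$, $G$ acts on $A^G$ by the right shift $(g\cdot a)(h)=a(hg)$. A $G$-process over $A$ is a Borel probability measure $\mu$ on $A^G$ invariant under this action. For a measurable map $\phi:A^G\to B$ let $\phi^G:A^G\to B^G$ be $\phi^G(a)(g)=\phi(g\cdot a)$. $\mathrm H$ denotes Shannon entropy of a probability measure on a finite set, and $\mathrm H_\mu(\phi)=\mathrm H(\phi_*\mu)$. For $W\subseteq S$, $\pi_W:A^S\to A^W$ is coordinate projection, and $\mu_F=\pi_{F*}\mu$ for $F\subseteq G$ (similarly $(\phi^G_*\mu)_S$ is the marginal on $B^S$). Uniform mixing. For finite $K\subseteq G$, a set $S\subseteq G$ is $K$-spread if any distinct $s_1,s_2\in S$ satisfy $s_1s_2^{-1}\notin K$. $(A^G,\mu)$ is uniformly mixing if for any finite-valued measurable $\phi:A^G\to B$ and $\epsilon>0$ there is a finite $K\subseteq G$ such that every finite $K$-spread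 $S\subseteq G$ satisfies $\mathrm H((\phi^G_*\mu)_S)\ge|S|\cdot(\mathrm H_\mu(\phi)-\epsilon)$. (Applied here with $\mathbb Z$ in place of $G$.) Coinduction. For $H\le G$ and an $H$-process $(A^H,\nu)$, let $T$ be a transversal for the right cosets $Hg$ of $H$ in $G$; identify $G$ with $H\times T$ via $ht\leftrightarrow(h,t)$, hence $A^G$ with $(A^H)^T$, and set $\mathrm{CInd}^G_H(\nu)=\nu^T$ (product measure), a $G$-process over $A$. Sofic approximations. A sofic approximation to $G$ is a sequence $\Sigma=(\sigma_n:G\to\mathrm{Sym}(V_n))_{n\ge1}$ of maps, $V_n$ finite sets with $|V_n|\to\infty$, such that (writing $\sigma^g\cdot v=\sigma(g)(v)$) $|\{v\in V_n:\sigma_n^{g}\sigma_n^{h}\cdot v=\sigma_n^{gh}\cdot v\}|=(1-o(1))|V_n|$ for all $g,h\in G$ and $|\{v\in V_n:\sigma_n^g\cdot v\neq v\}|=(1-o(1))|V_n|$ for all $g\neq 1_G$. $G$ is sofic if it has a sofic approximation. Convergence. For $\sigma:G\to\mathrm{Sym}(V)$, $v\in V$ and $\overline a\in A^V$ let $\Pi_v^\sigma(\overline a)\in A^G$ be $\Pi_v^\sigma(\overline a)(g)=\overline a(\sigma^g\cdot v)$, and let $P^\sigma_{\overline a}=\frac1{|V|}\sum_{v\in V}\delta_{\Pi^\sigma_v(\overline a)}$. A sequence $\mu_n\in\mathrm{Prob}(A^{V_n})$ locally and empirically converges to a $G$-process $\mu$ over $\Sigma$ if for every weak-star neighbourhood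 $\mathcal O$ of $\mu$ in $\mathrm{Prob}(A^G)$: (1) $|\{v\in V_n:(\Pi_v^{\sigma_n})_*\mu_n\in\mathcal O\}|=(1-o(1))|V_n|$, and (2) $\mu_n(\{\overline a:P^{\sigma_n}_{\overline a}\in\mathcal O\})\to1$. Metrics on sofic approximations. Fix a proper (all balls finite) right-invariant metric $\rho$ on $G$. For a finite set $V$ and $\sigma:G\to\mathrm{Sym}(V)$ let $H_\sigma$ be the graph on $V$ with an edge between $v$ and $w$ iff $\sigma^g\cdot v=w$ or $\sigma^g\cdot w=v$ for some $g\in G$, with edge weights $W(v,w)=\min\{\rho(g,1_G):\sigma^g\cdot v=w\text{ or }\sigma^g\cdot w=v\}$. On each connected component of $H_\sigma$ let $\rho_\sigma$ be the $W$-weighted graph distance, and set $\rho_\sigma(v,w)=M$ for $v,w$ in distinct components, where $M$ is a chosen number much larger than (in particular larger than) the $\rho_\sigma$-distance between any two points in a common component. Write $\rho_n=\rho_{\sigma_n}$. A set is $r$-separated if distinct points are at distance at least $r$. Uniform model-mixing. Write $\sigma^F(S)=\{\sigma^g\cdot s:g\in F,s\in S\}$. With $\mu=\mathrm{CInd}^G_H(\nu)$ the limiting process, $(\mu_n)$, $\mu_n\in\mathrm{Prob}(A^{V_n})$, is uniformly model-mixing if for every finite $F\subseteq G$ and $\epsilon>0$ there are $r<\infty$ and subsets $W_n\subseteq V_n$ with $|W_n|=(1-o(1))|V_n|$ such that if $S\subseteq W_n$ is $r$-separated according to $\rho_n$, then $\mathrm H(\pi_{\sigma_n^F(S)*}\mu_n)\ge|S|\cdot(\mathrm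 H(\mu_F)-\epsilon)$. *)

theory Defs
  imports
    "HOL-Probability.Probability"
    "HOL-Algebra.Free_Abelian_Groups"
    "HOL-Combinatorics.Permutations"
    "Graph_Theory.Graph_Theory"
begin

section \<open>Configurations, marginals and entropy\<close>

text \<open>
  A configuration in \<open>A\<^sup>S\<close> is an extensional function in \<open>S \<rightarrow>\<^sub>E A\<close>.  For countable \<open>S\<close> and
  finite \<open>A\<close> the product sigma-algebra below is the Borel sigma-algebra of \<open>A\<^sup>S\<close>.
\<close>

definition config :: "'s set \<Rightarrow> 'a set \<Rightarrow> ('s \<Rightarrow> 'a) measure" where
  "config S A = PiM S (\<lambda>_. count_space A)"

definition Prob :: "'s set \<Rightarrow> 'a set \<Rightarrow> ('s \<Rightarrow> 'a) measure set" where
  "Prob S A = {M. prob_space M \<and> sets M = sets (config S A)}"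

definition marginal :: "'a set \<Rightarrow> 's set \<Rightarrow> ('s \<Rightarrow> 'a) measure \<Rightarrow> ('s \<Rightarrow> 'a) measure" where
  "marginal A W M = distr M (config W A) (\<lambda>x. restrict x W)"

text \<open>Entropy in nats; the convention \<open>0 ln 0 = 0\<close> holds automatically.\<close>

definition shannon_entropy :: "'b measure \<Rightarrow> real" where
  "shannon_entropy M = - (\<Sum>x\<in>space M. measure M {x} * ln (measure M {x}))"

lemma shannon_entropy_eq_entropy:
  assumes "prob_space M" "finite (space M)" "sets M = Pow (space M)"
  shows "shannon_entropy M = prob_space.entropy M (exp 1) (count_space (space M)) (\<lambda>x. x)"
proof -
  interpret prob_space M by fact
  interpret information_space M "exp 1" by unfold_locales simp
  have sf: "simple_function M (\<lambda>x. x)"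
    using assms by (auto simp: simple_function_def)
  have "simple_distributed M (\<lambda>x. x) (\<lambda>x. measure M {x})"
  proof (rule simple_distributedI[OF sf])
    fix x assume "x \<in> (\<lambda>x. x) ` space M"
    then have "(\<lambda>x. x) -` {x} \<inter> space M = {x}" by auto
    then show "measure M {x} = prob ((\<lambda>x. x) -` {x} \<inter> space M)" by simp
  qed simp
  from entropy_simple_distributed[OF this] show ?thesis
    by (simp add: shannon_entropy_def log_def)
qed

section \<open>Processes\<close>

definition shift :: "('g, 'm) monoid_scheme \<Rightarrow> 'g \<Rightarrow> ('g \<Rightarrow> 'a) \<Rightarrow> 'g \<Rightarrow> 'a" where
  "shift G g a = (\<lambda>h\<in>carrier G. a (h \<otimes>\<^bsub>G\<^esub> g))"

definition process :: "('g, 'm) monoid_scheme \<Rightarrow> 'a set \<Rightarrow> ('g \<Rightarrow> 'a) measure \<Rightarrow> bool" where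
  "process G A M \<longleftrightarrow> M \<in> Prob (carrier G) A \<and>
     (\<forall>g\<in>carrier G. distr M (config (carrier G) A) (shift G g) = M)"

definition equivariant_map ::
  "('g, 'm) monoid_scheme \<Rightarrow> (('g \<Rightarrow> 'a) \<Rightarrow> 'b) \<Rightarrow> ('g \<Rightarrow> 'a) \<Rightarrow> 'g \<Rightarrow> 'b" where
  "equivariant_map G \<phi> a = (\<lambda>g\<in>carrier G. \<phi> (shift G g a))"

definition spread :: "('g, 'm) monoid_scheme \<Rightarrow> 'g set \<Rightarrow> 'g set \<Rightarrow> bool" where
  "spread G K S \<longleftrightarrow> (\<forall>s\<in>S. \<forall>t\<in>S. s \<noteq> t \<longrightarrow> s \<otimes>\<^bsub>G\<^esub> inv\<^bsub>G\<^esub> t \<notin> K)"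

text \<open>Every finite set of values can be labelled by natural numbers, hence \<open>B :: nat set\<close>.\<close>

definition uniformly_mixing ::
  "('g, 'm) monoid_scheme \<Rightarrow> 'a set \<Rightarrow> ('g \<Rightarrow> 'a) measure \<Rightarrow> bool" where
  "uniformly_mixing G A M \<longleftrightarrow>
     (\<forall>B :: nat set. \<forall>\<phi>. \<forall>\<epsilon>>0.
        finite B \<and> \<phi> \<in> measurable (config (carrier G) A) (count_space B) \<longrightarrow>
        (\<exists>K\<subseteq>carrier G. finite K \<and>
          (\<forall>S\<subseteq>carrier G. finite S \<and> spread G K S \<longrightarrow>
             shannon_entropy
               (marginal B S (distr M (config (carrier G) B) (equivariant_map G \<phi>)))
             \<ge> real (card S) * (shannon_entropy (distr M (count_space B) \<phi>) - \<epsilon>))))"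

section \<open>Coinduction\<close>

definition right_transversal :: "('g, 'm) monoid_scheme \<Rightarrow> 'g set \<Rightarrow> 'g set \<Rightarrow> bool" where
  "right_transversal G H T \<longleftrightarrow>
     T \<subseteq> carrier G \<and> (\<forall>C\<in>rcosets\<^bsub>G\<^esub> H. \<exists>!t. t \<in> T \<and> t \<in> C)"

definition coset_rep :: "('g, 'm) monoid_scheme \<Rightarrow> 'g set \<Rightarrow> 'g set \<Rightarrow> 'g \<Rightarrow> 'g" where
  "coset_rep G H T g = (THE t. t \<in> T \<and> g \<in> H #>\<^bsub>G\<^esub> t)"

text \<open>The identification of \<open>(A\<^sup>H)\<^sup>T\<close> with \<open>A\<^sup>G\<close>: the value at \<open>g = h t\<close> is \<open>x t h\<close>.\<close>

definition glue ::
  "('g, 'm) monoid_scheme \<Rightarrow> 'g set \<Rightarrow> 'g set \<Rightarrow> ('g \<Rightarrow> 'g \<Rightarrow> 'a) \<Rightarrow> 'g \<Rightarrow> 'a" where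
  "glue G H T x =
     (\<lambda>g\<in>carrier G. let t = coset_rep G H T g in x t (g \<otimes>\<^bsub>G\<^esub> inv\<^bsub>G\<^esub> t))"

definition CInd ::
  "('g, 'm) monoid_scheme \<Rightarrow> 'g set \<Rightarrow> 'g set \<Rightarrow> 'a set \<Rightarrow> ('g \<Rightarrow> 'a) measure
     \<Rightarrow> ('g \<Rightarrow> 'a) measure" where
  "CInd G H T A \<nu> = distr (PiM T (\<lambda>_. \<nu>)) (config (carrier G) A) (glue G H T)"

text \<open>The identification of \<open>A\<^bsup>L\<^esup>\<close> with \<open>A\<^sup>H\<close> along a bijection \<open>\<theta>\<close> from \<open>L\<close> to \<open>H\<close>.\<close>

definition relabel ::
  "'l set \<Rightarrow> 'g set \<Rightarrow> ('l \<Rightarrow> 'g) \<Rightarrow> 'a set \<Rightarrow> ('l \<Rightarrow> 'a) measure \<Rightarrow> ('g \<Rightarrow> 'a) measure" where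
  "relabel L H \<theta> A \<nu> = distr \<nu> (config H A) (\<lambda>a. \<lambda>h\<in>H. a (inv_into L \<theta> h))"

section \<open>Sofic approximations\<close>

definition sofic_approximation ::
  "('g, 'm) monoid_scheme \<Rightarrow> (nat \<Rightarrow> 'v set) \<Rightarrow> (nat \<Rightarrow> 'g \<Rightarrow> 'v \<Rightarrow> 'v) \<Rightarrow> bool" where
  "sofic_approximation G V \<sigma> \<longleftrightarrow>
     (\<forall>n. finite (V n)) \<and>
     filterlim (\<lambda>n. card (V n)) at_top sequentially \<and>
     (\<forall>n. \<forall>g\<in>carrier G. \<sigma> n g permutes V n) \<and>
     (\<forall>g\<in>carrier G. \<forall>h\<in>carrier G.
        (\<lambda>n. real (card {v\<in>V n. \<sigma> n g (\<sigma> n h v) = \<sigma> n (g \<otimes>\<^bsub>G\<^esub> h) v}) / real (card (V n)))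
          \<longlonglongrightarrow> 1) \<and>
     (\<forall>g\<in>carrier G - {\<one>\<^bsub>G\<^esub>}.
        (\<lambda>n. real (card {v\<in>V n. \<sigma> n g v \<noteq> v}) / real (card (V n))) \<longlonglongrightarrow> 1)"

text \<open>Every finite set is in bijection with a set of natural numbers, so here \<open>V n :: nat set\<close>.\<close>

definition sofic :: "('g, 'm) monoid_scheme \<Rightarrow> bool" where
  "sofic G \<longleftrightarrow> (\<exists>(V :: nat \<Rightarrow> nat set) \<sigma>. sofic_approximation G V \<sigma>)"

section \<open>Local and empirical convergence\<close>

definition pullback_name ::
  "('g, 'm) monoid_scheme \<Rightarrow> ('g \<Rightarrow> 'v \<Rightarrow> 'v) \<Rightarrow> ('v \<Rightarrow> 'a) \<Rightarrow> 'v \<Rightarrow> 'g \<Rightarrow> 'a" where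
  "pullback_name G \<sigma> a v = (\<lambda>g\<in>carrier G. a (\<sigma> g v))"

text \<open>The average of the point masses at \<open>pullback_name G \<sigma> a v\<close> over \<open>v \<in> V\<close>.\<close>

definition empirical ::
  "('g, 'm) monoid_scheme \<Rightarrow> 'a set \<Rightarrow> 'v set \<Rightarrow> ('g \<Rightarrow> 'v \<Rightarrow> 'v) \<Rightarrow> ('v \<Rightarrow> 'a)
     \<Rightarrow> ('g \<Rightarrow> 'a) measure" where
  "empirical G A V \<sigma> a =
     distr (uniform_count_measure V) (config (carrier G) A) (pullback_name G \<sigma> a)"

text \<open>
  The weak-star topology on \<open>Prob (carrier G) A\<close>: the coarsest one making all integrals of
  continuous functions continuous, where \<open>A\<close> is discrete and \<open>A\<^sup>G\<close> has the product topology.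
\<close>

definition weak_star :: "('g, 'm) monoid_scheme \<Rightarrow> 'a set \<Rightarrow> ('g \<Rightarrow> 'a) measure topology" where
  "weak_star G A = topology_generated_by
     {{M \<in> Prob (carrier G) A. (\<integral>x. f x \<partial>M) \<in> U} | f (U :: real set).
        continuous_map (product_topology (\<lambda>_. discrete_topology A) (carrier G)) euclideanreal f
        \<and> open U}"

definition locally_empirically_converges ::
  "('g, 'm) monoid_scheme \<Rightarrow> 'a set \<Rightarrow> (nat \<Rightarrow> 'v set) \<Rightarrow> (nat \<Rightarrow> 'g \<Rightarrow> 'v \<Rightarrow> 'v)
     \<Rightarrow> (nat \<Rightarrow> ('v \<Rightarrow> 'a) measure) \<Rightarrow> ('g \<Rightarrow> 'a) measure \<Rightarrow> bool" where
  "locally_empirically_converges G A V \<sigma> M \<mu> \<longleftrightarrow>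
     (\<forall>\<O>. openin (weak_star G A) \<O> \<and> \<mu> \<in> \<O> \<longrightarrow>
        (\<lambda>n. real (card {v\<in>V n.
                 distr (M n) (config (carrier G) A) (\<lambda>a. pullback_name G (\<sigma> n) a v) \<in> \<O>})
               / real (card (V n))) \<longlonglongrightarrow> 1 \<and>
        (\<lambda>n. measure (M n) {a \<in> space (M n). empirical G A (V n) (\<sigma> n) a \<in> \<O>}) \<longlonglongrightarrow> 1)"

section \<open>Metrics on sofic approximations\<close>

definition proper_right_invariant_metric ::
  "('g, 'm) monoid_scheme \<Rightarrow> ('g \<Rightarrow> 'g \<Rightarrow> real) \<Rightarrow> bool" where
  "proper_right_invariant_metric G \<rho> \<longleftrightarrow>
     Metric_space (carrier G) \<rho> \<and>
     (\<forall>x\<in>carrier G. \<forall>r. finite (Metric_space.mcball (carrier G) \<rho> x r)) \<and>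
     (\<forall>x\<in>carrier G. \<forall>y\<in>carrier G. \<forall>g\<in>carrier G. \<rho> (x \<otimes>\<^bsub>G\<^esub> g) (y \<otimes>\<^bsub>G\<^esub> g) = \<rho> x y)"

text \<open>An undirected graph is represented by its symmetric set of arcs.\<close>

definition action_graph ::
  "('g, 'm) monoid_scheme \<Rightarrow> 'v set \<Rightarrow> ('g \<Rightarrow> 'v \<Rightarrow> 'v) \<Rightarrow> ('v, 'v \<times> 'v) pre_digraph" where
  "action_graph G V \<sigma> = with_proj \<lparr> pverts = V,
     parcs = {(v, w). v \<in> V \<and> w \<in> V \<and> (\<exists>g\<in>carrier G. \<sigma> g v = w \<or> \<sigma> g w = v)} \<rparr>"

text \<open>
  The set of weights may be infinite, but for an edge \<open>(v, w)\<close> and a proper metric its infimum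
  is attained, so it is a minimum.
\<close>

definition edge_weight ::
  "('g, 'm) monoid_scheme \<Rightarrow> ('g \<Rightarrow> 'g \<Rightarrow> real) \<Rightarrow> ('g \<Rightarrow> 'v \<Rightarrow> 'v) \<Rightarrow> 'v \<times> 'v \<Rightarrow> real" where
  "edge_weight G \<rho> \<sigma> = (\<lambda>(v, w).
     Inf {\<rho> g \<one>\<^bsub>G\<^esub> | g. g \<in> carrier G \<and> (\<sigma> g v = w \<or> \<sigma> g w = v)})"

definition component_dist ::
  "('g, 'm) monoid_scheme \<Rightarrow> ('g \<Rightarrow> 'g \<Rightarrow> real) \<Rightarrow> 'v set \<Rightarrow> ('g \<Rightarrow> 'v \<Rightarrow> 'v)
     \<Rightarrow> 'v \<Rightarrow> 'v \<Rightarrow> real" where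
  "component_dist G \<rho> V \<sigma> v w =
     real_of_ereal (wf_digraph.\<mu> (action_graph G V \<sigma>) (edge_weight G \<rho> \<sigma>) v w)"

text \<open>\<open>D\<close> is the distance assigned to points in distinct components.\<close>

definition sofic_dist ::
  "('g, 'm) monoid_scheme \<Rightarrow> ('g \<Rightarrow> 'g \<Rightarrow> real) \<Rightarrow> 'v set \<Rightarrow> ('g \<Rightarrow> 'v \<Rightarrow> 'v) \<Rightarrow> real
     \<Rightarrow> 'v \<Rightarrow> 'v \<Rightarrow> real" where
  "sofic_dist G \<rho> V \<sigma> D v w =
     (if v \<rightarrow>\<^sup>*\<^bsub>action_graph G V \<sigma>\<^esub> w then component_dist G \<rho> V \<sigma> v w else D)"

definition exceeds_component_dists ::
  "('g, 'm) monoid_scheme \<Rightarrow> ('g \<Rightarrow> 'g \<Rightarrow> real) \<Rightarrow> 'v set \<Rightarrow> ('g \<Rightarrow> 'v \<Rightarrow> 'v) \<Rightarrow> real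
     \<Rightarrow> bool" where
  "exceeds_component_dists G \<rho> V \<sigma> D \<longleftrightarrow>
     (\<forall>v\<in>V. \<forall>w\<in>V. v \<rightarrow>\<^sup>*\<^bsub>action_graph G V \<sigma>\<^esub> w \<longrightarrow> component_dist G \<rho> V \<sigma> v w < D)"

definition separated :: "('v \<Rightarrow> 'v \<Rightarrow> real) \<Rightarrow> real \<Rightarrow> 'v set \<Rightarrow> bool" where
  "separated d r S \<longleftrightarrow> (\<forall>v\<in>S. \<forall>w\<in>S. v \<noteq> w \<longrightarrow> r \<le> d v w)"

section \<open>Uniform model-mixing\<close>

definition sofic_image :: "('g \<Rightarrow> 'v \<Rightarrow> 'v) \<Rightarrow> 'g set \<Rightarrow> 'v set \<Rightarrow> 'v set" where
  "sofic_image \<sigma> F S = {\<sigma> g s | g s. g \<in> F \<and> s \<in> S}"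

text \<open>\<open>d n\<close> is the distance on \<open>V n\<close> and \<open>\<mu>\<close> the limiting process.\<close>

definition uniformly_model_mixing ::
  "('g, 'm) monoid_scheme \<Rightarrow> 'a set \<Rightarrow> (nat \<Rightarrow> 'v set) \<Rightarrow> (nat \<Rightarrow> 'g \<Rightarrow> 'v \<Rightarrow> 'v)
     \<Rightarrow> (nat \<Rightarrow> 'v \<Rightarrow> 'v \<Rightarrow> real) \<Rightarrow> (nat \<Rightarrow> ('v \<Rightarrow> 'a) measure) \<Rightarrow> ('g \<Rightarrow> 'a) measure \<Rightarrow> bool"
  where
  "uniformly_model_mixing G A V \<sigma> d M \<mu> \<longleftrightarrow>
     (\<forall>F\<subseteq>carrier G. \<forall>\<epsilon>>0. finite F \<longrightarrow>
        (\<exists>(r :: real) W. (\<forall>n. W n \<subseteq> V n) \<and>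
           (\<lambda>n. real (card (W n)) / real (card (V n))) \<longlonglongrightarrow> 1 \<and>
           (\<forall>n. \<forall>S\<subseteq>W n. separated (d n) r S \<longrightarrow>
              shannon_entropy (marginal A (sofic_image (\<sigma> n) F S) (M n))
              \<ge> real (card S) * (shannon_entropy (marginal A F \<mu>) - \<epsilon>))))"

end

theory Submission
  imports Defs
begin

text \<open>
  Let \<open>\<tau>\<close> be the permutation of \<open>V n\<close> by which the generator of \<open>H\<close> acts.  Cut its cycles into blocks
  whose length tends to infinity so slowly that the sofic approximation is still accurate at the scale
  of the blocks, and let \<open>\<mu>\<^sub>n\<close> place an independent copy of \<open>\<nu>\<close> on every block.  For most \<open>v\<close> and a fixed
  finite \<open>F\<close>, the points \<open>\<sigma> g v\<close> with \<open>g \<in> F\<close> in one right coset of \<open>H\<close> lie in a common block, and those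
  from different cosets lie in different blocks.  Hence the law of the name of \<open>v\<close> on \<open>F\<close> is exactly
  the marginal of the coinduced process, which gives local convergence; as most pairs \<open>v\<close>, \<open>w\<close> involve
  disjoint sets of blocks, a second moment estimate gives empirical convergence.

  For a separated set \<open>S\<close> the entropy is the sum over the blocks of entropies of \<open>\<nu>\<close> on unions of
  windows.  The windows meeting a given block are far apart, so uniform mixing of \<open>\<nu>\<close> bounds each
  summand from below.
\<close>

section \<open>Entropy of finite-valued random variables\<close>

definition rv_entropy :: "'w measure \<Rightarrow> ('w \<Rightarrow> 'x) \<Rightarrow> real" where
  "rv_entropy M X = - (\<Sum>x\<in>X ` space M. measure M (X -` {x} \<inter> space M)
     * ln (measure M (X -` {x} \<inter> space M)))"

lemma rv_entropy_eq_entropy: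
  assumes "prob_space M" "simple_function M X"
  shows "rv_entropy M X = prob_space.entropy M (exp 1) (count_space (X ` space M)) X"
proof -
  interpret prob_space M by fact
  interpret information_space M "exp 1" by unfold_locales simp
  show ?thesis
    using entropy_simple_distributed[OF simple_distributedI[OF assms(2) measure_nonneg refl]]
    by (simp add: rv_entropy_def log_def)
qed

lemma shannon_entropy_distr:
  assumes "X \<in> measurable M N" "finite (space N)" "\<And>x. x \<in> space N \<Longrightarrow> {x} \<in> sets N"
  shows "shannon_entropy (distr M N X) = rv_entropy M X"
proof -
  have "X ` space M \<subseteq> space N" using assms(1) by (auto simp: measurable_def)
  moreover have "measure (distr M N X) {x} = measure M (X -` {x} \<inter> space M)" if "x \<in> space N" for x
    using assms that by (simp add: measure_distr)
  moreover have "X -` {x} \<inter> space M = {}" if "x \<notin> X ` space M" for x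
    using that by auto
  ultimately show ?thesis
    unfolding shannon_entropy_def rv_entropy_def
    by (auto intro!: sum.mono_neutral_cong_right assms(2))
qed

lemma simple_function_compose_arg:
  "simple_function M X \<Longrightarrow> simple_function M (\<lambda>x. f (X x))"
  using simple_function_compose[of M X f] by (simp add: comp_def)

lemma rv_entropy_mono:
  assumes "prob_space M" "simple_function M X" "\<And>x. x \<in> space M \<Longrightarrow> Y x = f (X x)"
  shows "rv_entropy M Y \<le> rv_entropy M X"
proof -
  interpret prob_space M by fact
  interpret information_space M "exp 1" by unfold_locales simp
  have "rv_entropy M Y = rv_entropy M (f \<circ> X)"
  proof -
    have "Y ` space M = (f \<circ> X) ` space M"
      by (rule image_cong) (auto simp: assms(3))
    moreover have "Y -` {y} \<inter> space M = (f \<circ> X) -` {y} \<inter> space M" for y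
      by (auto simp: assms(3))
    ultimately show ?thesis by (simp add: rv_entropy_def)
  qed
  then show ?thesis
    using entropy_data_processing[OF assms(2), of f] rv_entropy_eq_entropy[OF assms(1,2)]
      rv_entropy_eq_entropy[OF assms(1) simple_function_compose[OF assms(2)], of f]
    by simp
qed

lemma (in prob_space) prob_image_sum:
  assumes "simple_function M W"
  shows "(\<Sum>w\<in>W ` space M. prob (W -` {w} \<inter> space M) * g (f w)) =
    (\<Sum>u\<in>(\<lambda>x. f (W x)) ` space M. prob ((\<lambda>x. f (W x)) -` {u} \<inter> space M) * g u)"
proof -
  have fin: "finite (W ` space M)" using assms by (simp add: simple_functionD)
  have "prob ((\<lambda>x. f (W x)) -` {u} \<inter> space M) =
    (\<Sum>w\<in>{w \<in> W ` space M. f w = u}. prob (W -` {w} \<inter> space M))" for u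
  proof -
    have "(\<lambda>x. f (W x)) -` {u} \<inter> space M = (\<Union>w\<in>{w \<in> W ` space M. f w = u}. W -` {w} \<inter> space M)"
      by auto
    then show ?thesis
      using fin simple_functionD(2)[OF assms]
      by (simp only:) (rule finite_measure_finite_Union; auto simp: disjoint_family_on_def)
  qed
  then show ?thesis
    by (simp add: sum.image_gen[OF fin, of _ f] image_image sum_distrib_right)
qed

lemma rv_entropy_submodular:
  assumes "prob_space M" "simple_function M X" "simple_function M Y"
  shows "rv_entropy M (\<lambda>x. (X x, Y x)) + rv_entropy M (\<lambda>x. f (Y x))
    \<le> rv_entropy M (\<lambda>x. (X x, f (Y x))) + rv_entropy M Y"
proof -
  interpret prob_space M by fact
  interpret information_space M "exp 1" by unfold_locales simp
  let ?p = "\<lambda>X x. prob (X -` {x} \<inter> space M)"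
  let ?Z = "\<lambda>x. f (Y x)" and ?W = "\<lambda>x. (X x, Y x, f (Y x))"
  have Z: "simple_function M ?Z" by (rule simple_function_compose_arg[OF assms(3)])
  note sd = simple_distributedI[OF _ measure_nonneg refl]
  have W: "simple_function M ?W" by (intro simple_function_Pair assms Z)
  have XZ: "simple_function M (\<lambda>x. (X x, ?Z x))" and YZ: "simple_function M (\<lambda>x. (Y x, ?Z x))"
    by (intro simple_function_Pair assms Z)+
  let ?L = "\<lambda>V x. ln (?p V x)"
  have "0 \<le> conditional_mutual_information (exp 1) (count_space (X ` space M))
     (count_space (Y ` space M)) (count_space (?Z ` space M)) X Y ?Z"
    by (rule conditional_mutual_information_nonneg[OF assms(2,3) Z])
  also have "\<dots> = (\<Sum>(x, y, z)\<in>?W ` space M. ?p ?W (x, y, z) *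
      log (exp 1) (?p ?W (x, y, z) / (?p (\<lambda>x. (X x, ?Z x)) (x, z) * (?p (\<lambda>x. (Y x, ?Z x)) (y, z) / ?p ?Z z))))"
    by (rule conditional_mutual_information_eq[OF sd[OF Z] sd[OF YZ] sd[OF XZ] sd[OF W]])
  also have "\<dots> = (\<Sum>w\<in>?W ` space M. ?p ?W w * ?L ?W w)
     + (\<Sum>w\<in>?W ` space M. ?p ?W w * ?L ?Z (snd (snd w)))
     - (\<Sum>w\<in>?W ` space M. ?p ?W w * ?L (\<lambda>x. (X x, ?Z x)) (fst w, snd (snd w)))
     - (\<Sum>w\<in>?W ` space M. ?p ?W w * ?L (\<lambda>x. (Y x, ?Z x)) (snd w))"
    unfolding sum.distrib[symmetric] sum_subtractf[symmetric]
  proof (rule sum.cong[OF refl])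
    fix w assume w: "w \<in> ?W ` space M"
    obtain x y z where [simp]: "w = (x, y, z)" by (cases w) auto
    show "(case w of (x, y, z) \<Rightarrow> ?p ?W (x, y, z) *
      log (exp 1) (?p ?W (x, y, z) / (?p (\<lambda>x. (X x, ?Z x)) (x, z) * (?p (\<lambda>x. (Y x, ?Z x)) (y, z) / ?p ?Z z))))
      = ?p ?W w * ?L ?W w + ?p ?W w * ?L ?Z (snd (snd w))
       - ?p ?W w * ?L (\<lambda>x. (X x, ?Z x)) (fst w, snd (snd w)) - ?p ?W w * ?L (\<lambda>x. (Y x, ?Z x)) (snd w)"
    proof (cases "?p ?W w = 0")
      case False
      then have pos: "0 < ?p ?W w" by (simp add: zero_less_measure_iff)
      have "?p ?W w \<le> ?p ?Z z" "?p ?W w \<le> ?p (\<lambda>x. (X x, ?Z x)) (x, z)"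
        "?p ?W w \<le> ?p (\<lambda>x. (Y x, ?Z x)) (y, z)"
        by (intro finite_measure_mono simple_functionD(2) Z XZ YZ, force)+
      with pos have "0 < ?p ?Z z" "0 < ?p (\<lambda>x. (X x, ?Z x)) (x, z)"
        "0 < ?p (\<lambda>x. (Y x, ?Z x)) (y, z)" by linarith+
      with pos show ?thesis
        by (simp add: log_def ln_div ln_mult algebra_simps)
    qed simp
  qed
  also have "(\<Sum>w\<in>?W ` space M. ?p ?W w * ?L ?W w) = - rv_entropy M (\<lambda>x. (X x, Y x))"
  proof -
    have "rv_entropy M ?W = rv_entropy M (\<lambda>x. (X x, Y x))"
      by (rule antisym; rule rv_entropy_mono[where f = "\<lambda>w. (fst w, snd w, f (snd w))"]
          rv_entropy_mono[where f = "\<lambda>w. (fst w, fst (snd w))"])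
        (auto intro!: simple_function_Pair assms Z)
    then show ?thesis by (simp add: rv_entropy_def)
  qed
  also have "(\<Sum>w\<in>?W ` space M. ?p ?W w * ?L ?Z (snd (snd w))) = - rv_entropy M ?Z"
    using prob_image_sum[OF W, of "?L ?Z" "\<lambda>w. snd (snd w)"] by (simp add: rv_entropy_def)
  also have "(\<Sum>w\<in>?W ` space M. ?p ?W w * ?L (\<lambda>x. (X x, ?Z x)) (fst w, snd (snd w)))
    = - rv_entropy M (\<lambda>x. (X x, ?Z x))"
    using prob_image_sum[OF W, of "?L (\<lambda>x. (X x, ?Z x))" "\<lambda>w. (fst w, snd (snd w))"]
    by (simp add: rv_entropy_def)
  also have "(\<Sum>w\<in>?W ` space M. ?p ?W w * ?L (\<lambda>x. (Y x, ?Z x)) (snd w)) = - rv_entropy M (\<lambda>x. (Y x, ?Z x))"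
    using prob_image_sum[OF W, of "?L (\<lambda>x. (Y x, ?Z x))" snd]
    by (simp add: rv_entropy_def)
  also have "rv_entropy M (\<lambda>x. (Y x, ?Z x)) = rv_entropy M Y"
    by (rule antisym; rule rv_entropy_mono[where f = "\<lambda>w. (w, f w)"]
          rv_entropy_mono[where f = fst])
        (auto intro!: simple_function_Pair assms Z)
  finally show ?thesis by simp
qed

lemma sets_config_finite:
  assumes "finite S" "finite A"
  shows "sets (config S A) = Pow (S \<rightarrow>\<^sub>E A)"
proof
  show "sets (config S A) \<subseteq> Pow (S \<rightarrow>\<^sub>E A)"
    using sets.sets_into_space[of _ "config S A"] by (auto simp: config_def space_PiM)
  have "{x} \<in> sets (config S A)" if "x \<in> S \<rightarrow>\<^sub>E A" for x
  proof -
    have "{x} = (\<Pi>\<^sub>E i\<in>S. {x i})" using that PiE_singleton[of x S] by (simp add: PiE_iff)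
    moreover have "(\<Pi>\<^sub>E i\<in>S. {x i}) \<in> sets (config S A)" unfolding config_def
      using that assms by (intro sets_PiM_I_finite) auto
    ultimately show ?thesis by simp
  qed
  then have "(\<Union>x\<in>X. {x}) \<in> sets (config S A)" if "X \<subseteq> S \<rightarrow>\<^sub>E A" for X
    using that finite_subset[OF that] finite_PiE[OF assms(1), of "\<lambda>_. A"] assms(2)
    by (intro sets.finite_UN) auto
  then show "Pow (S \<rightarrow>\<^sub>E A) \<subseteq> sets (config S A)" by auto
qed

lemma space_config: "space (config S A) = S \<rightarrow>\<^sub>E A"
  by (simp add: config_def space_PiM)

lemma measurable_imp_simple_function:
  assumes "X \<in> measurable M N" "finite (space N)" "\<And>x. x \<in> space N \<Longrightarrow> {x} \<in> sets N"
  shows "simple_function M X"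
proof -
  have "X ` space M \<subseteq> space N" using assms(1) by (auto simp: measurable_def)
  then show ?thesis
    using assms by (auto simp: simple_function_def intro: finite_subset measurable_sets)
qed

lemma restrict_measurable_config:
  assumes "M \<in> Prob S A" "U \<subseteq> S"
  shows "(\<lambda>x. restrict x U) \<in> measurable M (config U A)"
proof -
  have "(\<lambda>x. restrict x U) \<in> measurable (config S A) (config U A)"
    unfolding config_def by (rule measurable_restrict_subset[OF assms(2)])
  then show ?thesis using assms(1) measurable_cong_sets[of M "config S A"] by (auto simp: Prob_def)
qed

lemma Prob_space:
  assumes "M \<in> Prob S A"
  shows "space M = S \<rightarrow>\<^sub>E A"
  using assms sets_eq_imp_space_eq[of M "config S A"] by (simp add: Prob_def space_config)

lemma simple_function_restrict:
  assumes "M \<in> Prob S A" "U \<subseteq> S" "finite U" "finite A"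
  shows "simple_function M (\<lambda>x. restrict x U)"
  by (rule measurable_imp_simple_function[OF restrict_measurable_config[OF assms(1,2)]])
    (use assms in \<open>auto simp: space_config sets_config_finite intro: finite_PiE\<close>)

lemma shannon_entropy_marginal:
  assumes "M \<in> Prob S A" "U \<subseteq> S" "finite U" "finite A"
  shows "shannon_entropy (marginal A U M) = rv_entropy M (\<lambda>x. restrict x U)"
  unfolding marginal_def
  by (rule shannon_entropy_distr[OF restrict_measurable_config[OF assms(1,2)]])
    (use assms in \<open>auto simp: space_config sets_config_finite intro: finite_PiE\<close>)

lemma shannon_entropy_marginal_cylinders:
  assumes "M \<in> Prob S A" "U \<subseteq> S" "finite U" "finite A"
  shows "shannon_entropy (marginal A U M) =
    - (\<Sum>z\<in>U \<rightarrow>\<^sub>E A. measure M {x \<in> space M. \<forall>u\<in>U. x u = z u}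
        * ln (measure M {x \<in> space M. \<forall>u\<in>U. x u = z u}))"
proof -
  have "measure (marginal A U M) {z} = measure M {x \<in> space M. \<forall>u\<in>U. x u = z u}"
    if "z \<in> U \<rightarrow>\<^sub>E A" for z
  proof -
    have "(\<lambda>x. restrict x U) -` {z} \<inter> space M = {x \<in> space M. \<forall>u\<in>U. x u = z u}"
      using that by (auto simp: fun_eq_iff restrict_def PiE_iff extensional_def)
    then show ?thesis unfolding marginal_def
      using that assms
      by (subst measure_distr[OF restrict_measurable_config[OF assms(1,2)]])
         (auto simp: sets_config_finite)
  qed
  moreover have "space (marginal A U M) = U \<rightarrow>\<^sub>E A" by (simp add: marginal_def space_config)
  ultimately show ?thesis by (simp add: shannon_entropy_def)
qed

lemma cylinder_in_sets:
  assumes "M \<in> Prob S A" "F \<subseteq> S" "finite F"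
  shows "{x \<in> space M. \<forall>g\<in>F. x g = z g} \<in> sets M"
proof -
  have sets: "sets M = sets (config S A)" using assms by (simp add: Prob_def)
  have "{x \<in> space M. x g = z g} \<in> sets M" if "g \<in> F" for g
  proof -
    have "(\<lambda>x. x g) \<in> measurable M (count_space A)"
      using that assms measurable_component_singleton[of g S "\<lambda>_. count_space A"]
      unfolding measurable_cong_sets[OF sets refl] by (auto simp: config_def)
    moreover have "{z g} \<inter> A \<in> sets (count_space A)" by simp
    ultimately have "(\<lambda>x. x g) -` ({z g} \<inter> A) \<inter> space M \<in> sets M" by (rule measurable_sets)
    moreover have "x g \<in> A" if "x \<in> space M" for x
      using that assms(2) \<open>g \<in> F\<close> unfolding Prob_space[OF assms(1)] by (meson PiE_mem subsetD)
    then have "(\<lambda>x. x g) -` ({z g} \<inter> A) \<inter> space M = {x \<in> space M. x g = z g}" by auto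
    ultimately show ?thesis by simp
  qed
  then show ?thesis using assms(3) by (intro sets.sets_Collect_finite_All) auto
qed

lemma marginal_entropy_mono:
  assumes "M \<in> Prob S A" "U \<subseteq> U'" "U' \<subseteq> S" "finite U'" "finite A"
  shows "shannon_entropy (marginal A U M) \<le> shannon_entropy (marginal A U' M)"
proof -
  have "finite U" "U \<subseteq> S" using assms finite_subset by auto
  then show ?thesis
    using assms
    by (simp add: shannon_entropy_marginal[OF assms(1)])
      (rule rv_entropy_mono[where f = "\<lambda>x. restrict x U"],
        auto simp: Prob_def Int_absorb1 intro: simple_function_restrict[OF assms(1)])
qed

lemma marginal_entropy_submodular:
  assumes "M \<in> Prob S A" "U \<subseteq> S" "U' \<subseteq> S" "finite U" "finite U'" "finite A"
  shows "shannon_entropy (marginal A (U \<union> U') M) + shannon_entropy (marginal A (U \<inter> U') M)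
    \<le> shannon_entropy (marginal A U M) + shannon_entropy (marginal A U' M)"
proof -
  have M: "prob_space M" using assms by (simp add: Prob_def)
  note sf = simple_function_restrict[OF assms(1) _ _ assms(6)]
  let ?r = "\<lambda>U x. restrict x U" and ?UU = "\<lambda>x. restrict (restrict x U') (U \<inter> U')"
  have "rv_entropy M (?r (U \<union> U')) \<le> rv_entropy M (\<lambda>x. (?r U x, ?r U' x))"
    using assms
    by (intro rv_entropy_mono[where f = "\<lambda>(x, y). \<lambda>u\<in>U \<union> U'. if u \<in> U then x u else y u"] M
        simple_function_Pair sf) (auto simp: fun_eq_iff)
  moreover have "rv_entropy M (?r (U \<inter> U')) \<le> rv_entropy M ?UU"
    using assms
    by (intro rv_entropy_mono[where f = "\<lambda>x. x"] M simple_function_compose_arg[OF sf]) auto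
  moreover have "rv_entropy M (\<lambda>x. (?r U x, ?UU x)) \<le> rv_entropy M (?r U)"
    using assms
    by (intro rv_entropy_mono[where f = "\<lambda>x. (x, restrict x (U \<inter> U'))"] M sf) auto
  moreover have "rv_entropy M (\<lambda>x. (?r U x, ?r U' x)) + rv_entropy M ?UU
    \<le> rv_entropy M (\<lambda>x. (?r U x, ?UU x)) + rv_entropy M (?r U')"
    using assms by (intro rv_entropy_submodular M sf) auto
  ultimately show ?thesis
    using assms by (simp add: shannon_entropy_marginal[OF assms(1)] le_infI1)
qed

lemma submodular_Union_le:
  fixes h :: "'x set \<Rightarrow> real"
  assumes mono: "\<And>U U'. U \<subseteq> U' \<Longrightarrow> finite U' \<Longrightarrow> h U \<le> h U'"
    and submod: "\<And>U U'. finite U \<Longrightarrow> finite U' \<Longrightarrow> h (U \<union> U') + h (U \<inter> U') \<le> h U + h U'"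
    and "finite I" "\<And>i. i \<in> I \<Longrightarrow> finite (X i)" "\<And>i. i \<in> I \<Longrightarrow> Y i \<subseteq> X i"
  shows "h (\<Union>i\<in>I. X i) - h (\<Union>i\<in>I. Y i) \<le> (\<Sum>i\<in>I. h (X i) - h (Y i))"
  using assms(3-)
proof (induction I)
  case (insert k I)
  let ?X = "\<Union>i\<in>I. X i" and ?Y = "\<Union>i\<in>I. Y i"
  have fin: "finite ?X" "finite (X k)" "finite ?Y" "finite (Y k)" and sub: "?Y \<subseteq> ?X" "Y k \<subseteq> X k"
    using insert by (auto intro: finite_subset)
  have "h ((?X \<union> Y k) \<union> X k) + h ((?X \<union> Y k) \<inter> X k) \<le> h (?X \<union> Y k) + h (X k)"
    using fin by (intro submod) auto
  moreover have "h (Y k) \<le> h ((?X \<union> Y k) \<inter> X k)" using fin sub by (intro mono) auto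
  moreover have "h (?X \<union> (?Y \<union> Y k)) + h (?X \<inter> (?Y \<union> Y k)) \<le> h ?X + h (?Y \<union> Y k)"
    using fin by (intro submod) auto
  moreover have "h ?Y \<le> h (?X \<inter> (?Y \<union> Y k))" using fin sub by (intro mono) auto
  moreover have "(?X \<union> Y k) \<union> X k = (\<Union>i\<in>insert k I. X i)" "?X \<union> (?Y \<union> Y k) = ?X \<union> Y k"
    "?Y \<union> Y k = (\<Union>i\<in>insert k I. Y i)"
    using sub by auto
  ultimately have "h (\<Union>i\<in>insert k I. X i) - h (\<Union>i\<in>insert k I. Y i)
    \<le> (h (X k) - h (Y k)) + (h ?X - h ?Y)" by simp
  also have "h ?X - h ?Y \<le> (\<Sum>i\<in>I. h (X i) - h (Y i))" using insert by auto
  finally show ?case using insert by simp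
qed simp

section \<open>Processes over the integers\<close>

lemma shift_integer_group: "shift integer_group k a = (\<lambda>i. a (i + k))"
  by (simp add: shift_def integer_group_def restrict_def)

lemma shift_measurable:
  "shift integer_group k \<in> measurable (config UNIV A) (config UNIV A)"
  unfolding config_def shift_integer_group
  by (rule measurable_PiM_single')
    (auto simp: space_PiM PiE_iff intro: measurable_component_singleton)

lemma process_integer_group:
  assumes "process integer_group A \<nu>"
  shows "\<nu> \<in> Prob UNIV A" "distr \<nu> (config UNIV A) (shift integer_group k) = \<nu>"
  using assms by (auto simp: process_def)

lemma process_shift_measurable:
  assumes "process integer_group A \<nu>"
  shows "shift integer_group k \<in> measurable \<nu> (config UNIV A)"
  using shift_measurable process_integer_group(1)[OF assms]
    measurable_cong_sets[of \<nu> "config UNIV A" "config UNIV A" "config UNIV A"]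
  by (auto simp: Prob_def)

lemma process_cylinder_shift:
  assumes "process integer_group A \<nu>" "finite F"
  shows "measure \<nu> {y \<in> space \<nu>. \<forall>g\<in>F. y (p g + k) = z g} = measure \<nu> {y \<in> space \<nu>. \<forall>g\<in>F. y (p g) = z g}"
proof -
  note \<nu> = process_integer_group[OF assms(1)]
  let ?C = "{y \<in> space \<nu>. \<forall>g\<in>F. y (p g) = z g}"
  have "{y \<in> space \<nu>. \<forall>g\<in>{g}. y (p g) = z g} \<in> sets \<nu>" for g
    using cylinder_in_sets[OF \<nu>(1), of "{p g}" "\<lambda>_. z g"] by simp
  then have "?C \<in> sets \<nu>" using assms(2) by (intro sets.sets_Collect_finite_All) auto
  then have C: "?C \<in> sets (config UNIV A)" using \<nu>(1) by (simp add: Prob_def)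
  have "measure \<nu> ?C = measure (distr \<nu> (config UNIV A) (shift integer_group k)) ?C"
    by (simp add: \<nu>(2))
  also have "\<dots> = measure \<nu> (shift integer_group k -` ?C \<inter> space \<nu>)"
    by (rule measure_distr[OF process_shift_measurable[OF assms(1)] C])
  also have "shift integer_group k -` ?C \<inter> space \<nu> = {y \<in> space \<nu>. \<forall>g\<in>F. y (p g + k) = z g}"
    by (auto simp: shift_integer_group Prob_space[OF \<nu>(1)] PiE_iff)
  finally show ?thesis by simp
qed

lemma process_entropy_shift:
  assumes "process integer_group A \<nu>" "finite A" "finite U"
  shows "shannon_entropy (marginal A ((+) k ` U) \<nu>) = shannon_entropy (marginal A U \<nu>)"
proof -
  note \<nu> = process_integer_group[OF assms(1)]
  have "shannon_entropy (marginal A ((+) k ` U) \<nu>) = - (\<Sum>z\<in>((+) k ` U) \<rightarrow>\<^sub>E A.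
      measure \<nu> {x \<in> space \<nu>. \<forall>u\<in>(+) k ` U. x u = z u}
        * ln (measure \<nu> {x \<in> space \<nu>. \<forall>u\<in>(+) k ` U. x u = z u}))"
    using assms by (intro shannon_entropy_marginal_cylinders[OF \<nu>(1)]) auto
  also have "\<dots> = - (\<Sum>z\<in>U \<rightarrow>\<^sub>E A. measure \<nu> {x \<in> space \<nu>. \<forall>u\<in>U. x u = z u}
        * ln (measure \<nu> {x \<in> space \<nu>. \<forall>u\<in>U. x u = z u}))"
  proof (intro arg_cong[where f = uminus] sum.reindex_bij_witness[where
        i = "\<lambda>z. \<lambda>u\<in>(+) k ` U. z (u - k)" and j = "\<lambda>z. \<lambda>u\<in>U. z (u + k)"])
    fix z assume "z \<in> (+) k ` U \<rightarrow>\<^sub>E A"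
    have "measure \<nu> {x \<in> space \<nu>. \<forall>u\<in>U. x u = (\<lambda>u\<in>U. z (u + k)) u}
      = measure \<nu> {x \<in> space \<nu>. \<forall>u\<in>U. x (u + k) = z (u + k)}"
      using process_cylinder_shift[OF assms(1,3), of "\<lambda>u. u" k "\<lambda>u. z (u + k)"] by simp
    also have "{x \<in> space \<nu>. \<forall>u\<in>U. x (u + k) = z (u + k)} = {x \<in> space \<nu>. \<forall>u\<in>(+) k ` U. x u = z u}"
      by (auto simp: add.commute)
    finally show "measure \<nu> {x \<in> space \<nu>. \<forall>u\<in>U. x u = (\<lambda>u\<in>U. z (u + k)) u}
        * ln (measure \<nu> {x \<in> space \<nu>. \<forall>u\<in>U. x u = (\<lambda>u\<in>U. z (u + k)) u})
      = measure \<nu> {x \<in> space \<nu>. \<forall>u\<in>(+) k ` U. x u = z u}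
        * ln (measure \<nu> {x \<in> space \<nu>. \<forall>u\<in>(+) k ` U. x u = z u})" by simp
  qed (auto simp: PiE_iff extensional_def fun_eq_iff add.commute)
  also have "\<dots> = shannon_entropy (marginal A U \<nu>)"
    using assms by (intro shannon_entropy_marginal_cylinders[OF \<nu>(1), symmetric]) auto
  finally show ?thesis .
qed

text \<open>
  Uniform mixing is applied to a labelling of the patterns on \<open>J\<close>; submodularity then passes from
  the full windows \<open>q i + J\<close> to sub-windows \<open>q i + J' i\<close>, which may vary with \<open>i\<close>.
\<close>

lemma uniformly_mixing_windows:
  assumes proc: "process integer_group A \<nu>" and mix: "uniformly_mixing integer_group A \<nu>"
    and fin: "finite A" "finite J" and "\<epsilon> > 0"
  shows "\<exists>N::nat. \<forall>(I :: 'i set) (q :: 'i \<Rightarrow> int) J'. finite I \<longrightarrow>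
      (\<forall>i\<in>I. \<forall>i'\<in>I. i \<noteq> i' \<longrightarrow> int N < \<bar>q i - q i'\<bar>) \<longrightarrow> (\<forall>i\<in>I. J' i \<subseteq> J) \<longrightarrow>
      (\<Sum>i\<in>I. shannon_entropy (marginal A (J' i) \<nu>) - \<epsilon>)
        \<le> shannon_entropy (marginal A (\<Union>i\<in>I. (+) (q i) ` J' i) \<nu>)"
proof -
  note \<nu> = process_integer_group[OF proc]
  have P: "prob_space \<nu>" using \<nu>(1) by (simp add: Prob_def)
  define h where "h U = shannon_entropy (marginal A U \<nu>)" for U
  have h: "h U = rv_entropy \<nu> (\<lambda>x. restrict x U)" if "finite U" for U
    unfolding h_def by (rule shannon_entropy_marginal[OF \<nu>(1) _ that fin(1)]) simp
  have finJ: "finite (J \<rightarrow>\<^sub>E A)" using fin by (simp add: finite_PiE)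
  define enc :: "(int \<Rightarrow> 'a) \<Rightarrow> nat" where "enc = to_nat_on (J \<rightarrow>\<^sub>E A)"
  define dec where "dec = inv_into (J \<rightarrow>\<^sub>E A) enc"
  have inj: "inj_on enc (J \<rightarrow>\<^sub>E A)" unfolding enc_def
    by (rule inj_on_to_nat_on[OF countable_finite[OF finJ]])
  define B where "B = enc ` (J \<rightarrow>\<^sub>E A)"
  define \<phi> where "\<phi> = (\<lambda>a. enc (restrict a J))"
  have finB: "finite B" by (simp add: B_def finJ)
  have \<phi>: "\<phi> \<in> measurable (config UNIV A) (count_space B)"
  proof -
    have "(\<lambda>a. restrict a J) \<in> measurable (config UNIV A) (config J A)"
      unfolding config_def by (rule measurable_restrict_subset) simp
    moreover have "enc \<in> measurable (config J A) (count_space B)"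
      by (rule measurableI) (auto simp: B_def sets_config_finite[OF fin(2,1)] space_config)
    ultimately show ?thesis unfolding \<phi>_def by (rule measurable_compose)
  qed
  have sets: "sets \<nu> = sets (config UNIV A)" using \<nu>(1) by (simp add: Prob_def)
  have \<phi>\<nu>: "\<phi> \<in> measurable \<nu> (count_space B)"
    using \<phi> unfolding measurable_cong_sets[OF sets refl] .
  have H\<phi>: "h J \<le> shannon_entropy (distr \<nu> (count_space B) \<phi>)"
  proof -
    have "rv_entropy \<nu> (\<lambda>x. restrict x J) \<le> rv_entropy \<nu> \<phi>"
    proof (rule rv_entropy_mono[OF P, where f = dec])
      show "simple_function \<nu> \<phi>" by (rule measurable_imp_simple_function[OF \<phi>\<nu>]) (auto simp: finB)
      show "restrict x J = dec (\<phi> x)" if "x \<in> space \<nu>" for x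
        using that inj by (simp add: dec_def \<phi>_def Prob_space[OF \<nu>(1)] PiE_iff)
    qed
    moreover have "shannon_entropy (distr \<nu> (count_space B) \<phi>) = rv_entropy \<nu> \<phi>"
      by (rule shannon_entropy_distr[OF \<phi>\<nu>]) (auto simp: finB)
    ultimately show ?thesis by (simp add: h fin)
  qed
  obtain K where K: "finite K" and mixK: "\<And>S. finite S \<Longrightarrow> spread integer_group K S \<Longrightarrow>
      real (card S) * (shannon_entropy (distr \<nu> (count_space B) \<phi>) - \<epsilon>) \<le>
      shannon_entropy (marginal B S (distr \<nu> (config UNIV B) (equivariant_map integer_group \<phi>)))"
    using mix[unfolded uniformly_mixing_def, rule_format, of \<epsilon> B \<phi>] \<open>\<epsilon> > 0\<close> finB \<phi> by auto
  define N where "N = nat (Max (insert 0 (abs ` K)))"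
  have N: "\<bar>k\<bar> \<le> int N" if "k \<in> K" for k
    using Max_ge[of "insert 0 (abs ` K)" "\<bar>k\<bar>"] that K by (simp add: N_def)
  have full: "real (card S) * (h J - \<epsilon>) \<le> h (\<Union>s\<in>S. (+) s ` J)"
    if S: "finite S" and sp: "\<And>s t. s \<in> S \<Longrightarrow> t \<in> S \<Longrightarrow> s \<noteq> t \<Longrightarrow> int N < \<bar>s - t\<bar>" for S
  proof -
    let ?E = "equivariant_map integer_group \<phi>" and ?U = "\<Union>s\<in>S. (+) s ` J"
    have E: "?E a = (\<lambda>g. \<phi> (shift integer_group g a))" for a
      by (simp add: equivariant_map_def restrict_def)
    have finU: "finite ?U" using S fin by auto
    have "spread integer_group K S"
      unfolding spread_def
    proof (intro ballI impI notI)
      fix s t assume "s \<in> S" "t \<in> S" "s \<noteq> t" "s \<otimes>\<^bsub>integer_group\<^esub> inv\<^bsub>integer_group\<^esub> t \<in> K"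
      then show False using sp[of s t] N[of "s - t"] by simp
    qed
    then have "real (card S) * (h J - \<epsilon>) \<le>
        shannon_entropy (marginal B S (distr \<nu> (config UNIV B) ?E))"
      using mixK[OF S] H\<phi> by (smt (verit) mult_left_mono of_nat_0_le_iff)
    also have "\<dots> \<le> h ?U"
    proof -
      have ME: "?E \<in> measurable \<nu> (config UNIV B)" unfolding config_def E
        using measurable_space[OF \<phi>]
        by (intro measurable_PiM_single' measurable_compose[OF process_shift_measurable[OF proc] \<phi>])
          (auto simp: Prob_space[OF \<nu>(1)] space_config shift_integer_group PiE_iff)
      have MS: "(\<lambda>x. restrict x S) \<in> measurable (config UNIV B) (config S B)"
        unfolding config_def by (rule measurable_restrict_subset) simp
      have "shannon_entropy (marginal B S (distr \<nu> (config UNIV B) ?E)) = rv_entropy \<nu> (\<lambda>a. restrict (?E a) S)"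
        unfolding marginal_def distr_distr[OF MS ME]
        by (subst shannon_entropy_distr[OF measurable_comp[OF ME MS]])
          (use S finB in \<open>auto simp: space_config sets_config_finite comp_def intro: finite_PiE\<close>)
      also have "\<dots> \<le> rv_entropy \<nu> (\<lambda>a. restrict a ?U)"
      proof (rule rv_entropy_mono[OF P, where f = "\<lambda>a. restrict (?E a) S"])
        show "simple_function \<nu> (\<lambda>a. restrict a ?U)"
          using finU fin by (intro simple_function_restrict[OF \<nu>(1)]) auto
        show "restrict (?E x) S = restrict (?E (restrict x ?U)) S" for x
        proof (rule restrict_ext)
          fix s assume "s \<in> S"
          then have "restrict (shift integer_group s x) J = restrict (shift integer_group s (restrict x ?U)) J"
            by (intro restrict_ext) (force simp: shift_integer_group)
          then show "?E x s = ?E (restrict x ?U) s" by (simp only: E) (simp only: \<phi>_def)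
        qed
      qed
      finally show ?thesis by (simp only: h[OF finU])
    qed
    finally show ?thesis .
  qed
  show ?thesis
  proof (intro exI[of _ N] allI impI)
    fix I :: "'i set" and q :: "'i \<Rightarrow> int" and J'
    assume I: "finite I" and sp: "\<forall>i\<in>I. \<forall>i'\<in>I. i \<noteq> i' \<longrightarrow> int N < \<bar>q i - q i'\<bar>"
      and J': "\<forall>i\<in>I. J' i \<subseteq> J"
    have injq: "inj_on q I"
      by (rule inj_onI) (use sp in force)
    have finJ': "finite (J' i)" if "i \<in> I" for i using J' that fin finite_subset by blast
    have hs: "h ((+) k ` U) = h U" if "finite U" for k U
      unfolding h_def by (rule process_entropy_shift[OF proc fin(1) that])
    have "real (card (q ` I)) * (h J - \<epsilon>) \<le> h (\<Union>s\<in>q ` I. (+) s ` J)"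
      using I sp by (intro full) auto
    then have "real (card I) * (h J - \<epsilon>) \<le> h (\<Union>i\<in>I. (+) (q i) ` J)"
      by (simp add: card_image[OF injq])
    moreover have "h (\<Union>i\<in>I. (+) (q i) ` J) - h (\<Union>i\<in>I. (+) (q i) ` J' i)
      \<le> (\<Sum>i\<in>I. h ((+) (q i) ` J) - h ((+) (q i) ` J' i))"
    proof (rule submodular_Union_le[OF _ _ I])
      show "h U \<le> h U'" if "U \<subseteq> U'" "finite U'" for U U'
        unfolding h_def using that fin by (intro marginal_entropy_mono[OF \<nu>(1)]) auto
      show "h (U \<union> U') + h (U \<inter> U') \<le> h U + h U'" if "finite U" "finite U'" for U U'
        unfolding h_def using that fin by (intro marginal_entropy_submodular[OF \<nu>(1)]) auto
    qed (use J' fin in auto)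
    moreover have "(\<Sum>i\<in>I. h ((+) (q i) ` J) - h ((+) (q i) ` J' i)) = (\<Sum>i\<in>I. h J - h (J' i))"
      using finJ' fin by (intro sum.cong refl) (simp add: hs)
    ultimately show "(\<Sum>i\<in>I. shannon_entropy (marginal A (J' i) \<nu>) - \<epsilon>)
        \<le> shannon_entropy (marginal A (\<Union>i\<in>I. (+) (q i) ` J' i) \<nu>)"
      by (simp add: sum_subtractf h_def[symmetric] algebra_simps)
  qed
qed

section \<open>Asymptotically almost all points\<close>

definition asymptotically_almost_all ::
  "(nat \<Rightarrow> 'v set) \<Rightarrow> (nat \<Rightarrow> 'v \<Rightarrow> bool) \<Rightarrow> bool" where
  "asymptotically_almost_all V P \<longleftrightarrow>
     (\<lambda>n. real (card {v \<in> V n. P n v}) / real (card (V n))) \<longlonglongrightarrow> 1"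

locale finite_approximation =
  fixes V :: "nat \<Rightarrow> 'v set"
  assumes finite_V: "finite (V n)"
    and card_V: "filterlim (\<lambda>n. card (V n)) at_top sequentially"
begin

abbreviation aaa :: "(nat \<Rightarrow> 'v \<Rightarrow> bool) \<Rightarrow> bool" where
  "aaa \<equiv> asymptotically_almost_all V"

lemma eventually_card_pos: "eventually (\<lambda>n. card (V n) > 0) sequentially"
  using card_V[unfolded filterlim_at_top, rule_format, of 1] by (rule eventually_mono) simp

lemma aaa_iff:
  "aaa P \<longleftrightarrow> (\<lambda>n. real (card {v \<in> V n. \<not> P n v}) / real (card (V n))) \<longlonglongrightarrow> 0"
proof -
  let ?f = "\<lambda>n. real (card {v \<in> V n. P n v}) / real (card (V n))"
  let ?g = "\<lambda>n. real (card {v \<in> V n. \<not> P n v}) / real (card (V n))"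
  have "eventually (\<lambda>n. ?g n = 1 - ?f n) sequentially"
    using eventually_card_pos
  proof eventually_elim
    case (elim n)
    have "card (V n) = card {v \<in> V n. P n v} + card {v \<in> V n. \<not> P n v}"
      using finite_V[of n] by (subst card_Un_disjoint[symmetric]) (auto intro: arg_cong[where f = card])
    then have "real (card {v \<in> V n. \<not> P n v}) = real (card (V n)) - real (card {v \<in> V n. P n v})" by simp
    then show ?case using elim by (simp add: diff_divide_distrib)
  qed
  then have eq: "(?g \<longlonglongrightarrow> 0) \<longleftrightarrow> ((\<lambda>n. 1 - ?f n) \<longlonglongrightarrow> 0)"
    by (rule tendsto_cong)
  have "?f \<longlonglongrightarrow> 1" if "(\<lambda>n. 1 - ?f n) \<longlonglongrightarrow> 0"
    using tendsto_diff[OF tendsto_const[of 1] that] by simp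
  moreover have "(\<lambda>n. 1 - ?f n) \<longlonglongrightarrow> 0" if "?f \<longlonglongrightarrow> 1"
    using tendsto_diff[OF tendsto_const[of 1] that] by simp
  ultimately show ?thesis unfolding asymptotically_almost_all_def eq by blast
qed

lemma aaa_mono:
  assumes "aaa P" "\<And>n v. v \<in> V n \<Longrightarrow> P n v \<Longrightarrow> Q n v"
  shows "aaa Q"
  unfolding aaa_iff
proof (rule Lim_null_comparison)
  show "(\<lambda>n. real (card {v \<in> V n. \<not> P n v}) / real (card (V n))) \<longlonglongrightarrow> 0"
    using assms(1) by (simp add: aaa_iff)
  show "\<forall>\<^sub>F n in sequentially. norm (real (card {v \<in> V n. \<not> Q n v}) / real (card (V n)))
    \<le> real (card {v \<in> V n. \<not> P n v}) / real (card (V n))"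
    using assms(2) finite_V
    by (intro always_eventually allI) (auto intro!: divide_right_mono card_mono)
qed

lemma aaa_conj:
  assumes "aaa P" "aaa Q"
  shows "aaa (\<lambda>n v. P n v \<and> Q n v)"
  unfolding aaa_iff
proof (rule Lim_null_comparison)
  show "(\<lambda>n. real (card {v \<in> V n. \<not> P n v}) / real (card (V n))
      + real (card {v \<in> V n. \<not> Q n v}) / real (card (V n))) \<longlonglongrightarrow> 0"
    using tendsto_add[of _ 0 _ _ 0] assms by (auto simp: aaa_iff)
  have "card {v \<in> V n. \<not> (P n v \<and> Q n v)} \<le> card {v \<in> V n. \<not> P n v} + card {v \<in> V n. \<not> Q n v}" for n
    by (rule order_trans[OF card_mono card_Un_le]) (use finite_V in auto)
  then have "real (card {v \<in> V n. \<not> (P n v \<and> Q n v)})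
    \<le> real (card {v \<in> V n. \<not> P n v}) + real (card {v \<in> V n. \<not> Q n v})" for n
    by (simp only: of_nat_add[symmetric] of_nat_le_iff)
  then show "\<forall>\<^sub>F n in sequentially. norm (real (card {v \<in> V n. \<not> (P n v \<and> Q n v)}) / real (card (V n)))
    \<le> real (card {v \<in> V n. \<not> P n v}) / real (card (V n))
      + real (card {v \<in> V n. \<not> Q n v}) / real (card (V n))"
    by (intro always_eventually allI) (simp add: add_divide_distrib[symmetric] divide_right_mono)
qed

lemma aaa_True: "aaa (\<lambda>n v. True)"
  unfolding aaa_iff by simp

lemma aaa_ball:
  assumes "finite I" "\<And>i. i \<in> I \<Longrightarrow> aaa (P i)"
  shows "aaa (\<lambda>n v. \<forall>i\<in>I. P i n v)"
  using assms
proof (induction I)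
  case (insert i I)
  then have "aaa (\<lambda>n v. P i n v \<and> (\<forall>i\<in>I. P i n v))" by (intro aaa_conj) auto
  then show ?case by (rule aaa_mono) auto
qed (simp add: aaa_True)

lemma aaa_permute:
  assumes "aaa P" "\<And>n. f n permutes V n"
  shows "aaa (\<lambda>n v. P n (f n v))"
proof -
  have "card {v \<in> V n. P n (f n v)} = card {v \<in> V n. P n v}" for n
  proof (rule bij_betw_same_card[of "f n"])
    show "bij_betw (f n) {v \<in> V n. P n (f n v)} {v \<in> V n. P n v}"
      by (rule bij_betwI[where g = "inv_into UNIV (f n)"])
        (auto simp: permutes_in_image[OF assms(2)] permutes_in_image[OF permutes_inv[OF assms(2)]]
          permutes_inverses[OF assms(2)])
  qed
  with assms(1) show ?thesis by (simp add: asymptotically_almost_all_def)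
qed

lemma aaa_eventually:
  assumes "aaa P" "e > 0"
  shows "eventually (\<lambda>n. real (card {v \<in> V n. \<not> P n v}) \<le> e * real (card (V n))) sequentially"
proof -
  have "eventually (\<lambda>n. real (card {v \<in> V n. \<not> P n v}) / real (card (V n)) < e) sequentially"
    using assms order_tendstoD(2) unfolding aaa_iff by blast
  then show ?thesis using eventually_card_pos
    by eventually_elim (simp add: field_simps)
qed

lemma aaa_if_eventually:
  fixes L :: "nat \<Rightarrow> nat"
  assumes "filterlim L at_top sequentially"
    and "eventually (\<lambda>n. real (card {v \<in> V n. \<not> P n v}) \<le> c / real (L n) * real (card (V n))) sequentially"
  shows "aaa P"
  unfolding aaa_iff
proof (rule Lim_null_comparison)
  have "(\<lambda>n. 1 / real (L n)) \<longlonglongrightarrow> 0"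
    using filterlim_compose[OF lim_1_over_n assms(1)] .
  then show "(\<lambda>n. c / real (L n)) \<longlonglongrightarrow> 0"
    using tendsto_mult_right_zero[of "\<lambda>n. 1 / real (L n)" _ c] by simp
  show "\<forall>\<^sub>F n in sequentially. norm (real (card {v \<in> V n. \<not> P n v}) / real (card (V n))) \<le> c / real (L n)"
    using assms(2) eventually_card_pos by eventually_elim (simp add: field_simps)
qed

end

lemma eventually_diagonal:
  fixes Q :: "nat \<Rightarrow> nat \<Rightarrow> bool"
  assumes "\<And>L. eventually (Q L) sequentially"
  shows "\<exists>L. filterlim L at_top sequentially \<and> eventually (\<lambda>n. Q (L n) n) sequentially \<and> (\<forall>n. L n \<ge> 1)"
proof -
  define S where "S n = {L. 1 \<le> L \<and> L \<le> n \<and> Q L n}" for n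
  define L where "L n = (if S n = {} then 1 else Max (S n))" for n
  have fin: "finite (S n)" for n
    by (rule finite_subset[of _ "{..n}"]) (auto simp: S_def)
  have in_S: "L n \<in> S n" if "S n \<noteq> {}" for n
    using that Max_in[OF fin that] by (simp add: L_def)
  have ge: "eventually (\<lambda>n. S n \<noteq> {} \<and> K \<le> L n) sequentially" for K
    using assms[of "Suc K"] eventually_ge_at_top[of "Suc K"]
  proof eventually_elim
    case (elim n)
    then have K: "Suc K \<in> S n" unfolding S_def by simp
    then have "L n = Max (S n)" unfolding L_def by auto
    then show ?case using Max_ge[OF fin K] K by auto
  qed
  have "filterlim L at_top sequentially"
    unfolding filterlim_at_top
  proof
    show "eventually (\<lambda>n. K \<le> L n) sequentially" for K
      using ge[of K] by (rule eventually_mono) simp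
  qed
  moreover have "eventually (\<lambda>n. Q (L n) n) sequentially"
    using ge[of 0]
  proof eventually_elim
    case (elim n)
    then have "L n \<in> S n" using in_S by blast
    then show ?case unfolding S_def by blast
  qed
  moreover have "L n \<ge> 1" for n
  proof (cases "S n = {}")
    case False
    from in_S[OF this] show ?thesis unfolding S_def by blast
  qed (simp add: L_def)
  ultimately show ?thesis by (intro exI[of _ L]) simp
qed

section \<open>Cutting a permutation into blocks\<close>

text \<open>
  A maximal set \<open>X\<close> whose points do not return to \<open>X\<close> in fewer than \<open>L\<close> steps has density at most
  \<open>1 / L\<close>, and every orbit without points of small period meets \<open>X\<close> within \<open>2 * L\<close> steps.  The cut set
  is \<open>X\<close> together with the points of small period.
\<close>

lemma permutation_cut_set:
  fixes \<tau> :: "'v \<Rightarrow> 'v"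
  assumes fin: "finite V" and \<tau>: "\<tau> permutes V" and L: "L \<ge> 1"
  shows "\<exists>C\<subseteq>V. card C * L \<le> card V + L * card {v \<in> V. \<exists>k\<in>{1..L}. (\<tau> ^^ k) v = v} \<and>
    (\<forall>v\<in>V. \<exists>c\<in>C. \<exists>k<2 * L. (\<tau> ^^ k) c = v)"
proof -
  have pk: "(\<tau> ^^ k) permutes V" for k
    using \<tau> by (induction k) (auto intro: permutes_compose permutes_id)
  have inV: "(\<tau> ^^ k) v \<in> V \<longleftrightarrow> v \<in> V" for k v by (rule permutes_in_image[OF pk])
  have inj: "inj (\<tau> ^^ k)" for k by (rule permutes_inj[OF pk])
  define B where "B = {v \<in> V. \<exists>k\<in>{1..L}. (\<tau> ^^ k) v = v}"
  define good where "good X \<longleftrightarrow> X \<subseteq> V \<and> (\<forall>x\<in>X. \<forall>j\<in>{1..<L}. (\<tau> ^^ j) x \<notin> X)" for X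
  have "\<exists>X. is_arg_max card good X"
  proof -
    have "good {}" by (simp add: good_def)
    then have "\<exists>X. good X \<and> (\<forall>Y. good Y \<longrightarrow> card Y \<le> card X)"
      by (rule ex_has_greatest_nat[where b = "Suc (card V)"])
        (auto simp: good_def less_Suc_eq_le intro: card_mono[OF fin])
    then show ?thesis by (auto simp: is_arg_max_linorder)
  qed
  then obtain X where X: "good X" and mx: "\<And>Y. good Y \<Longrightarrow> card Y \<le> card X"
    by (auto simp: is_arg_max_linorder)
  have finX: "finite X" and XV: "X \<subseteq> V" using X fin finite_subset by (auto simp: good_def)
  have "card X * L \<le> card V"
  proof -
    have "inj_on (\<lambda>(j, x). (\<tau> ^^ j) x) ({0..<L} \<times> X)"
    proof -
      have *: "i = j \<and> x = y" if "i \<le> j" "j < L" "x \<in> X" "y \<in> X" "(\<tau> ^^ i) x = (\<tau> ^^ j) y" for i j x y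
      proof -
        have "(\<tau> ^^ i) x = (\<tau> ^^ i) ((\<tau> ^^ (j - i)) y)"
          using that(1,5) by (simp add: funpow_add[symmetric, THEN fun_cong, unfolded comp_def])
        then have x: "x = (\<tau> ^^ (j - i)) y" using inj by (auto dest: injD)
        have "j = i"
        proof (rule ccontr)
          assume "j \<noteq> i"
          then have "j - i \<in> {1..<L}" using that by auto
          then show False using X x that by (auto simp: good_def)
        qed
        with x show ?thesis by simp
      qed
      show ?thesis
      proof (rule inj_onI, clarsimp)
        fix i j x y
        assume "i < L" "j < L" "x \<in> X" "y \<in> X" "(\<tau> ^^ i) x = (\<tau> ^^ j) y"
        then show "i = j \<and> x = y" using *[of i j x y] *[of j i y x] by (cases "i \<le> j") auto
      qed
    qed
    then have "card ({0..<L} \<times> X) \<le> card V"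
      using XV inV fin by (intro card_inj_on_le) auto
    then show ?thesis by (simp add: card_cartesian_product mult.commute)
  qed
  moreover have "card (X \<union> B) * L \<le> (card X + card B) * L"
    by (intro mult_right_mono card_Un_le) simp
  moreover have "(card X + card B) * L = card X * L + L * card B" by (simp add: algebra_simps)
  ultimately have "card (X \<union> B) * L \<le> card V + L * card B" by linarith
  moreover have "\<exists>c\<in>X \<union> B. \<exists>k<2 * L. (\<tau> ^^ k) c = v" if v: "v \<in> V" for v
  proof -
    obtain w where w: "(\<tau> ^^ (L - 1)) w = v" "w \<in> V"
      using permutes_surj[OF pk[of "L - 1"]] inV v by (metis surjD)
    consider "w \<in> X \<union> B" | "w \<notin> X" "w \<notin> B" by blast
    then show ?thesis
    proof cases
      case 1
      then show ?thesis using w L by (intro bexI[of _ w] exI[of _ "L - 1"]) auto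
    next
      case 2
      have "\<not> good (insert w X)"
        using mx[of "insert w X"] finX 2(1) by auto
      then have "\<exists>x\<in>insert w X. \<exists>j\<in>{1..<L}. (\<tau> ^^ j) x \<in> insert w X"
        using w(2) XV unfolding good_def by blast
      then obtain x y j where j: "j \<in> {1..<L}" "(\<tau> ^^ j) x = y"
        and xy: "x \<in> insert w X" "y \<in> insert w X"
        by metis
      have "\<not> (x \<in> X \<and> y \<in> X)" using X j by (auto simp: good_def)
      moreover have "\<not> (x = w \<and> y = w)" using j w(2) 2(2) by (auto simp: B_def)
      ultimately consider "x = w" "y \<in> X" | "x \<in> X" "y = w" using xy by auto
      then show ?thesis
      proof cases
        case 1
        have "(\<tau> ^^ (L - 1 - j)) y = (\<tau> ^^ (L - 1 - j + j)) w"
          unfolding funpow_add using j 1 by simp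
        then have "(\<tau> ^^ (L - 1 - j)) y = v" using w j by simp
        then show ?thesis using 1 L by (intro bexI[of _ y] exI[of _ "L - 1 - j"]) auto
      next
        case 2
        have "(\<tau> ^^ (L - 1 + j)) x = v" unfolding funpow_add using j 2 w by simp
        then show ?thesis using 2 j by (intro bexI[of _ x] exI[of _ "L - 1 + j"]) auto
      qed
    qed
  qed
  ultimately show ?thesis using XV by (intro exI[of _ "X \<union> B"]) (auto simp: B_def)
qed

lemma permutation_blocks:
  fixes \<tau> :: "'v \<Rightarrow> 'v"
  assumes fin: "finite V" and \<tau>: "\<tau> permutes V" and L: "L \<ge> 1"
  shows "\<exists>C b p. C \<subseteq> V \<and>
    card C * L \<le> card V + L * card {v \<in> V. \<exists>k\<in>{1..L}. (\<tau> ^^ k) v = v} \<and>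
    (\<forall>v\<in>V. b v \<in> V \<and> p v < 2 * L \<and> (\<tau> ^^ p v) (b v) = v) \<and>
    (\<forall>v\<in>V. \<tau> v \<notin> C \<longrightarrow> b (\<tau> v) = b v \<and> p (\<tau> v) = Suc (p v))"
proof -
  obtain C where C: "C \<subseteq> V"
    "card C * L \<le> card V + L * card {v \<in> V. \<exists>k\<in>{1..L}. (\<tau> ^^ k) v = v}"
    "\<And>v. v \<in> V \<Longrightarrow> \<exists>c\<in>C. \<exists>k<2 * L. (\<tau> ^^ k) c = v"
    using permutation_cut_set[OF assms] by blast
  define p where "p v = (LEAST k. \<exists>c\<in>C. (\<tau> ^^ k) c = v)" for v
  define b where "b v = (SOME c. c \<in> C \<and> (\<tau> ^^ p v) c = v)" for v
  have ex: "\<exists>c\<in>C. (\<tau> ^^ p v) c = v" and lt: "p v < 2 * L" if v: "v \<in> V" for v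
  proof -
    obtain c k where ck: "c \<in> C" "k < 2 * L" "(\<tau> ^^ k) c = v" using C(3)[OF v] by blast
    then have "\<exists>c\<in>C. (\<tau> ^^ k) c = v" by blast
    then show "\<exists>c\<in>C. (\<tau> ^^ p v) c = v" unfolding p_def by (rule LeastI)
    show "p v < 2 * L" using ck Least_le[of "\<lambda>k. \<exists>c\<in>C. (\<tau> ^^ k) c = v" k] by (fastforce simp: p_def)
  qed
  have b: "b v \<in> C" "(\<tau> ^^ p v) (b v) = v" if "v \<in> V" for v
  proof -
    have "\<exists>c. c \<in> C \<and> (\<tau> ^^ p v) c = v" using ex[OF that] by blast
    from someI_ex[OF this] show "b v \<in> C" "(\<tau> ^^ p v) (b v) = v" by (auto simp: b_def)
  qed
  have inj: "inj (\<tau> ^^ k)" for k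
    using permutes_inj[OF \<tau>] by (induction k) (auto intro: inj_compose)
  have step: "b (\<tau> v) = b v \<and> p (\<tau> v) = Suc (p v)" if v: "v \<in> V" "\<tau> v \<notin> C" for v
  proof
    have \<tau>v: "\<tau> v \<in> V" using v \<tau> by (simp add: permutes_in_image)
    have "p (\<tau> v) \<noteq> 0" using b[OF \<tau>v] v(2) by (metis funpow_0)
    then obtain k where k: "p (\<tau> v) = Suc k" by (cases "p (\<tau> v)") auto
    have "\<tau> ((\<tau> ^^ k) (b (\<tau> v))) = \<tau> v" using b[OF \<tau>v] k by simp
    then have kb: "(\<tau> ^^ k) (b (\<tau> v)) = v" using permutes_inj[OF \<tau>] by (auto dest: injD)
    then have "p v \<le> k" unfolding p_def[of v] using b(1)[OF \<tau>v] by (intro Least_le) blast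
    moreover have "p (\<tau> v) \<le> Suc (p v)" unfolding p_def[of "\<tau> v"]
      using b[OF v(1)] by (intro Least_le) (auto intro!: bexI[of _ "b v"])
    ultimately show "p (\<tau> v) = Suc (p v)" using k by simp
    then have "(\<tau> ^^ p v) (b (\<tau> v)) = (\<tau> ^^ p v) (b v)" using k kb b[OF v(1)] by simp
    then show "b (\<tau> v) = b v" using inj by (auto dest: injD)
  qed
  show ?thesis using C(1,2) b lt step by (intro exI[of _ C] exI[of _ b] exI[of _ p]) blast
qed

section \<open>Neighbourhoods in the weak-star topology\<close>

lemma continuous_configuration_oscillation:
  assumes A: "finite A" and e: "e > 0"
    and f: "continuous_map (product_topology (\<lambda>_. discrete_topology A) S) euclideanreal f"
  shows "\<exists>F\<subseteq>S. finite F \<and> (\<forall>x\<in>S \<rightarrow>\<^sub>E A. \<forall>y\<in>S \<rightarrow>\<^sub>E A.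
    (\<forall>g\<in>F. x g = y g) \<longrightarrow> \<bar>f x - f y\<bar> < e)"
proof -
  let ?T = "product_topology (\<lambda>_. discrete_topology A) S"
  have top: "topspace ?T = S \<rightarrow>\<^sub>E A" by simp
  have "\<exists>F\<subseteq>S. finite F \<and> (\<forall>y\<in>S \<rightarrow>\<^sub>E A. (\<forall>g\<in>F. y g = x g) \<longrightarrow> \<bar>f y - f x\<bar> < e / 2)"
    if x: "x \<in> S \<rightarrow>\<^sub>E A" for x
  proof -
    have "openin ?T {y \<in> topspace ?T. f y \<in> ball (f x) (e / 2)}"
      by (rule openin_continuous_map_preimage[OF f]) (simp only: open_openin[symmetric] open_ball)
    moreover have "x \<in> {y \<in> topspace ?T. f y \<in> ball (f x) (e / 2)}" using x e by simp
    ultimately have "\<exists>U. finite {i \<in> S. U i \<noteq> topspace (discrete_topology A)} \<and>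
        (\<forall>i\<in>S. openin (discrete_topology A) (U i)) \<and> x \<in> Pi\<^sub>E S U \<and>
        Pi\<^sub>E S U \<subseteq> {y \<in> topspace ?T. f y \<in> ball (f x) (e / 2)}"
      unfolding openin_product_topology_alt by (rule bspec)
    then obtain U where U: "finite {i \<in> S. U i \<noteq> A}" "x \<in> Pi\<^sub>E S U"
      "Pi\<^sub>E S U \<subseteq> {y \<in> topspace ?T. f y \<in> ball (f x) (e / 2)}"
      unfolding topspace_discrete_topology by blast
    have "\<bar>f y - f x\<bar> < e / 2"
      if y: "y \<in> S \<rightarrow>\<^sub>E A" and eq: "\<forall>g\<in>{i \<in> S. U i \<noteq> A}. y g = x g" for y
    proof -
      have "y g \<in> U g" if "g \<in> S" for g
      proof (cases "U g = A")
        case True with y that show ?thesis by auto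
      next
        case False with eq that U(2) show ?thesis by auto
      qed
      then have "y \<in> Pi\<^sub>E S U" using y by (auto simp: PiE_iff)
      with U(3) show ?thesis by (auto simp: dist_real_def abs_minus_commute)
    qed
    with U(1) show ?thesis by (intro exI[of _ "{i \<in> S. U i \<noteq> A}"]) auto
  qed
  then obtain F where F: "\<And>x. x \<in> S \<rightarrow>\<^sub>E A \<Longrightarrow> F x \<subseteq> S" "\<And>x. x \<in> S \<rightarrow>\<^sub>E A \<Longrightarrow> finite (F x)"
    "\<And>x y. x \<in> S \<rightarrow>\<^sub>E A \<Longrightarrow> y \<in> S \<rightarrow>\<^sub>E A \<Longrightarrow> \<forall>g\<in>F x. y g = x g \<Longrightarrow> \<bar>f y - f x\<bar> < e / 2"
    by metis
  define N where "N x = {y \<in> S \<rightarrow>\<^sub>E A. \<forall>g\<in>F x. y g = x g}" for x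
  have "compact_space ?T"
    using A by (auto simp: compact_space_product_topology compact_space_discrete_topology)
  moreover have "openin ?T (N x)" if x: "x \<in> S \<rightarrow>\<^sub>E A" for x
  proof -
    have "N x = (\<Pi>\<^sub>E g\<in>S. if g \<in> F x then {x g} else A)"
      using x F(1)[OF x] by (auto simp: N_def PiE_iff extensional_def split: if_splits)
    moreover have "openin ?T (\<Pi>\<^sub>E g\<in>S. if g \<in> F x then {x g} else A)"
      using x F(1,2)[OF x] by (intro product_topology_basis)
        (auto simp: PiE_iff subset_iff elim!: finite_subset[rotated] split: if_splits)
    ultimately show ?thesis by simp
  qed
  moreover have "topspace ?T \<subseteq> \<Union> (N ` (S \<rightarrow>\<^sub>E A))" by (auto simp: N_def)
  ultimately obtain \<U> where "finite \<U>" "\<U> \<subseteq> N ` (S \<rightarrow>\<^sub>E A)" "topspace ?T \<subseteq> \<Union>\<U>"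
    unfolding compact_space_def compactin_def
    by (auto elim!: allE[of _ "N ` (S \<rightarrow>\<^sub>E A)"])
  then obtain X where X: "finite X" "X \<subseteq> S \<rightarrow>\<^sub>E A" "S \<rightarrow>\<^sub>E A \<subseteq> (\<Union>x\<in>X. N x)"
    unfolding top by (metis finite_subset_image)
  have "(\<Union>x\<in>X. F x) \<subseteq> S" "finite (\<Union>x\<in>X. F x)"
    using X(1,2) F(1,2) by (blast, auto)
  then show ?thesis
  proof (intro exI[of _ "\<Union>x\<in>X. F x"] conjI ballI impI)
    fix y z assume y: "y \<in> S \<rightarrow>\<^sub>E A" and z: "z \<in> S \<rightarrow>\<^sub>E A" and eq: "\<forall>g\<in>\<Union>x\<in>X. F x. y g = z g"
    obtain x where x: "x \<in> X" "y \<in> N x" using y X(3) by auto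
    then have "\<bar>f y - f x\<bar> < e / 2" using X(2) by (intro F(3)) (auto simp: N_def)
    moreover have "\<bar>f z - f x\<bar> < e / 2" using x X(2) eq z by (intro F(3)) (auto simp: N_def)
    ultimately show "\<bar>f y - f z\<bar> < e" by linarith
  qed
qed

lemma integral_cylinder_function:
  assumes M: "M \<in> Prob S A" and A: "finite A" and F: "finite F" "F \<subseteq> S"
  shows "integrable M (\<lambda>x. f (restrict x F))"
    and "(\<integral>x. f (restrict x F) \<partial>M)
      = (\<Sum>z\<in>F \<rightarrow>\<^sub>E A. f z * measure M {x \<in> space M. \<forall>g\<in>F. x g = z g})"
proof -
  interpret prob_space M using M by (simp add: Prob_def)
  let ?C = "\<lambda>z. {x \<in> space M. \<forall>g\<in>F. x g = z g}"
  have fin: "finite (F \<rightarrow>\<^sub>E A)" using A F by (simp add: finite_PiE)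
  have eq: "f (restrict x F) = (\<Sum>z\<in>F \<rightarrow>\<^sub>E A. f z * indicator (?C z) x)" if x: "x \<in> space M" for x
  proof -
    have "restrict x F \<in> F \<rightarrow>\<^sub>E A" using x F unfolding Prob_space[OF M] by (auto simp: PiE_iff)
    moreover have "indicator (?C z) x = (if z = restrict x F then 1 else 0 :: real)" if "z \<in> F \<rightarrow>\<^sub>E A" for z
    proof (cases "z = restrict x F")
      case False
      then have "\<exists>g\<in>F. z g \<noteq> x g" using that by (metis PiE_restrict restrict_ext)
      then show ?thesis using False by (auto simp: indicator_def)
    qed (use x in auto)
    ultimately show ?thesis by (simp add: fin if_distrib[of "\<lambda>t. _ * t"] cong: if_cong)
  qed
  have C: "?C z \<in> sets M" for z by (rule cylinder_in_sets[OF M F(2,1)])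
  have I: "integrable M (indicat_real (?C z))" for z
    using C by (intro integrable_real_indicator) (auto simp: less_top[symmetric])
  have int: "integrable M (\<lambda>x. \<Sum>z\<in>F \<rightarrow>\<^sub>E A. f z * indicator (?C z) x)"
    using I by (intro Bochner_Integration.integrable_sum integrable_mult_right) auto
  show "integrable M (\<lambda>x. f (restrict x F))"
    using int by (rule Bochner_Integration.integrable_cong[THEN iffD2, rotated 2]) (auto simp: eq)
  have "(\<integral>x. f (restrict x F) \<partial>M) = (\<integral>x. (\<Sum>z\<in>F \<rightarrow>\<^sub>E A. f z * indicator (?C z) x) \<partial>M)"
    by (rule Bochner_Integration.integral_cong) (auto simp: eq)
  also have "\<dots> = (\<Sum>z\<in>F \<rightarrow>\<^sub>E A. f z * measure M (?C z))"
    using C I by (subst Bochner_Integration.integral_sum) (auto intro!: integrable_mult_right)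
  finally show "(\<integral>x. f (restrict x F) \<partial>M) = (\<Sum>z\<in>F \<rightarrow>\<^sub>E A. f z * measure M (?C z))" .
qed

lemma continuous_configuration_integral:
  assumes A: "finite A" "A \<noteq> {}" and e: "e > 0"
    and f: "continuous_map (product_topology (\<lambda>_. discrete_topology A) S) euclideanreal f"
  shows "\<exists>F f'. F \<subseteq> S \<and> finite F \<and> (\<forall>M\<in>Prob S A.
    \<bar>(\<integral>x. f x \<partial>M) - (\<Sum>z\<in>F \<rightarrow>\<^sub>E A. f' z * measure M {x \<in> space M. \<forall>g\<in>F. x g = z g})\<bar> \<le> e)"
proof -
  obtain a where a: "a \<in> A" using A by auto
  define ext where "ext F z = (\<lambda>g\<in>S. if g \<in> F then z g else a)" for F z
  have ext: "ext F (restrict x F) \<in> S \<rightarrow>\<^sub>E A" "\<forall>g\<in>F. ext F (restrict x F) g = x g"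
    if "x \<in> S \<rightarrow>\<^sub>E A" "F \<subseteq> S" for F x
    using that a by (auto simp: ext_def PiE_iff)
  have osc: "\<exists>F\<subseteq>S. finite F \<and> (\<forall>x\<in>S \<rightarrow>\<^sub>E A. \<bar>f (ext F (restrict x F)) - f x\<bar> < e)" if e: "e > 0" for e
  proof -
    obtain F where F: "F \<subseteq> S" "finite F"
      "\<forall>x\<in>S \<rightarrow>\<^sub>E A. \<forall>y\<in>S \<rightarrow>\<^sub>E A. (\<forall>g\<in>F. x g = y g) \<longrightarrow> \<bar>f x - f y\<bar> < e"
      using continuous_configuration_oscillation[OF A(1) e f] by blast
    then show ?thesis using ext[OF _ F(1)] by (intro exI[of _ F]) blast
  qed
  then have "\<exists>F. F \<subseteq> S \<and> finite F \<and> (\<forall>x\<in>S \<rightarrow>\<^sub>E A. \<bar>f (ext F (restrict x F)) - f x\<bar> < 1 / real (Suc k))" for k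
    by (meson of_nat_0_less_iff zero_less_Suc zero_less_divide_1_iff)
  then obtain Fk where Fk: "\<And>k. Fk k \<subseteq> S" "\<And>k. finite (Fk k)"
    "\<And>k x. x \<in> S \<rightarrow>\<^sub>E A \<Longrightarrow> \<bar>f (ext (Fk k) (restrict x (Fk k))) - f x\<bar> < 1 / real (Suc k)"
    by metis
  obtain F where F: "F \<subseteq> S" "finite F" "\<And>x. x \<in> S \<rightarrow>\<^sub>E A \<Longrightarrow> \<bar>f (ext F (restrict x F)) - f x\<bar> < e"
    using osc[OF e] by blast
  have "\<bar>(\<integral>x. f x \<partial>M) - (\<Sum>z\<in>F \<rightarrow>\<^sub>E A. f (ext F z) * measure M {x \<in> space M. \<forall>g\<in>F. x g = z g})\<bar> \<le> e"
    if M: "M \<in> Prob S A" for M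
  proof -
    interpret prob_space M using M by (simp add: Prob_def)
    note sp = Prob_space[OF M]
    have meas: "f \<in> borel_measurable M"
    proof (rule borel_measurable_LIMSEQ_real)
      show "(\<lambda>k. f (ext (Fk k) (restrict x (Fk k)))) \<longlonglongrightarrow> f x" if "x \<in> space M" for x
      proof (rule LIM_zero_cancel, rule Lim_null_comparison)
        show "\<forall>\<^sub>F k in sequentially. norm (f (ext (Fk k) (restrict x (Fk k))) - f x) \<le> 1 / real (Suc k)"
          using Fk(3)[of x] that sp by (auto intro!: always_eventually less_imp_le)
      qed (rule LIMSEQ_Suc[OF lim_1_over_n])
      show "(\<lambda>x. f (ext (Fk k) (restrict x (Fk k)))) \<in> borel_measurable M" for k
        using integral_cylinder_function(1)[OF M A(1) Fk(2,1), where f = "\<lambda>z. f (ext (Fk k) z)"] by auto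
    qed
    note int' = integral_cylinder_function[OF M A(1) F(2,1), where f = "\<lambda>z. f (ext F z)"]
    have intd: "integrable M (\<lambda>x. f (ext F (restrict x F)) - f x)"
      using F(3) meas int'(1) by (intro integrable_const_bound[of _ e]) (auto simp: sp intro!: AE_I2 less_imp_le)
    have int: "integrable M f"
      using Bochner_Integration.integrable_diff[OF int'(1) intd] by simp
    have "\<bar>\<integral>x. f (ext F (restrict x F)) - f x \<partial>M\<bar> \<le> (\<integral>x. \<bar>f (ext F (restrict x F)) - f x\<bar> \<partial>M)"
      by (rule integral_abs_bound)
    also have "\<dots> \<le> (\<integral>x. e \<partial>M)"
      using F(3) intd by (intro integral_mono) (auto simp: sp intro: less_imp_le)
    finally have "\<bar>(\<integral>x. f (ext F (restrict x F)) \<partial>M) - (\<integral>x. f x \<partial>M)\<bar> \<le> e"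
      using int int' by (simp add: prob_space)
    then show ?thesis by (simp only: int'(2) abs_minus_commute)
  qed
  with F show ?thesis by (intro exI[of _ F] exI[of _ "\<lambda>z. f (ext F z)"]) auto
qed

lemma weak_star_neighbourhood:
  fixes G :: "('g, 'm) monoid_scheme" and A :: "'a set"
  assumes A: "finite A" "A \<noteq> {}" and \<mu>: "\<mu> \<in> Prob (carrier G) A"
    and "openin (weak_star G A) \<O>" "\<mu> \<in> \<O>"
  shows "\<exists>Q \<delta>. finite Q \<and> \<delta> > 0 \<and> (\<forall>(F, z)\<in>Q. F \<subseteq> carrier G \<and> finite F \<and> z \<in> F \<rightarrow>\<^sub>E A) \<and>
    (\<forall>M\<in>Prob (carrier G) A.
      (\<forall>(F, z)\<in>Q. \<bar>measure M {x \<in> space M. \<forall>g\<in>F. x g = z g}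
        - measure \<mu> {x \<in> space \<mu>. \<forall>g\<in>F. x g = z g}\<bar> < \<delta>) \<longrightarrow> M \<in> \<O>)"
proof -
  let ?m = "\<lambda>M F z. measure M {x \<in> space M. \<forall>g\<in>F. x g = z g}"
  let ?P = "\<lambda>\<O>. \<exists>Q \<delta>. finite Q \<and> \<delta> > 0 \<and> (\<forall>(F, z)\<in>Q. F \<subseteq> carrier G \<and> finite F \<and> z \<in> F \<rightarrow>\<^sub>E A) \<and>
    (\<forall>M\<in>Prob (carrier G) A. (\<forall>(F, z)\<in>Q. \<bar>?m M F z - ?m \<mu> F z\<bar> < \<delta>) \<longrightarrow> M \<in> \<O>)"
  have "generate_topology_on {{M \<in> Prob (carrier G) A. (\<integral>x. f x \<partial>M) \<in> U} | f (U :: real set).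
        continuous_map (product_topology (\<lambda>_. discrete_topology A) (carrier G)) euclideanreal f
        \<and> open U} \<O>"
    using assms(4) by (simp add: weak_star_def openin_topology_generated_by_iff)
  then show ?thesis using assms(5)
  proof induction
    case (Int a b)
    then have ab: "?P a" "?P b" by blast+
    from ab(1) obtain Q \<delta> where Q: "finite Q" "\<delta> > 0"
      "\<forall>(F, z)\<in>Q. F \<subseteq> carrier G \<and> finite F \<and> z \<in> F \<rightarrow>\<^sub>E A"
      "\<forall>M\<in>Prob (carrier G) A. (\<forall>(F, z)\<in>Q. \<bar>?m M F z - ?m \<mu> F z\<bar> < \<delta>) \<longrightarrow> M \<in> a"
      by (elim exE conjE)
    from ab(2) obtain Q' \<delta>' where Q': "finite Q'" "\<delta>' > 0"
      "\<forall>(F, z)\<in>Q'. F \<subseteq> carrier G \<and> finite F \<and> z \<in> F \<rightarrow>\<^sub>E A"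
      "\<forall>M\<in>Prob (carrier G) A. (\<forall>(F, z)\<in>Q'. \<bar>?m M F z - ?m \<mu> F z\<bar> < \<delta>') \<longrightarrow> M \<in> b"
      by (elim exE conjE)
    have "M \<in> a \<inter> b" if M: "M \<in> Prob (carrier G) A"
      and c: "\<forall>(F, z)\<in>Q \<union> Q'. \<bar>?m M F z - ?m \<mu> F z\<bar> < min \<delta> \<delta>'" for M
    proof
      show "M \<in> a" using c by (intro Q(4)[rule_format, OF M]) auto
      show "M \<in> b" using c by (intro Q'(4)[rule_format, OF M]) auto
    qed
    then show ?case using Q(1-3) Q'(1-3) by (intro exI[of _ "Q \<union> Q'"] exI[of _ "min \<delta> \<delta>'"]) auto
  next
    case (UN K)
    then obtain k where k: "k \<in> K" "\<mu> \<in> k" by auto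
    obtain Q \<delta> where Q: "finite Q" "\<delta> > 0"
      "\<forall>(F, z)\<in>Q. F \<subseteq> carrier G \<and> finite F \<and> z \<in> F \<rightarrow>\<^sub>E A"
      "\<forall>M\<in>Prob (carrier G) A. (\<forall>(F, z)\<in>Q. \<bar>?m M F z - ?m \<mu> F z\<bar> < \<delta>) \<longrightarrow> M \<in> k"
      using UN(2)[OF k] by (elim exE conjE)
    then show ?case using k(1) by (intro exI[of _ Q] exI[of _ \<delta>]) blast
  next
    case (Basis s)
    then obtain f U where s: "s = {M \<in> Prob (carrier G) A. (\<integral>x. f x \<partial>M) \<in> U}" and "open U"
      and f: "continuous_map (product_topology (\<lambda>_. discrete_topology A) (carrier G)) euclideanreal f"
      by auto
    have "(\<integral>x. f x \<partial>\<mu>) \<in> U" using Basis s by simp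
    with \<open>open U\<close> obtain e where e: "e > 0" "ball (\<integral>x. f x \<partial>\<mu>) e \<subseteq> U"
      by (auto simp: open_contains_ball)
    have "\<exists>F f'. F \<subseteq> carrier G \<and> finite F \<and> (\<forall>M\<in>Prob (carrier G) A.
        \<bar>(\<integral>x. f x \<partial>M) - (\<Sum>z\<in>F \<rightarrow>\<^sub>E A. f' z * ?m M F z)\<bar> \<le> e / 4)"
      by (rule continuous_configuration_integral[OF A _ f]) (use e in simp)
    then obtain F f' where F: "F \<subseteq> carrier G" "finite F" and f': "\<And>M. M \<in> Prob (carrier G) A \<Longrightarrow>
        \<bar>(\<integral>x. f x \<partial>M) - (\<Sum>z\<in>F \<rightarrow>\<^sub>E A. f' z * ?m M F z)\<bar> \<le> e / 4" by blast
    define B where "B = (\<Sum>z\<in>F \<rightarrow>\<^sub>E A. \<bar>f' z\<bar>)"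
    have B: "B \<ge> 0" by (simp add: B_def sum_nonneg)
    have fin: "finite (F \<rightarrow>\<^sub>E A)" using F A(1) by (simp add: finite_PiE)
    have "M \<in> s" if M: "M \<in> Prob (carrier G) A"
      and close: "\<forall>(F, z)\<in>Pair F ` (F \<rightarrow>\<^sub>E A). \<bar>?m M F z - ?m \<mu> F z\<bar> < e / (4 * (B + 1))" for M
    proof -
      have "\<bar>(\<Sum>z\<in>F \<rightarrow>\<^sub>E A. f' z * ?m M F z) - (\<Sum>z\<in>F \<rightarrow>\<^sub>E A. f' z * ?m \<mu> F z)\<bar>
        \<le> (\<Sum>z\<in>F \<rightarrow>\<^sub>E A. \<bar>f' z * (?m M F z - ?m \<mu> F z)\<bar>)"
        by (simp add: sum_subtractf[symmetric] right_diff_distrib[symmetric] sum_abs)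
      also have "\<dots> \<le> (\<Sum>z\<in>F \<rightarrow>\<^sub>E A. \<bar>f' z\<bar> * (e / (4 * (B + 1))))"
      proof (rule sum_mono)
        fix z assume "z \<in> F \<rightarrow>\<^sub>E A"
        then have "\<bar>?m M F z - ?m \<mu> F z\<bar> \<le> e / (4 * (B + 1))" using close by auto
        then show "\<bar>f' z * (?m M F z - ?m \<mu> F z)\<bar> \<le> \<bar>f' z\<bar> * (e / (4 * (B + 1)))"
          unfolding abs_mult by (rule mult_left_mono) simp
      qed
      also have "\<dots> = (B / (B + 1)) * (e / 4)"
        unfolding sum_distrib_right[symmetric] B_def[symmetric] by simp
      also have "\<dots> \<le> 1 * (e / 4)" using B e by (intro mult_right_mono) auto
      finally have "\<bar>(\<integral>x. f x \<partial>M) - (\<integral>x. f x \<partial>\<mu>)\<bar> < e"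
        using f'[OF M] f'[OF \<mu>] e by linarith
      then have "(\<integral>x. f x \<partial>M) \<in> U" using e(2) by (auto simp: dist_real_def abs_minus_commute)
      then show ?thesis using M s by simp
    qed
    moreover have "finite (Pair F ` (F \<rightarrow>\<^sub>E A))" using fin by simp
    moreover have "e / (4 * (B + 1)) > 0" using e B by auto
    ultimately show ?case using F
      by (intro exI[of _ "Pair F ` (F \<rightarrow>\<^sub>E A)"] exI[of _ "e / (4 * (B + 1))"]) auto
  qed simp
qed

section \<open>Independent blocks\<close>

text \<open>
  The probability that, among independent copies of \<open>N\<close> indexed by \<open>c\<close>, the copy \<open>b g\<close> shows the
  symbol \<open>z g\<close> at the coordinate \<open>p g\<close>, for all \<open>g \<in> F\<close>.
\<close>

definition block_mass ::
  "('s \<Rightarrow> 'a) measure \<Rightarrow> ('g \<Rightarrow> 'c) \<Rightarrow> ('g \<Rightarrow> 's) \<Rightarrow> 'g set \<Rightarrow> ('g \<Rightarrow> 'a) \<Rightarrow> real" where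
  "block_mass N b p F z =
     (\<Prod>c\<in>b ` F. measure N {y \<in> space N. \<forall>g\<in>F. b g = c \<longrightarrow> y (p g) = z g})"

lemma block_event_sets:
  assumes "N \<in> Prob S A" "finite F" "p ` F \<subseteq> S"
  shows "{y \<in> space N. \<forall>g\<in>F. b g = c \<longrightarrow> y (p g) = z g} \<in> sets N"
proof -
  have "{y \<in> space N. b g = c \<longrightarrow> y (p g) = z g} \<in> sets N" if "g \<in> F" for g
    using cylinder_in_sets[OF assms(1), of "{p g}" "\<lambda>_. z g"] that assms(3)
    by (cases "b g = c") auto
  then show ?thesis using assms(2) by (intro sets.sets_Collect_finite_All) auto
qed

lemma measure_iid_Collect:
  assumes "prob_space N" "J \<subseteq> I" "finite J" "\<And>c. c \<in> J \<Longrightarrow> E c \<in> sets N"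
  shows "measure (PiM I (\<lambda>_. N)) {x \<in> space (PiM I (\<lambda>_. N)). \<forall>c\<in>J. x c \<in> E c}
    = (\<Prod>c\<in>J. measure N (E c))"
proof -
  interpret N: prob_space N by fact
  interpret product_prob_space "\<lambda>_. N" I by unfold_locales
  have "emeasure (PiM I (\<lambda>_. N)) {x \<in> space (PiM I (\<lambda>_. N)). \<forall>c\<in>J. x c \<in> E c}
    = ennreal (\<Prod>c\<in>J. measure N (E c))"
    using emeasure_PiM_Collect[OF assms(2,3), of E] assms(4)
    by (simp add: N.emeasure_eq_measure prod_ennreal)
  then show ?thesis by (simp add: measure_def prod_nonneg)
qed

lemma space_iid_component: "x \<in> space (PiM I (\<lambda>_. N)) \<Longrightarrow> c \<in> I \<Longrightarrow> x c \<in> space N"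
  by (auto simp: space_PiM)

lemma measure_iid_blocks:
  assumes N: "N \<in> Prob S A" and F: "finite F" "p ` F \<subseteq> S" "b ` F \<subseteq> I"
  shows "measure (PiM I (\<lambda>_. N)) {x \<in> space (PiM I (\<lambda>_. N)). \<forall>g\<in>F. x (b g) (p g) = z g}
    = block_mass N b p F z"
proof -
  let ?E = "\<lambda>c. {y \<in> space N. \<forall>g\<in>F. b g = c \<longrightarrow> y (p g) = z g}"
  have "{x \<in> space (PiM I (\<lambda>_. N)). \<forall>g\<in>F. x (b g) (p g) = z g}
    = {x \<in> space (PiM I (\<lambda>_. N)). \<forall>c\<in>b ` F. x c \<in> ?E c}"
  proof (intro Collect_cong conj_cong refl)
    fix x assume x: "x \<in> space (PiM I (\<lambda>_. N))"
    then have "x c \<in> space N" if "c \<in> b ` F" for c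
      using that F(3) space_iid_component[OF x] by auto
    then show "(\<forall>g\<in>F. x (b g) (p g) = z g) \<longleftrightarrow> (\<forall>c\<in>b ` F. x c \<in> ?E c)" by blast
  qed
  moreover have "measure (PiM I (\<lambda>_. N)) {x \<in> space (PiM I (\<lambda>_. N)). \<forall>c\<in>b ` F. x c \<in> ?E c}
    = (\<Prod>c\<in>b ` F. measure N (?E c))"
    by (rule measure_iid_Collect[OF _ F(3) finite_imageI[OF F(1)] block_event_sets[OF N F(1,2)]])
      (use N in \<open>simp add: Prob_def\<close>)
  ultimately show ?thesis by (simp only: block_mass_def)
qed

lemma measure_iid_blocks_disjoint:
  assumes N: "N \<in> Prob S A" and F: "finite F" "p ` F \<subseteq> S" "b ` F \<subseteq> I"
    and F': "p' ` F \<subseteq> S" "b' ` F \<subseteq> I" and disj: "b ` F \<inter> b' ` F = {}"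
  shows "measure (PiM I (\<lambda>_. N)) {x \<in> space (PiM I (\<lambda>_. N)).
      (\<forall>g\<in>F. x (b g) (p g) = z g) \<and> (\<forall>g\<in>F. x (b' g) (p' g) = z g)}
    = block_mass N b p F z * block_mass N b' p' F z"
proof -
  let ?E = "\<lambda>b p c. {y \<in> space N. \<forall>g\<in>F. b g = c \<longrightarrow> y (p g) = z g}"
  let ?EE = "\<lambda>c. ?E b p c \<inter> ?E b' p' c"
  have "{x \<in> space (PiM I (\<lambda>_. N)). (\<forall>g\<in>F. x (b g) (p g) = z g) \<and> (\<forall>g\<in>F. x (b' g) (p' g) = z g)}
    = {x \<in> space (PiM I (\<lambda>_. N)). \<forall>c\<in>b ` F \<union> b' ` F. x c \<in> ?EE c}" (is "?L = ?R")
  proof (intro Collect_cong conj_cong refl)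
    fix x assume x: "x \<in> space (PiM I (\<lambda>_. N))"
    then have "x c \<in> space N" if "c \<in> b ` F \<union> b' ` F" for c
      using that F F' space_iid_component[OF x] by auto
    then show "((\<forall>g\<in>F. x (b g) (p g) = z g) \<and> (\<forall>g\<in>F. x (b' g) (p' g) = z g))
      \<longleftrightarrow> (\<forall>c\<in>b ` F \<union> b' ` F. x c \<in> ?EE c)" by blast
  qed
  moreover have "measure (PiM I (\<lambda>_. N)) ?R = (\<Prod>c\<in>b ` F \<union> b' ` F. measure N (?EE c))"
    using N F F' by (intro measure_iid_Collect sets.Int block_event_sets[OF N F(1,2)]
        block_event_sets[OF N F(1) F'(1)]) (simp_all add: Prob_def)
  ultimately have "measure (PiM I (\<lambda>_. N)) ?L = (\<Prod>c\<in>b ` F \<union> b' ` F. measure N (?EE c))"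
    by (simp only:)
  also have "\<dots> = (\<Prod>c\<in>b ` F. measure N (?EE c)) * (\<Prod>c\<in>b' ` F. measure N (?EE c))"
    using F disj by (intro prod.union_disjoint) auto
  also have "(\<Prod>c\<in>b ` F. measure N (?EE c)) = (\<Prod>c\<in>b ` F. measure N (?E b p c))"
    using disj by (intro prod.cong refl arg_cong[where f = "measure N"]) blast
  also have "(\<Prod>c\<in>b' ` F. measure N (?EE c)) = (\<Prod>c\<in>b' ` F. measure N (?E b' p' c))"
    using disj by (intro prod.cong refl arg_cong[where f = "measure N"]) blast
  finally show ?thesis by (simp add: block_mass_def)
qed

lemma block_mass_shift:
  assumes "process integer_group A \<nu>" "finite F" "inj_on \<beta> (b ` F)"
    and "\<And>g. g \<in> F \<Longrightarrow> b' g = \<beta> (b g)" "\<And>g. g \<in> F \<Longrightarrow> p' g = p g + q (b g)"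
  shows "block_mass \<nu> b' p' F z = block_mass \<nu> b p F z"
proof -
  have "b' ` F = \<beta> ` (b ` F)" using assms(4) by (simp add: image_image cong: image_cong)
  then have "block_mass \<nu> b' p' F z
    = (\<Prod>c\<in>b ` F. measure \<nu> {y \<in> space \<nu>. \<forall>g\<in>F. b' g = \<beta> c \<longrightarrow> y (p' g) = z g})"
    by (simp add: block_mass_def prod.reindex[OF assms(3)])
  also have "\<dots> = block_mass \<nu> b p F z"
    unfolding block_mass_def
  proof (rule prod.cong[OF refl])
    fix c assume c: "c \<in> b ` F"
    have iff: "b' g = \<beta> c \<longleftrightarrow> b g = c" if "g \<in> F" for g
      using that c assms(3,4) by (auto simp: inj_on_eq_iff)
    have "{y \<in> space \<nu>. \<forall>g\<in>F. b' g = \<beta> c \<longrightarrow> y (p' g) = z g}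
      = {y \<in> space \<nu>. \<forall>g\<in>{g \<in> F. b g = c}. y (p g + q c) = z g}"
      by (auto simp: iff assms(5))
    moreover have "{y \<in> space \<nu>. \<forall>g\<in>F. b g = c \<longrightarrow> y (p g) = z g}
      = {y \<in> space \<nu>. \<forall>g\<in>{g \<in> F. b g = c}. y (p g) = z g}" by auto
    ultimately show "measure \<nu> {y \<in> space \<nu>. \<forall>g\<in>F. b' g = \<beta> c \<longrightarrow> y (p' g) = z g}
      = measure \<nu> {y \<in> space \<nu>. \<forall>g\<in>F. b g = c \<longrightarrow> y (p g) = z g}"
      using process_cylinder_shift[OF assms(1), of "{g \<in> F. b g = c}" p "q c" z] assms(2) by simp
  qed
  finally show ?thesis .
qed

lemma sum_reindexed_cylinders:
  assumes "N \<in> Prob S A" "inj_on p F"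
  shows "(\<Sum>z\<in>F \<rightarrow>\<^sub>E A. f (measure N {y \<in> space N. \<forall>g\<in>F. y (p g) = z g}))
    = (\<Sum>w\<in>(p ` F) \<rightarrow>\<^sub>E A. f (measure N {y \<in> space N. \<forall>u\<in>p ` F. y u = w u}))"
proof (rule sum.reindex_bij_witness[where i = "\<lambda>w. \<lambda>g\<in>F. w (p g)"
      and j = "\<lambda>z. \<lambda>u\<in>p ` F. z (inv_into F p u)"])
  fix z
  have "{y \<in> space N. \<forall>u\<in>p ` F. y u = (\<lambda>u\<in>p ` F. z (inv_into F p u)) u}
    = {y \<in> space N. \<forall>g\<in>F. y (p g) = z g}"
    using assms(2) by auto
  then show "f (measure N {y \<in> space N. \<forall>u\<in>p ` F. y u = (\<lambda>u\<in>p ` F. z (inv_into F p u)) u})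
    = f (measure N {y \<in> space N. \<forall>g\<in>F. y (p g) = z g})" by simp
qed (use assms(2) in \<open>auto simp: PiE_iff extensional_def fun_eq_iff f_inv_into_f inv_into_into\<close>)

lemma sum_cylinders:
  assumes "N \<in> Prob S A" "finite A" "finite U" "U \<subseteq> S"
  shows "(\<Sum>w\<in>U \<rightarrow>\<^sub>E A. measure N {y \<in> space N. \<forall>u\<in>U. y u = w u}) = 1"
proof -
  interpret prob_space N using assms by (simp add: Prob_def)
  show ?thesis using integral_cylinder_function(2)[OF assms, of "\<lambda>_. 1"] by (simp add: prob_space)
qed

lemma block_mass_entropy:
  assumes N: "N \<in> Prob S A" and A: "finite A"
    and F: "finite F" "p ` F \<subseteq> S" "inj_on (\<lambda>g. (b g, p g)) F"
  shows "(\<Sum>z\<in>F \<rightarrow>\<^sub>E A. block_mass N b p F z) = 1"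
    and "- (\<Sum>z\<in>F \<rightarrow>\<^sub>E A. block_mass N b p F z * ln (block_mass N b p F z))
      = (\<Sum>c\<in>b ` F. shannon_entropy (marginal A (p ` {g \<in> F. b g = c}) N))"
proof -
  let ?S = "\<lambda>F. \<Sum>z\<in>F \<rightarrow>\<^sub>E A. block_mass N b p F z"
  let ?H = "\<lambda>F. \<Sum>z\<in>F \<rightarrow>\<^sub>E A. block_mass N b p F z * ln (block_mass N b p F z)"
  let ?h = "\<lambda>F c. shannon_entropy (marginal A (p ` {g \<in> F. b g = c}) N)"
  have "?S F = 1 \<and> - ?H F = (\<Sum>c\<in>b ` F. ?h F c)" if "finite K" "b ` F = K" for K
    using that F
  proof (induction K arbitrary: F)
    case empty
    then have "F = {}" by simp
    then show ?case by (simp add: block_mass_def)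
  next
    case (insert c K)
    define F1 where "F1 = {g \<in> F. b g = c}"
    define F2 where "F2 = {g \<in> F. b g \<noteq> c}"
    have F12: "F = F1 \<union> F2" "F1 \<inter> F2 = {}" by (auto simp: F1_def F2_def)
    have fin: "finite F1" "finite F2" using insert.prems F12 by auto
    have bF2: "b ` F2 = K" using insert.hyps insert.prems by (auto simp: F2_def)
    have inj1: "inj_on p F1"
      using insert.prems(4) by (auto simp: inj_on_def F1_def)
    have IH: "?S F2 = 1 \<and> - ?H F2 = (\<Sum>c\<in>b ` F2. ?h F2 c)"
      using bF2 fin insert.prems F12 by (intro insert.IH) (auto intro: inj_on_subset)
    define m where "m z = measure N {y \<in> space N. \<forall>g\<in>F1. y (p g) = z g}" for z
    have S1: "(\<Sum>z\<in>F1 \<rightarrow>\<^sub>E A. m z) = 1"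
      using sum_reindexed_cylinders[OF N inj1, of "\<lambda>t. t"] sum_cylinders[OF N A, of "p ` F1"] fin
        insert.prems F12 by (auto simp: m_def)
    have H1: "- (\<Sum>z\<in>F1 \<rightarrow>\<^sub>E A. m z * ln (m z)) = ?h F c"
    proof -
      have "p ` F1 \<subseteq> S" using insert.prems F12 by auto
      then show ?thesis
        using sum_reindexed_cylinders[OF N inj1, of "\<lambda>t. t * ln t"]
          shannon_entropy_marginal_cylinders[OF N, of "p ` F1"] fin A
        by (simp add: m_def F1_def)
    qed
    have split: "(\<Sum>z\<in>F \<rightarrow>\<^sub>E A. f (block_mass N b p F z))
      = (\<Sum>z1\<in>F1 \<rightarrow>\<^sub>E A. \<Sum>z2\<in>F2 \<rightarrow>\<^sub>E A. f (m z1 * block_mass N b p F2 z2))" for f :: "real \<Rightarrow> real"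
      unfolding sum.cartesian_product
    proof (rule sum.reindex_bij_witness[where j = "\<lambda>z. (restrict z F1, restrict z F2)"
          and i = "\<lambda>(z1, z2). \<lambda>g\<in>F. if b g = c then z1 g else z2 g"])
      fix z assume "z \<in> F \<rightarrow>\<^sub>E A"
      have "block_mass N b p F z = measure N {y \<in> space N. \<forall>g\<in>F. b g = c \<longrightarrow> y (p g) = z g}
          * (\<Prod>c'\<in>K. measure N {y \<in> space N. \<forall>g\<in>F. b g = c' \<longrightarrow> y (p g) = z g})"
        unfolding block_mass_def insert.prems(1) using insert.hyps by simp
      also have "{y \<in> space N. \<forall>g\<in>F. b g = c \<longrightarrow> y (p g) = z g}
        = {y \<in> space N. \<forall>g\<in>F1. y (p g) = restrict z F1 g}" by (auto simp: F1_def)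
      also have "(\<Prod>c'\<in>K. measure N {y \<in> space N. \<forall>g\<in>F. b g = c' \<longrightarrow> y (p g) = z g})
        = block_mass N b p F2 (restrict z F2)"
        unfolding block_mass_def bF2 using insert.hyps(2)
        by (intro prod.cong refl arg_cong[where f = "measure N"]) (auto simp: F2_def)
      finally show "(case (restrict z F1, restrict z F2) of (z1, z2) \<Rightarrow>
        f (m z1 * block_mass N b p F2 z2)) = f (block_mass N b p F z)" by (simp add: m_def)
    qed (auto simp: F1_def F2_def PiE_iff extensional_def fun_eq_iff)
    have "?S F = 1"
      using split[of "\<lambda>t. t"] IH S1 by (simp add: sum_distrib_left[symmetric])
    moreover have "- ?H F = (\<Sum>c\<in>b ` F. ?h F c)"
    proof -
      have "?H F = (\<Sum>z1\<in>F1 \<rightarrow>\<^sub>E A. \<Sum>z2\<in>F2 \<rightarrow>\<^sub>E A. (m z1 * block_mass N b p F2 z2)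
          * ln (m z1 * block_mass N b p F2 z2))"
        by (rule split)
      also have "\<dots> = (\<Sum>z1\<in>F1 \<rightarrow>\<^sub>E A. \<Sum>z2\<in>F2 \<rightarrow>\<^sub>E A. (m z1 * ln (m z1)) * block_mass N b p F2 z2
          + m z1 * (block_mass N b p F2 z2 * ln (block_mass N b p F2 z2)))"
      proof (intro sum.cong refl)
        fix z1 z2
        have "m z1 \<ge> 0" "block_mass N b p F2 z2 \<ge> 0"
          by (auto simp: m_def block_mass_def prod_nonneg)
        then show "(m z1 * block_mass N b p F2 z2) * ln (m z1 * block_mass N b p F2 z2)
          = (m z1 * ln (m z1)) * block_mass N b p F2 z2
          + m z1 * (block_mass N b p F2 z2 * ln (block_mass N b p F2 z2))"
          by (cases "m z1 = 0 \<or> block_mass N b p F2 z2 = 0") (auto simp: ln_mult algebra_simps)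
      qed
      also have "\<dots> = (\<Sum>z\<in>F1 \<rightarrow>\<^sub>E A. m z * ln (m z)) * ?S F2 + (\<Sum>z\<in>F1 \<rightarrow>\<^sub>E A. m z) * ?H F2"
        by (simp add: sum.distrib sum_product)
      finally have "- ?H F = ?h F c + (\<Sum>c\<in>K. ?h F2 c)"
        using IH S1 H1 bF2 by simp
      also have "(\<Sum>c\<in>K. ?h F2 c) = (\<Sum>c\<in>K. ?h F c)"
      proof (rule sum.cong[OF refl])
        fix c' assume "c' \<in> K"
        then have "{g \<in> F2. b g = c'} = {g \<in> F. b g = c'}" using insert.hyps(2) by (auto simp: F2_def)
        then show "?h F2 c' = ?h F c'" by simp
      qed
      finally show ?thesis using insert.hyps insert.prems(1) by simp
    qed
    ultimately show ?case ..
  qed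
  from this[of "b ` F"] F(1)
  show "?S F = 1" "- ?H F = (\<Sum>c\<in>b ` F. ?h F c)" by auto
qed

definition block_measure ::
  "'v set \<Rightarrow> 'a set \<Rightarrow> ('s \<Rightarrow> 'a) measure \<Rightarrow> ('v \<Rightarrow> 'v) \<Rightarrow> ('v \<Rightarrow> 's) \<Rightarrow> ('v \<Rightarrow> 'a) measure" where
  "block_measure V A N b p =
     distr (PiM V (\<lambda>_. N)) (config V A) (\<lambda>x. \<lambda>v\<in>V. x (b v) (p v))"

lemma Prob_distr:
  assumes "prob_space M" "X \<in> measurable M (config S A)"
  shows "distr M (config S A) X \<in> Prob S A"
  using prob_space.prob_space_distr[OF assms] by (simp add: Prob_def)

lemma component_measurable:
  assumes "N \<in> Prob S A" "s \<in> S"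
  shows "(\<lambda>y. y s) \<in> measurable N (count_space A)"
proof -
  have sets: "sets N = sets (config S A)" using assms(1) by (simp add: Prob_def)
  show ?thesis unfolding measurable_cong_sets[OF sets refl] config_def
    using assms(2) by (rule measurable_component_singleton)
qed

lemma iid_readout_measurable:
  assumes N: "N \<in> Prob S A" and b: "b ` U \<subseteq> I" and p: "p ` U \<subseteq> S"
  shows "(\<lambda>x. \<lambda>v\<in>U. x (b v) (p v)) \<in> measurable (PiM I (\<lambda>_. N)) (config U A)"
  unfolding config_def
proof (rule measurable_restrict)
  fix v assume v: "v \<in> U"
  have "(\<lambda>x. x (b v)) \<in> measurable (PiM I (\<lambda>_. N)) N"
    using v b by (intro measurable_component_singleton) auto
  moreover have "(\<lambda>y. y (p v)) \<in> measurable N (count_space A)"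
    using v p by (intro component_measurable[OF N]) auto
  ultimately show "(\<lambda>x. x (b v) (p v)) \<in> measurable (PiM I (\<lambda>_. N)) (count_space A)"
    by (rule measurable_compose)
qed

lemma prob_space_iid: "N \<in> Prob S A \<Longrightarrow> prob_space (PiM I (\<lambda>_. N))"
  by (rule prob_space_PiM) (simp add: Prob_def)

lemma block_measure_Prob:
  assumes "N \<in> Prob S A" "b ` V \<subseteq> V" "p ` V \<subseteq> S"
  shows "block_measure V A N b p \<in> Prob V A"
  unfolding block_measure_def
  by (intro Prob_distr prob_space_iid[OF assms(1)] iid_readout_measurable[OF assms])

lemma distr_Collect:
  assumes "X \<in> measurable M N" "{y \<in> space N. P y} \<in> sets N"
  shows "measure (distr M N X) {y \<in> space N. P y} = measure M {x \<in> space M. P (X x)}"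
proof -
  have "X -` {y \<in> space N. P y} \<inter> space M = {x \<in> space M. P (X x)}"
    using measurable_space[OF assms(1)] by auto
  then show ?thesis by (simp add: measure_distr[OF assms])
qed

lemma measure_block_measure:
  assumes N: "N \<in> Prob S A" and V: "b ` V \<subseteq> V" "p ` V \<subseteq> S"
    and F: "finite F" "u ` F \<subseteq> V"
  shows "measure (block_measure V A N b p) {a \<in> space (block_measure V A N b p). \<forall>g\<in>F. a (u g) = z g}
    = block_mass N (\<lambda>g. b (u g)) (\<lambda>g. p (u g)) F z"
proof -
  note M = block_measure_Prob[OF N V]
  have "{a \<in> space (block_measure V A N b p). \<forall>g\<in>F. (True = True) \<longrightarrow> a (u g) = z g}
      \<in> sets (block_measure V A N b p)"
    by (rule block_event_sets[OF M F])
  then have "{a \<in> space (config V A). \<forall>g\<in>F. a (u g) = z g} \<in> sets (config V A)"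
    by (simp add: block_measure_def)
  then have "measure (block_measure V A N b p) {a \<in> space (block_measure V A N b p). \<forall>g\<in>F. a (u g) = z g}
    = measure (PiM V (\<lambda>_. N)) {x \<in> space (PiM V (\<lambda>_. N)). \<forall>g\<in>F. (\<lambda>v\<in>V. x (b v) (p v)) (u g) = z g}"
    unfolding block_measure_def space_distr by (rule distr_Collect[OF iid_readout_measurable[OF N V]])
  also have "{x \<in> space (PiM V (\<lambda>_. N)). \<forall>g\<in>F. (\<lambda>v\<in>V. x (b v) (p v)) (u g) = z g}
    = {x \<in> space (PiM V (\<lambda>_. N)). \<forall>g\<in>F. x (b (u g)) (p (u g)) = z g}"
    using F(2) by (auto simp: image_subset_iff)
  also have "measure (PiM V (\<lambda>_. N)) \<dots> = block_mass N (\<lambda>g. b (u g)) (\<lambda>g. p (u g)) F z"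
    using F V by (intro measure_iid_blocks[OF N]) auto
  finally show ?thesis .
qed

lemma measure_block_measure_disjoint:
  assumes N: "N \<in> Prob S A" and V: "b ` V \<subseteq> V" "p ` V \<subseteq> S"
    and F: "finite F" "u ` F \<subseteq> V" "u' ` F \<subseteq> V"
    and disj: "\<And>g g'. g \<in> F \<Longrightarrow> g' \<in> F \<Longrightarrow> b (u g) \<noteq> b (u' g')"
  shows "measure (block_measure V A N b p) {a \<in> space (block_measure V A N b p).
      (\<forall>g\<in>F. a (u g) = z g) \<and> (\<forall>g\<in>F. a (u' g) = z g)}
    = block_mass N (\<lambda>g. b (u g)) (\<lambda>g. p (u g)) F z * block_mass N (\<lambda>g. b (u' g)) (\<lambda>g. p (u' g)) F z"
proof -
  note M = block_measure_Prob[OF N V]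
  have "{a \<in> space (block_measure V A N b p). \<forall>g\<in>F. (True = True) \<longrightarrow> a (u g) = z g}
      \<in> sets (block_measure V A N b p)"
    "{a \<in> space (block_measure V A N b p). \<forall>g\<in>F. (True = True) \<longrightarrow> a (u' g) = z g}
      \<in> sets (block_measure V A N b p)"
    by (rule block_event_sets[OF M F(1,2)], rule block_event_sets[OF M F(1,3)])
  then have "{a \<in> space (config V A). (\<forall>g\<in>F. a (u g) = z g) \<and> (\<forall>g\<in>F. a (u' g) = z g)} \<in> sets (config V A)"
    by (intro sets.sets_Collect_conj) (auto simp: block_measure_def)
  then have "measure (block_measure V A N b p) {a \<in> space (block_measure V A N b p).
      (\<forall>g\<in>F. a (u g) = z g) \<and> (\<forall>g\<in>F. a (u' g) = z g)}
    = measure (PiM V (\<lambda>_. N)) {x \<in> space (PiM V (\<lambda>_. N)).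
      (\<forall>g\<in>F. (\<lambda>v\<in>V. x (b v) (p v)) (u g) = z g) \<and> (\<forall>g\<in>F. (\<lambda>v\<in>V. x (b v) (p v)) (u' g) = z g)}"
    unfolding block_measure_def space_distr by (rule distr_Collect[OF iid_readout_measurable[OF N V]])
  also have "{x \<in> space (PiM V (\<lambda>_. N)).
      (\<forall>g\<in>F. (\<lambda>v\<in>V. x (b v) (p v)) (u g) = z g) \<and> (\<forall>g\<in>F. (\<lambda>v\<in>V. x (b v) (p v)) (u' g) = z g)}
    = {x \<in> space (PiM V (\<lambda>_. N)).
      (\<forall>g\<in>F. x (b (u g)) (p (u g)) = z g) \<and> (\<forall>g\<in>F. x (b (u' g)) (p (u' g)) = z g)}"
    using F(2,3) by (auto simp: image_subset_iff)
  also have "measure (PiM V (\<lambda>_. N)) \<dots>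
    = block_mass N (\<lambda>g. b (u g)) (\<lambda>g. p (u g)) F z * block_mass N (\<lambda>g. b (u' g)) (\<lambda>g. p (u' g)) F z"
    using F V disj by (intro measure_iid_blocks_disjoint[OF N]) (auto simp: image_subset_iff subset_iff)
  finally show ?thesis .
qed

section \<open>Cutting a sofic approximation\<close>

locale sofic_setting = group G + finite_approximation V
  for G :: "('g, 'm) monoid_scheme" (structure) and V :: "nat \<Rightarrow> 'v set" +
  fixes \<sigma> :: "nat \<Rightarrow> 'g \<Rightarrow> 'v \<Rightarrow> 'v" and \<theta> :: "int \<Rightarrow> 'g"
  assumes countable_G: "countable (carrier G)"
    and sofic_permutes: "g \<in> carrier G \<Longrightarrow> \<sigma> n g permutes V n"
    and aaa_mult: "g \<in> carrier G \<Longrightarrow> h \<in> carrier G \<Longrightarrow> aaa (\<lambda>n v. \<sigma> n g (\<sigma> n h v) = \<sigma> n (g \<otimes> h) v)"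
    and aaa_free: "g \<in> carrier G \<Longrightarrow> g \<noteq> \<one> \<Longrightarrow> aaa (\<lambda>n v. \<sigma> n g v \<noteq> v)"
    and \<theta>_closed: "\<theta> k \<in> carrier G"
    and \<theta>_add: "\<theta> (k + l) = \<theta> k \<otimes> \<theta> l"
    and inj_\<theta>: "inj \<theta>"
begin

abbreviation \<tau> :: "nat \<Rightarrow> 'v \<Rightarrow> 'v" where "\<tau> n \<equiv> \<sigma> n (\<theta> 1)"

lemma sofic_in_V: "g \<in> carrier G \<Longrightarrow> \<sigma> n g v \<in> V n \<longleftrightarrow> v \<in> V n"
  by (rule permutes_in_image[OF sofic_permutes])

lemma sofic_inj: "g \<in> carrier G \<Longrightarrow> \<sigma> n g v = \<sigma> n g w \<longleftrightarrow> v = w"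
  using permutes_inj[OF sofic_permutes] by (auto dest: injD)

lemma \<tau>_pow_in_V: "(\<tau> n ^^ k) v \<in> V n \<longleftrightarrow> v \<in> V n"
  by (induction k) (auto simp: sofic_in_V \<theta>_closed)

lemma \<tau>_pow_permutes: "(\<tau> n ^^ k) permutes V n"
  using sofic_permutes[OF \<theta>_closed] by (induction k) (auto intro: permutes_compose permutes_id)

lemma \<theta>_zero: "\<theta> 0 = \<one>"
  using \<theta>_add[of 0 0] \<theta>_closed[of 0] by (simp add: l_cancel_one')

lemma \<theta>_uminus: "\<theta> (- k) = inv \<theta> k"
  using \<theta>_add[of "- k" k] \<theta>_closed by (intro inv_equality[symmetric]) (auto simp: \<theta>_zero)

lemma aaa_sofic: "aaa P \<Longrightarrow> g \<in> carrier G \<Longrightarrow> aaa (\<lambda>n v. P n (\<sigma> n g v))"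
  by (rule aaa_permute) (auto intro: sofic_permutes)

lemma aaa_\<tau>_pow: "aaa P \<Longrightarrow> aaa (\<lambda>n v. P n ((\<tau> n ^^ k) v))"
  by (rule aaa_permute) (auto intro: \<tau>_pow_permutes)

lemma aaa_one: "aaa (\<lambda>n v. \<sigma> n \<one> v = v)"
  using aaa_mult[of \<one> \<one>] by (simp add: sofic_inj)

lemma aaa_inv: "g \<in> carrier G \<Longrightarrow> aaa (\<lambda>n v. \<sigma> n (inv g) (\<sigma> n g v) = v)"
  by (rule aaa_mono[OF aaa_conj[OF aaa_mult[of "inv g" g] aaa_one]]) auto

lemma aaa_neq:
  assumes "g \<in> carrier G" "h \<in> carrier G" "g \<noteq> h"
  shows "aaa (\<lambda>n v. \<sigma> n g v \<noteq> \<sigma> n h v)"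
proof -
  have "inv g \<otimes> h \<noteq> \<one>" using assms by (metis inv_solve_left' r_one one_closed)
  then have "aaa (\<lambda>n v. \<sigma> n (inv g \<otimes> h) v \<noteq> v)" using assms by (intro aaa_free) auto
  moreover have "aaa (\<lambda>n v. \<sigma> n (inv g) (\<sigma> n g v) = v)"
    "aaa (\<lambda>n v. \<sigma> n (inv g) (\<sigma> n h v) = \<sigma> n (inv g \<otimes> h) v)"
    using assms by (auto intro: aaa_inv aaa_mult)
  ultimately have "aaa (\<lambda>n v. \<sigma> n (inv g \<otimes> h) v \<noteq> v \<and> \<sigma> n (inv g) (\<sigma> n g v) = v
      \<and> \<sigma> n (inv g) (\<sigma> n h v) = \<sigma> n (inv g \<otimes> h) v)"
    by (intro aaa_conj)
  then show ?thesis by (rule aaa_mono) auto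
qed

lemma aaa_\<tau>:
  assumes "g \<in> carrier G"
  shows "aaa (\<lambda>n v. (\<tau> n ^^ k) (\<sigma> n g v) = \<sigma> n (\<theta> (int k) \<otimes> g) v)"
proof (induction k)
  case 0
  show ?case using assms aaa_True by (simp add: \<theta>_zero)
next
  case (Suc k)
  have "\<theta> (int (Suc k)) \<otimes> g = \<theta> 1 \<otimes> (\<theta> (int k) \<otimes> g)"
    using assms \<theta>_closed by (simp add: \<theta>_add m_assoc)
  then show ?case
    by (intro aaa_mono[OF aaa_conj[OF Suc aaa_mult[of "\<theta> 1" "\<theta> (int k) \<otimes> g"]]])
      (use assms \<theta>_closed in auto)
qed

lemma aaa_\<tau>_free:
  assumes "k \<ge> 1"
  shows "aaa (\<lambda>n v. (\<tau> n ^^ k) v \<noteq> v)"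
proof -
  have "\<theta> (int k) \<noteq> \<one>"
    using assms inj_\<theta> \<theta>_zero by (metis injD not_one_le_zero of_nat_eq_0_iff)
  then have "aaa (\<lambda>n v. \<sigma> n (\<theta> (int k)) v \<noteq> v)" using \<theta>_closed by (intro aaa_free)
  moreover have "aaa (\<lambda>n v. (\<tau> n ^^ k) (\<sigma> n \<one> v) = \<sigma> n (\<theta> (int k)) v)"
    using aaa_\<tau>[of \<one> k] \<theta>_closed by simp
  ultimately show ?thesis
    by (rule aaa_mono[OF aaa_conj[OF _ aaa_conj[OF _ aaa_one]]]) auto
qed

lemma aaa_\<tau>_neq:
  assumes "g \<in> carrier G" "h \<in> carrier G" "\<And>k::nat. g \<noteq> \<theta> (int k) \<otimes> h"
  shows "aaa (\<lambda>n v. \<forall>k<K. \<sigma> n g v \<noteq> (\<tau> n ^^ k) (\<sigma> n h v))"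
proof -
  have "aaa (\<lambda>n v. \<forall>k\<in>{..<K}. \<sigma> n g v \<noteq> (\<tau> n ^^ k) (\<sigma> n h v))"
  proof (rule aaa_ball)
    fix k
    have "aaa (\<lambda>n v. \<sigma> n g v \<noteq> \<sigma> n (\<theta> (int k) \<otimes> h) v)"
      using assms \<theta>_closed by (intro aaa_neq) auto
    then show "aaa (\<lambda>n v. \<sigma> n g v \<noteq> (\<tau> n ^^ k) (\<sigma> n h v))"
      by (rule aaa_mono[OF aaa_conj[OF _ aaa_\<tau>[OF assms(2), of k]]]) auto
  qed simp
  then show ?thesis by (rule aaa_mono) simp
qed

lemma sofic_blocks:
  obtains C b p L where "aaa (\<lambda>n v. v \<notin> C n)"
    "\<And>n v. v \<in> V n \<Longrightarrow> b n v \<in> V n" "\<And>n v. v \<in> V n \<Longrightarrow> p n v < 2 * L n"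
    "\<And>n v. v \<in> V n \<Longrightarrow> (\<tau> n ^^ p n v) (b n v) = v"
    "\<And>n v. v \<in> V n \<Longrightarrow> \<tau> n v \<notin> C n \<Longrightarrow> b n (\<tau> n v) = b n v \<and> p n (\<tau> n v) = Suc (p n v)"
    "(\<lambda>n. real (L n) / real (card (V n))) \<longlonglongrightarrow> 0"
    "\<And>g h. g \<in> carrier G \<Longrightarrow> h \<in> carrier G \<Longrightarrow> (\<And>k. g \<noteq> \<theta> k \<otimes> h)
       \<Longrightarrow> aaa (\<lambda>n v. b n (\<sigma> n g v) \<noteq> b n (\<sigma> n h v))"
proof -
  define e where "e = from_nat_into (carrier G)"
  have e: "e i \<in> carrier G" for i unfolding e_def by (rule from_nat_into) auto
  have e_surj: "\<exists>i. e i = g" if "g \<in> carrier G" for g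
    using from_nat_into_surj[OF countable_G that] by (auto simp: e_def)
  define apart where "apart g h \<longleftrightarrow> (\<forall>k::nat. g \<noteq> \<theta> (int k) \<otimes> h)" for g h
  define Q1 where "Q1 L n \<longleftrightarrow> real (card {v \<in> V n. \<not> (\<forall>k\<in>{1..L}. (\<tau> n ^^ k) v \<noteq> v)})
      \<le> 1 / real L * real (card (V n))" for L n
  define Q2 where "Q2 L i j n \<longleftrightarrow> real (card {v \<in> V n. \<not> (\<forall>k<2 * L. \<sigma> n (e i) v \<noteq> (\<tau> n ^^ k) (\<sigma> n (e j) v))})
      \<le> 1 / real L * real (card (V n))" for L i j n
  define Q where "Q L n \<longleftrightarrow> L * L \<le> card (V n) \<and> Q1 L n \<and>
      (\<forall>i\<in>{..L}. \<forall>j\<in>{..L}. apart (e i) (e j) \<longrightarrow> Q2 L i j n)" for L n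
  have "eventually (Q L) sequentially" for L
  proof (cases "L = 0")
    case True
    then show ?thesis unfolding Q_def Q1_def Q2_def by simp
  next
    case False
    have "eventually (\<lambda>n. L * L \<le> card (V n)) sequentially"
      using card_V by (simp add: filterlim_at_top)
    moreover have "eventually (Q1 L) sequentially"
      unfolding Q1_def using False by (intro aaa_eventually aaa_ball aaa_\<tau>_free) auto
    moreover have "eventually (\<lambda>n. apart (e i) (e j) \<longrightarrow> Q2 L i j n) sequentially" for i j
    proof (cases "apart (e i) (e j)")
      case True
      then have "eventually (Q2 L i j) sequentially"
        unfolding Q2_def apart_def using False e by (intro aaa_eventually aaa_\<tau>_neq) auto
      then show ?thesis by (rule eventually_mono) simp
    qed simp
    ultimately show ?thesis unfolding Q_def
      by (intro eventually_conj eventually_ball_finite ballI) (auto simp del: eventually_sequentially)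
  qed
  then obtain L where L: "filterlim L at_top sequentially" "eventually (\<lambda>n. Q (L n) n) sequentially"
    and L1: "\<And>n. L n \<ge> 1"
    using eventually_diagonal[of Q] by blast
  have "\<forall>n. \<exists>C b p. C \<subseteq> V n \<and>
    card C * L n \<le> card (V n) + L n * card {v \<in> V n. \<exists>k\<in>{1..L n}. (\<tau> n ^^ k) v = v} \<and>
    (\<forall>v\<in>V n. b v \<in> V n \<and> p v < 2 * L n \<and> (\<tau> n ^^ p v) (b v) = v) \<and>
    (\<forall>v\<in>V n. \<tau> n v \<notin> C \<longrightarrow> b (\<tau> n v) = b v \<and> p (\<tau> n v) = Suc (p v))"
    by (intro allI permutation_blocks finite_V sofic_permutes \<theta>_closed L1)
  then obtain C b p where C: "\<And>n. C n \<subseteq> V n"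
      "\<And>n. card (C n) * L n \<le> card (V n) + L n * card {v \<in> V n. \<exists>k\<in>{1..L n}. (\<tau> n ^^ k) v = v}"
    and bp: "\<And>n v. v \<in> V n \<Longrightarrow> b n v \<in> V n" "\<And>n v. v \<in> V n \<Longrightarrow> p n v < 2 * L n"
      "\<And>n v. v \<in> V n \<Longrightarrow> (\<tau> n ^^ p n v) (b n v) = v"
      "\<And>n v. v \<in> V n \<Longrightarrow> \<tau> n v \<notin> C n \<Longrightarrow> b n (\<tau> n v) = b n v \<and> p n (\<tau> n v) = Suc (p n v)"
    unfolding choice_iff by (elim exE) blast
  have "aaa (\<lambda>n v. v \<notin> C n)"
  proof (rule aaa_if_eventually[OF L(1), where c = 2])
    show "\<forall>\<^sub>F n in sequentially. real (card {v \<in> V n. \<not> v \<notin> C n}) \<le> 2 / real (L n) * real (card (V n))"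
      using L(2)
    proof eventually_elim
      case (elim n)
      let ?B = "{v \<in> V n. \<exists>k\<in>{1..L n}. (\<tau> n ^^ k) v = v}"
      have Lp: "real (L n) > 0" using L1[of n] by simp
      have B: "real (L n) * real (card ?B) \<le> real (card (V n))"
        using elim Lp unfolding Q_def Q1_def by (simp add: field_simps)
      have "real (card (C n)) * real (L n) \<le> real (card (V n)) + real (L n) * real (card ?B)"
        using C(2)[of n] by (simp only: of_nat_mult[symmetric] of_nat_add[symmetric] of_nat_le_iff)
      then have "real (card (C n)) * real (L n) \<le> 2 * real (card (V n))" using B by linarith
      moreover have "{v \<in> V n. \<not> v \<notin> C n} = C n" using C(1) by auto
      ultimately show ?case using Lp by (simp add: field_simps)
    qed
  qed
  moreover have "(\<lambda>n. real (L n) / real (card (V n))) \<longlonglongrightarrow> 0"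
  proof (rule Lim_null_comparison)
    show "(\<lambda>n. 1 / real (L n)) \<longlonglongrightarrow> 0" using filterlim_compose[OF lim_1_over_n L(1)] .
    show "\<forall>\<^sub>F n in sequentially. norm (real (L n) / real (card (V n))) \<le> 1 / real (L n)"
      using L(2) eventually_card_pos
    proof eventually_elim
      case (elim n)
      have "real (L n) * real (L n) \<le> real (card (V n))"
        using elim unfolding Q_def by (simp only: of_nat_mult[symmetric] of_nat_le_iff)
      then show ?case using elim L1[of n] by (simp add: field_simps)
    qed
  qed
  moreover have "aaa (\<lambda>n v. b n (\<sigma> n g v) \<noteq> b n (\<sigma> n h v))"
    if gh: "g \<in> carrier G" "h \<in> carrier G" and ne: "\<And>k. g \<noteq> \<theta> k \<otimes> h" for g h
  proof -
    have far: "aaa (\<lambda>n v. \<forall>k<2 * L n. \<sigma> n g v \<noteq> (\<tau> n ^^ k) (\<sigma> n h v))"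
      if gh: "g \<in> carrier G" "h \<in> carrier G" and ap: "apart g h" for g h
    proof -
      obtain i j where ij: "e i = g" "e j = h" using e_surj gh by metis
      show ?thesis
      proof (rule aaa_if_eventually[OF L(1), where c = 1])
        have "eventually (\<lambda>n. max i j \<le> L n) sequentially"
          using L(1)[unfolded filterlim_at_top] by blast
        with L(2) show "\<forall>\<^sub>F n in sequentially.
          real (card {v \<in> V n. \<not> (\<forall>k<2 * L n. \<sigma> n g v \<noteq> (\<tau> n ^^ k) (\<sigma> n h v))})
            \<le> 1 / real (L n) * real (card (V n))"
        proof eventually_elim
          case (elim n)
          then have "Q2 (L n) i j n" using ap ij unfolding Q_def by auto
          then show ?case by (simp add: Q2_def ij)
        qed
      qed
    qed
    have "apart g h" using ne by (simp add: apart_def)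
    moreover have "apart h g" unfolding apart_def
    proof
      fix k :: nat
      have "\<theta> (- int k) \<otimes> (\<theta> (int k) \<otimes> g) = g"
        using gh \<theta>_closed by (simp add: \<theta>_uminus m_assoc[symmetric])
      then show "h \<noteq> \<theta> (int k) \<otimes> g" using ne[of "- int k"] by auto
    qed
    ultimately have "aaa (\<lambda>n v. (\<forall>k<2 * L n. \<sigma> n g v \<noteq> (\<tau> n ^^ k) (\<sigma> n h v))
        \<and> (\<forall>k<2 * L n. \<sigma> n h v \<noteq> (\<tau> n ^^ k) (\<sigma> n g v)))"
      using gh by (intro aaa_conj far)
    then show ?thesis
    proof (rule aaa_mono)
      fix n v assume v: "v \<in> V n" and *: "(\<forall>k<2 * L n. \<sigma> n g v \<noteq> (\<tau> n ^^ k) (\<sigma> n h v))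
        \<and> (\<forall>k<2 * L n. \<sigma> n h v \<noteq> (\<tau> n ^^ k) (\<sigma> n g v))"
      have same: "\<exists>k<2 * L n. y = (\<tau> n ^^ k) x"
        if "x \<in> V n" "y \<in> V n" "b n x = b n y" "p n x \<le> p n y" for x y
      proof -
        have "y = (\<tau> n ^^ (p n y - p n x + p n x)) (b n x)" using bp(3)[OF that(2)] that by simp
        also have "\<dots> = (\<tau> n ^^ (p n y - p n x)) x"
          unfolding funpow_add using bp(3)[OF that(1)] by simp
        finally show ?thesis using bp(2)[OF that(2)] by (intro exI[of _ "p n y - p n x"]) auto
      qed
      have in_V: "\<sigma> n g v \<in> V n" "\<sigma> n h v \<in> V n" using v gh by (simp_all add: sofic_in_V)
      show "b n (\<sigma> n g v) \<noteq> b n (\<sigma> n h v)"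
      proof
        assume eq: "b n (\<sigma> n g v) = b n (\<sigma> n h v)"
        show False
          using same[OF in_V eq] same[OF in_V(2,1) eq[symmetric]] * by (meson linear)
      qed
    qed
  qed
  ultimately show thesis using bp by (intro that[of C b p L]) auto
qed

end

section \<open>Frequencies, separated sets and coinduction\<close>

text \<open>
  Only the pairs in \<open>R\<close> contribute to the variance of the frequency of the events \<open>E v\<close>, and each of
  them contributes at most \<open>1\<close>.
\<close>

lemma (in prob_space) frequency_deviation:
  assumes V: "finite V" "V \<noteq> {}" and E: "\<And>v. v \<in> V \<Longrightarrow> E v \<in> events"
    and R: "R \<subseteq> V \<times> V" and m: "0 \<le> m" "m \<le> 1" and \<delta>: "\<delta> > 0"
    and good: "\<And>v w. v \<in> V \<Longrightarrow> w \<in> V \<Longrightarrow> (v, w) \<notin> R \<Longrightarrow>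
      prob (E v) = m \<and> prob (E w) = m \<and> prob (E v \<inter> E w) = m * m"
  shows "prob {x \<in> space M. \<delta> \<le> \<bar>real (card {v \<in> V. x \<in> E v}) / real (card V) - m\<bar>}
    \<le> real (card R) / (real (card V) * real (card V)) / \<delta>\<^sup>2"
proof -
  let ?c = "real (card V)"
  have c: "?c > 0" using V by (simp add: card_gt_0_iff)
  define f where "f x = (\<Sum>v\<in>V. indicator (E v) x - m) / ?c" for x :: 'a
  have f: "f x = real (card {v \<in> V. x \<in> E v}) / ?c - m" for x
  proof -
    have "(\<Sum>v\<in>V. indicator (E v) x :: real) = real (card {v \<in> V. x \<in> E v})"
      using V by (simp add: indicator_def sum.If_cases Int_def)
    then show ?thesis using c by (simp add: f_def sum_subtractf field_simps)
  qed
  let ?g = "\<lambda>v w x. (indicator (E v) x - m) * (indicator (E w) x - m) :: real"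
  have f2: "(f x)\<^sup>2 = (\<Sum>(v, w)\<in>V \<times> V. ?g v w x) / (?c * ?c)" for x
    by (simp add: f_def power2_eq_square sum_product sum.cartesian_product)
  have I: "integrable M (\<lambda>x. indicator (E v) x :: real)" if "v \<in> V" for v
    using E[OF that] by (intro integrable_real_indicator) (auto simp: less_top[symmetric])
  have g: "?g v w x = indicator (E v \<inter> E w) x - m * indicator (E v) x - m * indicator (E w) x + m * m" for v w x
    by (simp add: indicator_inter_arith algebra_simps)
  have I2: "integrable M (\<lambda>x. indicator (E v \<inter> E w) x :: real)" if "v \<in> V" "w \<in> V" for v w
    using E that by (intro integrable_real_indicator) (auto simp: less_top[symmetric])
  have Ig: "integrable M (?g v w)" if "v \<in> V" "w \<in> V" for v w
    unfolding g using I I2 that by auto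
  have eg: "expectation (?g v w) = prob (E v \<inter> E w) - m * prob (E v) - m * prob (E w) + m * m"
    if "v \<in> V" "w \<in> V" for v w
    unfolding g using I[OF that(1)] I[OF that(2)] I2[OF that] E that by (simp add: prob_space)
  have If2: "integrable M (\<lambda>x. (f x)\<^sup>2)" unfolding f2
    using Ig by (intro integrable_divide Bochner_Integration.integrable_sum) auto
  have f_meas: "f \<in> borel_measurable M" unfolding f_def using I by auto
  have "expectation (\<lambda>x. (f x)\<^sup>2) = (\<Sum>(v, w)\<in>V \<times> V. expectation (?g v w)) / (?c * ?c)"
  proof -
    have "expectation (\<lambda>x. \<Sum>vw\<in>V \<times> V. ?g (fst vw) (snd vw) x)
      = (\<Sum>vw\<in>V \<times> V. expectation (?g (fst vw) (snd vw)))"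
      by (rule Bochner_Integration.integral_sum) (rule Ig; auto)
    then show ?thesis unfolding f2 split_beta' by simp
  qed
  also have "(\<Sum>(v, w)\<in>V \<times> V. expectation (?g v w)) \<le> (\<Sum>(v, w)\<in>V \<times> V. if (v, w) \<in> R then 1 else 0)"
  proof (rule sum_mono, clarify)
    fix v w assume vw: "v \<in> V" "w \<in> V"
    show "expectation (?g v w) \<le> (if (v, w) \<in> R then 1 else 0)"
    proof (cases "(v, w) \<in> R")
      case True
      have "\<bar>?g v w x\<bar> \<le> 1 * 1" for x
        unfolding abs_mult using m by (intro mult_mono) (auto simp: indicator_def)
      then have "?g v w x \<le> 1" for x by (metis abs_le_D1 mult_1)
      then have "expectation (?g v w) \<le> expectation (\<lambda>_. 1)"
        using Ig[OF vw] by (intro integral_mono) auto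
      with True show ?thesis by (simp add: prob_space)
    next
      case False
      with good[OF vw] show ?thesis by (simp add: eg[OF vw])
    qed
  qed
  also have "(\<Sum>(v, w)\<in>V \<times> V. if (v, w) \<in> R then 1 else 0 :: real) = real (card R)"
    using R V by (simp add: split_beta' sum.If_cases Int_absorb1)
  finally have e: "expectation (\<lambda>x. (f x)\<^sup>2) \<le> real (card R) / (?c * ?c)"
    using c by (simp add: divide_right_mono)
  have "prob {x \<in> space M. \<delta> \<le> \<bar>f x\<bar>} \<le> expectation (\<lambda>x. (f x)\<^sup>2) / \<delta>\<^sup>2"
    by (rule second_moment_method[OF f_meas If2 \<delta>])
  also have "\<dots> \<le> real (card R) / (?c * ?c) / \<delta>\<^sup>2"
    using e by (rule divide_right_mono) simp
  finally show ?thesis by (simp add: f)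
qed

lemma separated_sofic_dist:
  assumes met: "proper_right_invariant_metric G \<rho>" and one: "\<one>\<^bsub>G\<^esub> \<in> carrier G"
    and S: "separated (sofic_dist G \<rho> V \<sigma> D) r S" "S \<subseteq> V"
    and vw: "v \<in> S" "w \<in> S" "v \<noteq> w" and g: "g \<in> carrier G" "\<rho> g \<one>\<^bsub>G\<^esub> < r"
  shows "\<sigma> g v \<noteq> w"
proof
  assume eq: "\<sigma> g v = w"
  let ?\<Gamma> = "action_graph G V \<sigma>"
  interpret wf_digraph ?\<Gamma>
    by unfold_locales (auto simp: action_graph_def)
  interpret Metric_space "carrier G" \<rho> using met by (simp add: proper_right_invariant_metric_def)
  have inV: "v \<in> V" "w \<in> V" using vw S(2) by auto
  have arc: "(v, w) \<in> arcs ?\<Gamma>" using inV eq g by (auto simp: action_graph_def)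
  have aw: "awalk v [(v, w)] w"
  proof -
    have "tail ?\<Gamma> (v, w) = v" "head ?\<Gamma> (v, w) = w" by (simp_all add: action_graph_def)
    with arc_implies_awalk[OF arc] show ?thesis by simp
  qed
  then have reach: "v \<rightarrow>\<^sup>*\<^bsub>?\<Gamma>\<^esub> w" by (rule reachable_awalkI)
  have "edge_weight G \<rho> \<sigma> (v, w) \<le> \<rho> g \<one>\<^bsub>G\<^esub>"
    unfolding edge_weight_def using g eq
    by (auto intro!: cInf_lower bdd_belowI[of _ 0])
  then have "\<mu> (edge_weight G \<rho> \<sigma>) v w \<le> ereal (\<rho> g \<one>\<^bsub>G\<^esub>)"
    using min_cost_le_walk_cost[OF aw, of "edge_weight G \<rho> \<sigma>"]
    by (simp add: awalk_cost_def) (meson ereal_less_eq(3) order_trans)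
  then have "component_dist G \<rho> V \<sigma> v w \<le> \<rho> g \<one>\<^bsub>G\<^esub>"
    unfolding component_dist_def
    by (cases "\<mu> (edge_weight G \<rho> \<sigma>) v w") auto
  then have "sofic_dist G \<rho> V \<sigma> D v w < r" using g reach by (simp add: sofic_dist_def)
  then show False using S(1) vw by (force simp: separated_def)
qed

lemma relabel_Prob:
  assumes "N \<in> Prob UNIV A"
  shows "relabel UNIV H \<theta> A N \<in> Prob H A"
    and "(\<lambda>a. \<lambda>h\<in>H. a (inv_into UNIV \<theta> h)) \<in> measurable N (config H A)"
proof -
  show *: "(\<lambda>a. \<lambda>h\<in>H. a (inv_into UNIV \<theta> h)) \<in> measurable N (config H A)"
    unfolding config_def
    by (rule measurable_restrict) (rule component_measurable[OF assms UNIV_I])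
  then show "relabel UNIV H \<theta> A N \<in> Prob H A"
    unfolding relabel_def using assms by (intro Prob_distr) (auto simp: Prob_def)
qed

lemma relabel_block_mass:
  assumes N: "N \<in> Prob UNIV A" and F: "finite F" "p ` F \<subseteq> H"
  shows "block_mass (relabel UNIV H \<theta> A N) b p F z
    = block_mass N b (\<lambda>g. inv_into UNIV \<theta> (p g)) F z"
  unfolding block_mass_def
proof (rule prod.cong[OF refl])
  fix c
  note M = relabel_Prob[OF N, where H = H and \<theta> = \<theta>]
  have "{y \<in> space (config H A). \<forall>g\<in>F. b g = c \<longrightarrow> y (p g) = z g} \<in> sets (config H A)"
    using block_event_sets[OF M(1) F] by (simp add: relabel_def)
  then have "measure (relabel UNIV H \<theta> A N)
      {y \<in> space (relabel UNIV H \<theta> A N). \<forall>g\<in>F. b g = c \<longrightarrow> y (p g) = z g}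
    = measure N {y \<in> space N. \<forall>g\<in>F. b g = c \<longrightarrow> (\<lambda>h\<in>H. y (inv_into UNIV \<theta> h)) (p g) = z g}"
    unfolding relabel_def space_distr by (rule distr_Collect[OF M(2)])
  also have "{y \<in> space N. \<forall>g\<in>F. b g = c \<longrightarrow> (\<lambda>h\<in>H. y (inv_into UNIV \<theta> h)) (p g) = z g}
    = {y \<in> space N. \<forall>g\<in>F. b g = c \<longrightarrow> y (inv_into UNIV \<theta> (p g)) = z g}"
    by (intro Collect_cong conj_cong ball_cong refl) (use F(2) in \<open>simp add: image_subset_iff\<close>)
  finally show "measure (relabel UNIV H \<theta> A N)
      {y \<in> space (relabel UNIV H \<theta> A N). \<forall>g\<in>F. b g = c \<longrightarrow> y (p g) = z g}
    = measure N {y \<in> space N. \<forall>g\<in>F. b g = c \<longrightarrow> y (inv_into UNIV \<theta> (p g)) = z g}" .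
qed

context group
begin

context
  fixes H T assumes H: "subgroup H G" and T: "right_transversal G H T"
begin

lemma coset_rep_ex1:
  assumes "g \<in> carrier G"
  shows "\<exists>!t. t \<in> T \<and> g \<in> H #> t"
proof -
  have TG: "T \<subseteq> carrier G" using T by (simp add: right_transversal_def)
  have "H #> g \<in> rcosets H" using assms H by (auto simp: RCOSETS_def)
  then have "\<exists>!t. t \<in> T \<and> t \<in> H #> g" using T by (simp add: right_transversal_def)
  moreover have "t \<in> H #> g \<longleftrightarrow> g \<in> H #> t" if "t \<in> T" for t
    using repr_independence[OF _ _ H] rcos_self[OF _ H] assms that TG by (metis subsetD)
  ultimately show ?thesis by metis
qed

lemma coset_rep_props:
  assumes "g \<in> carrier G"
  shows "coset_rep G H T g \<in> T" "coset_rep G H T g \<in> carrier G"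
    "g \<otimes> inv (coset_rep G H T g) \<in> H"
proof -
  let ?t = "coset_rep G H T g"
  have *: "?t \<in> T \<and> g \<in> H #> ?t"
    unfolding coset_rep_def by (rule theI'[OF coset_rep_ex1[OF assms]])
  then show "?t \<in> T" by simp
  then show t: "?t \<in> carrier G" using T by (auto simp: right_transversal_def)
  obtain h where h: "h \<in> H" "g = h \<otimes> ?t" using * by (auto simp: r_coset_def)
  have "h \<in> carrier G" using h(1) H by (rule subgroup.mem_carrier[rotated])
  then have "g \<otimes> inv ?t = h" using t by (subst h(2)) (simp add: m_assoc)
  then show "g \<otimes> inv ?t \<in> H" using h(1) by simp
qed

lemma coset_rep_distinct:
  assumes "g \<in> carrier G" "g' \<in> carrier G" "h \<in> H"
    and "coset_rep G H T g = h \<otimes> coset_rep G H T g'"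
  shows "coset_rep G H T g = coset_rep G H T g'"
proof -
  let ?t = "coset_rep G H T g" and ?t' = "coset_rep G H T g'"
  note t = coset_rep_props[OF assms(1)] and t' = coset_rep_props[OF assms(2)]
  have "?t \<in> H #> ?t'" using assms by (auto simp: r_coset_def)
  moreover have "?t \<in> H #> ?t" by (rule rcos_self[OF t(2) H])
  ultimately have "(THE s. s \<in> T \<and> ?t \<in> H #> s) = ?t'" "(THE s. s \<in> T \<and> ?t \<in> H #> s) = ?t"
    using t(1) t'(1) by (auto intro: the1_equality[OF coset_rep_ex1[OF t(2)]])
  then show ?thesis by simp
qed

lemma CInd_Prob:
  assumes N: "N \<in> Prob H A"
  shows "CInd G H T A N \<in> Prob (carrier G) A"
    and "F \<subseteq> carrier G \<Longrightarrow> finite F \<Longrightarrow>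
      measure (CInd G H T A N) {x \<in> space (CInd G H T A N). \<forall>g\<in>F. x g = z g}
      = block_mass N (coset_rep G H T) (\<lambda>g. g \<otimes> inv (coset_rep G H T g)) F z"
proof -
  let ?c = "coset_rep G H T" and ?p = "\<lambda>g. g \<otimes> inv (coset_rep G H T g)"
  have glue: "glue G H T = (\<lambda>x. \<lambda>g\<in>carrier G. x (?c g) (?p g))"
    by (simp add: glue_def Let_def fun_eq_iff)
  have meas: "glue G H T \<in> measurable (PiM T (\<lambda>_. N)) (config (carrier G) A)"
    unfolding glue using coset_rep_props by (intro iid_readout_measurable[OF N]) auto
  show P: "CInd G H T A N \<in> Prob (carrier G) A"
    unfolding CInd_def by (intro Prob_distr prob_space_iid[OF N] meas)
  assume F: "F \<subseteq> carrier G" "finite F"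
  have "{x \<in> space (config (carrier G) A). \<forall>g\<in>F. x g = z g} \<in> sets (config (carrier G) A)"
    using cylinder_in_sets[OF P F] by (simp add: CInd_def)
  then have "measure (CInd G H T A N) {x \<in> space (CInd G H T A N). \<forall>g\<in>F. x g = z g}
    = measure (PiM T (\<lambda>_. N)) {x \<in> space (PiM T (\<lambda>_. N)). \<forall>g\<in>F. glue G H T x g = z g}"
    unfolding CInd_def space_distr by (rule distr_Collect[OF meas])
  also have "{x \<in> space (PiM T (\<lambda>_. N)). \<forall>g\<in>F. glue G H T x g = z g}
    = {x \<in> space (PiM T (\<lambda>_. N)). \<forall>g\<in>F. x (?c g) (?p g) = z g}"
    using F(1) by (auto simp: glue subset_iff)
  also have "measure (PiM T (\<lambda>_. N)) \<dots> = block_mass N ?c ?p F z"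
    using F coset_rep_props by (intro measure_iid_blocks[OF N]) auto
  finally show "measure (CInd G H T A N) {x \<in> space (CInd G H T A N). \<forall>g\<in>F. x g = z g}
      = block_mass N ?c ?p F z" .
qed

end

end

section \<open>The block measures\<close>

text \<open>
  Here \<open>g = \<theta> (j g) \<otimes> c g\<close> is the decomposition along a transversal, \<open>C n\<close> is the cut set, and a point
  \<open>v\<close> has the position \<open>p n v\<close> in the block that starts at \<open>b n v\<close>.
\<close>

locale block_setting = sofic_setting G V \<sigma> \<theta>
  for G :: "('g, 'm) monoid_scheme" (structure) and V :: "nat \<Rightarrow> 'v set"
    and \<sigma> :: "nat \<Rightarrow> 'g \<Rightarrow> 'v \<Rightarrow> 'v" and \<theta> :: "int \<Rightarrow> 'g" +
  fixes A :: "'a set" and \<nu> :: "(int \<Rightarrow> 'a) measure" and c :: "'g \<Rightarrow> 'g" and j :: "'g \<Rightarrow> int"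
    and \<mu> :: "('g \<Rightarrow> 'a) measure"
    and C :: "nat \<Rightarrow> 'v set" and b :: "nat \<Rightarrow> 'v \<Rightarrow> 'v" and p :: "nat \<Rightarrow> 'v \<Rightarrow> nat" and L :: "nat \<Rightarrow> nat"
  assumes finite_A: "finite A"
    and proc: "process integer_group A \<nu>"
    and c_closed: "g \<in> carrier G \<Longrightarrow> c g \<in> carrier G"
    and decomposition: "g \<in> carrier G \<Longrightarrow> \<theta> (j g) \<otimes> c g = g"
    and c_apart: "g \<in> carrier G \<Longrightarrow> h \<in> carrier G \<Longrightarrow> c g = \<theta> k \<otimes> c h \<Longrightarrow> c g = c h"
    and \<mu>_Prob: "\<mu> \<in> Prob (carrier G) A"
    and \<mu>_cylinder: "F \<subseteq> carrier G \<Longrightarrow> finite F \<Longrightarrow>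
      measure \<mu> {x \<in> space \<mu>. \<forall>g\<in>F. x g = z g} = block_mass \<nu> c j F z"
    and aaa_uncut: "aaa (\<lambda>n v. v \<notin> C n)"
    and b_in_V: "v \<in> V n \<Longrightarrow> b n v \<in> V n"
    and p_less: "v \<in> V n \<Longrightarrow> p n v < 2 * L n"
    and \<tau>_p_b: "v \<in> V n \<Longrightarrow> (\<tau> n ^^ p n v) (b n v) = v"
    and block_step: "v \<in> V n \<Longrightarrow> \<tau> n v \<notin> C n \<Longrightarrow> b n (\<tau> n v) = b n v \<and> p n (\<tau> n v) = Suc (p n v)"
    and L_small: "(\<lambda>n. real (L n) / real (card (V n))) \<longlonglongrightarrow> 0"
    and aaa_b_distinct: "g \<in> carrier G \<Longrightarrow> h \<in> carrier G \<Longrightarrow> (\<And>k. g \<noteq> \<theta> k \<otimes> h)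
       \<Longrightarrow> aaa (\<lambda>n v. b n (\<sigma> n g v) \<noteq> b n (\<sigma> n h v))"
begin

abbreviation P :: "nat \<Rightarrow> 'v \<Rightarrow> int" where "P n v \<equiv> int (p n v)"

abbreviation \<mu>\<^sub>n :: "nat \<Rightarrow> ('v \<Rightarrow> 'a) measure" where
  "\<mu>\<^sub>n n \<equiv> block_measure (V n) A \<nu> (b n) (P n)"

abbreviation e :: "nat \<Rightarrow> 'g \<Rightarrow> 'g" where "e m t \<equiv> \<theta> (- int m) \<otimes> t"

lemma \<nu>_Prob: "\<nu> \<in> Prob UNIV A"
  by (rule process_integer_group(1)[OF proc])

lemma A_nonempty: "A \<noteq> {}"
proof -
  interpret prob_space \<nu> using \<nu>_Prob by (simp add: Prob_def)
  show ?thesis using not_empty unfolding Prob_space[OF \<nu>_Prob] by (auto simp: PiE_eq_empty_iff)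
qed

lemma \<mu>\<^sub>n_Prob: "\<mu>\<^sub>n n \<in> Prob (V n) A"
  using b_in_V by (intro block_measure_Prob[OF \<nu>_Prob]) auto

lemma e_closed: "t \<in> carrier G \<Longrightarrow> e m t \<in> carrier G"
  using \<theta>_closed by simp

lemma \<theta>_e: "t \<in> carrier G \<Longrightarrow> \<theta> k \<otimes> e m t = \<theta> (k - int m) \<otimes> t"
  using \<theta>_add[of k "- int m"] \<theta>_closed by (simp add: m_assoc[symmetric])

lemma c_eq_if_e:
  assumes "g \<in> carrier G" "h \<in> carrier G" "e m (c g) = \<theta> k \<otimes> e m (c h)"
  shows "c g = c h"
proof (rule c_apart[OF assms(1,2)])
  have "c g = \<theta> (int m) \<otimes> e m (c g)"
    using \<theta>_e[of "c g" "int m" m] c_closed[OF assms(1)] by (simp add: \<theta>_zero)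
  also have "\<dots> = \<theta> (int m) \<otimes> (\<theta> (k - int m) \<otimes> c h)"
    using assms c_closed \<theta>_e by simp
  also have "\<dots> = \<theta> (int m + (k - int m)) \<otimes> c h"
    unfolding \<theta>_add using \<theta>_closed c_closed[OF assms(2)] by (simp add: m_assoc)
  also have "int m + (k - int m) = k" by simp
  finally show "c g = \<theta> k \<otimes> c h" .
qed

lemma block_iterate:
  assumes "v \<in> V n" "\<forall>i\<in>{1..k}. (\<tau> n ^^ i) v \<notin> C n"
  shows "b n ((\<tau> n ^^ k) v) = b n v \<and> p n ((\<tau> n ^^ k) v) = p n v + k"
  using assms(2)
proof (induction k)
  case (Suc k)
  then have "b n ((\<tau> n ^^ k) v) = b n v \<and> p n ((\<tau> n ^^ k) v) = p n v + k" by auto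
  moreover have "\<tau> n ((\<tau> n ^^ k) v) \<notin> C n" using Suc.prems by force
  ultimately show ?case
    using block_step[of "(\<tau> n ^^ k) v" n] assms(1) by (simp add: \<tau>_pow_in_V)
qed simp

text \<open>
  The points \<open>\<sigma> n g v\<close> with \<open>g\<close> in a fixed coset lie on the \<open>\<tau> n\<close>-orbit of the common starting point
  \<open>\<sigma> n (e m (c g)) v\<close>, where \<open>m\<close> is chosen so large that all exponents are nonnegative.
\<close>

lemma aaa_window:
  assumes F: "F \<subseteq> carrier G" "finite F" and m: "\<And>g. g \<in> F \<Longrightarrow> \<bar>j g\<bar> \<le> int m"
  shows "aaa (\<lambda>n v. \<forall>g\<in>F. b n (\<sigma> n g v) = b n (\<sigma> n (e m (c g)) v) \<and>
    P n (\<sigma> n g v) = P n (\<sigma> n (e m (c g)) v) + (j g + int m))"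
proof (rule aaa_ball[OF F(2)])
  fix g assume g: "g \<in> F"
  then have gG: "g \<in> carrier G" using F by auto
  define k where "k = nat (j g + int m)"
  have k: "int k = j g + int m" using m[OF g] by (simp add: k_def)
  have "\<theta> (int k) \<otimes> e m (c g) = g"
    using \<theta>_e[OF c_closed[OF gG], of "int k" m] decomposition[OF gG] k by simp
  then have 1: "aaa (\<lambda>n v. (\<tau> n ^^ k) (\<sigma> n (e m (c g)) v) = \<sigma> n g v)"
    using aaa_\<tau>[OF e_closed[OF c_closed[OF gG]], of k m] by simp
  have 2: "aaa (\<lambda>n v. \<forall>i\<in>{1..k}. (\<tau> n ^^ i) (\<sigma> n (e m (c g)) v) \<notin> C n)"
    using e_closed[OF c_closed[OF gG]]
    by (intro aaa_ball aaa_sofic[where P = "\<lambda>n v. (\<tau> n ^^ _) v \<notin> C n"]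
        aaa_\<tau>_pow[where P = "\<lambda>n v. v \<notin> C n"] aaa_uncut) auto
  show "aaa (\<lambda>n v. b n (\<sigma> n g v) = b n (\<sigma> n (e m (c g)) v) \<and>
    P n (\<sigma> n g v) = P n (\<sigma> n (e m (c g)) v) + (j g + int m))"
  proof (rule aaa_mono[OF aaa_conj[OF 1 2]])
    fix n v assume v: "v \<in> V n" and *: "(\<tau> n ^^ k) (\<sigma> n (e m (c g)) v) = \<sigma> n g v \<and>
      (\<forall>i\<in>{1..k}. (\<tau> n ^^ i) (\<sigma> n (e m (c g)) v) \<notin> C n)"
    have "\<sigma> n (e m (c g)) v \<in> V n" using v e_closed[OF c_closed[OF gG]] sofic_in_V by blast
    from block_iterate[OF this conjunct2[OF *]]
    show "b n (\<sigma> n g v) = b n (\<sigma> n (e m (c g)) v) \<and>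
      P n (\<sigma> n g v) = P n (\<sigma> n (e m (c g)) v) + (j g + int m)"
      by (simp only: conjunct1[OF *] k[symmetric] of_nat_add simp_thms)
  qed
qed

lemma exponent_bound:
  assumes "finite F"
  obtains m where "\<And>g. g \<in> F \<Longrightarrow> \<bar>j g\<bar> \<le> int m"
proof (rule that)
  fix g assume "g \<in> F"
  then have "\<bar>j g\<bar> \<le> Max ((\<lambda>g. \<bar>j g\<bar>) ` F)" using assms by (intro Max_ge) auto
  moreover from this have "0 \<le> Max ((\<lambda>g. \<bar>j g\<bar>) ` F)" using abs_ge_zero order_trans by blast
  ultimately show "\<bar>j g\<bar> \<le> int (nat (Max ((\<lambda>g. \<bar>j g\<bar>) ` F)))" by simp
qed

lemma aaa_block_mass:
  assumes F: "F \<subseteq> carrier G" "finite F"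
  shows "aaa (\<lambda>n v. \<forall>z. block_mass \<nu> (\<lambda>g. b n (\<sigma> n g v)) (\<lambda>g. P n (\<sigma> n g v)) F z = block_mass \<nu> c j F z)"
proof -
  obtain m where m: "\<And>g. g \<in> F \<Longrightarrow> \<bar>j g\<bar> \<le> int m" using exponent_bound[OF F(2)] by blast
  have distinct: "aaa (\<lambda>n v. \<forall>g\<in>F. \<forall>h\<in>F. c g \<noteq> c h \<longrightarrow>
      b n (\<sigma> n (e m (c g)) v) \<noteq> b n (\<sigma> n (e m (c h)) v))"
  proof (intro aaa_ball F(2))
    fix g h assume gh: "g \<in> F" "h \<in> F"
    show "aaa (\<lambda>n v. c g \<noteq> c h \<longrightarrow> b n (\<sigma> n (e m (c g)) v) \<noteq> b n (\<sigma> n (e m (c h)) v))"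
    proof (cases "c g = c h")
      case True
      then show ?thesis using aaa_True by simp
    next
      case False
      then have "aaa (\<lambda>n v. b n (\<sigma> n (e m (c g)) v) \<noteq> b n (\<sigma> n (e m (c h)) v))"
        using gh F(1) c_eq_if_e[of g h] by (intro aaa_b_distinct e_closed c_closed) blast+
      then show ?thesis by (rule aaa_mono) simp
    qed
  qed
  show ?thesis
  proof (rule aaa_mono[OF aaa_conj[OF aaa_window[OF F m] distinct]])
    fix n v
    assume *: "(\<forall>g\<in>F. b n (\<sigma> n g v) = b n (\<sigma> n (e m (c g)) v) \<and>
        P n (\<sigma> n g v) = P n (\<sigma> n (e m (c g)) v) + (j g + int m)) \<and>
      (\<forall>g\<in>F. \<forall>h\<in>F. c g \<noteq> c h \<longrightarrow> b n (\<sigma> n (e m (c g)) v) \<noteq> b n (\<sigma> n (e m (c h)) v))"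
    show "\<forall>z. block_mass \<nu> (\<lambda>g. b n (\<sigma> n g v)) (\<lambda>g. P n (\<sigma> n g v)) F z = block_mass \<nu> c j F z"
    proof (intro allI block_mass_shift[OF proc F(2), where \<beta> = "\<lambda>t. b n (\<sigma> n (e m t) v)"
          and q = "\<lambda>t. P n (\<sigma> n (e m t) v) + int m"])
      show "inj_on (\<lambda>t. b n (\<sigma> n (e m t) v)) (c ` F)"
        using conjunct2[OF *] by (intro inj_onI) blast
      show "b n (\<sigma> n g v) = b n (\<sigma> n (e m (c g)) v)" if "g \<in> F" for g
        using conjunct1[OF *] that by blast
      show "P n (\<sigma> n g v) = j g + (P n (\<sigma> n (e m (c g)) v) + int m)" if "g \<in> F" for g
        using bspec[OF conjunct1[OF *] that] by linarith
    qed
  qed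
qed

lemma pullback_measurable:
  assumes "v \<in> V n"
  shows "(\<lambda>a. pullback_name G (\<sigma> n) a v) \<in> measurable (\<mu>\<^sub>n n) (config (carrier G) A)"
  unfolding pullback_name_def config_def
  by (rule measurable_restrict, rule component_measurable[OF \<mu>\<^sub>n_Prob])
    (simp add: assms sofic_in_V)

lemma pullback_distr_cylinder:
  assumes v: "v \<in> V n" and F: "F \<subseteq> carrier G" "finite F"
  defines "D \<equiv> distr (\<mu>\<^sub>n n) (config (carrier G) A) (\<lambda>a. pullback_name G (\<sigma> n) a v)"
  shows "D \<in> Prob (carrier G) A"
    and "measure D {x \<in> space D. \<forall>g\<in>F. x g = z g}
      = block_mass \<nu> (\<lambda>g. b n (\<sigma> n g v)) (\<lambda>g. P n (\<sigma> n g v)) F z"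
    and "measure (\<mu>\<^sub>n n) {a \<in> space (\<mu>\<^sub>n n). \<forall>g\<in>F. a (\<sigma> n g v) = z g}
      = block_mass \<nu> (\<lambda>g. b n (\<sigma> n g v)) (\<lambda>g. P n (\<sigma> n g v)) F z"
proof -
  show D: "D \<in> Prob (carrier G) A"
    unfolding D_def using \<mu>\<^sub>n_Prob by (intro Prob_distr pullback_measurable[OF v]) (simp add: Prob_def)
  have "{x \<in> space (config (carrier G) A). \<forall>g\<in>F. x g = z g} \<in> sets (config (carrier G) A)"
    using cylinder_in_sets[OF D F] by (simp add: D_def)
  then have "measure D {x \<in> space D. \<forall>g\<in>F. x g = z g}
    = measure (\<mu>\<^sub>n n) {a \<in> space (\<mu>\<^sub>n n). \<forall>g\<in>F. pullback_name G (\<sigma> n) a v g = z g}"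
    unfolding D_def space_distr by (rule distr_Collect[OF pullback_measurable[OF v]])
  also have "{a \<in> space (\<mu>\<^sub>n n). \<forall>g\<in>F. pullback_name G (\<sigma> n) a v g = z g}
    = {a \<in> space (\<mu>\<^sub>n n). \<forall>g\<in>F. a (\<sigma> n g v) = z g}"
    by (intro Collect_cong conj_cong ball_cong refl) (use F(1) in \<open>simp add: pullback_name_def subset_iff\<close>)
  finally have 1: "measure D {x \<in> space D. \<forall>g\<in>F. x g = z g}
    = measure (\<mu>\<^sub>n n) {a \<in> space (\<mu>\<^sub>n n). \<forall>g\<in>F. a (\<sigma> n g v) = z g}" .
  show 2: "measure (\<mu>\<^sub>n n) {a \<in> space (\<mu>\<^sub>n n). \<forall>g\<in>F. a (\<sigma> n g v) = z g}
      = block_mass \<nu> (\<lambda>g. b n (\<sigma> n g v)) (\<lambda>g. P n (\<sigma> n g v)) F z"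
    using v F b_in_V by (intro measure_block_measure[OF \<nu>_Prob]) (auto simp: sofic_in_V subset_iff)
  show "measure D {x \<in> space D. \<forall>g\<in>F. x g = z g}
      = block_mass \<nu> (\<lambda>g. b n (\<sigma> n g v)) (\<lambda>g. P n (\<sigma> n g v)) F z"
    by (simp only: 1 2)
qed

lemma local_convergence:
  assumes "openin (weak_star G A) \<O>" "\<mu> \<in> \<O>"
  shows "aaa (\<lambda>n v. distr (\<mu>\<^sub>n n) (config (carrier G) A) (\<lambda>a. pullback_name G (\<sigma> n) a v) \<in> \<O>)"
proof -
  obtain Q \<delta> where Q: "finite Q" "\<delta> > 0"
    "\<forall>(F, z)\<in>Q. F \<subseteq> carrier G \<and> finite F \<and> z \<in> F \<rightarrow>\<^sub>E A"
    "\<forall>M\<in>Prob (carrier G) A. (\<forall>(F, z)\<in>Q. \<bar>measure M {x \<in> space M. \<forall>g\<in>F. x g = z g}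
        - measure \<mu> {x \<in> space \<mu>. \<forall>g\<in>F. x g = z g}\<bar> < \<delta>) \<longrightarrow> M \<in> \<O>"
    using weak_star_neighbourhood[OF finite_A A_nonempty \<mu>_Prob assms] by (elim exE conjE)
  have "aaa (\<lambda>n v. \<forall>q\<in>Q. \<forall>z. block_mass \<nu> (\<lambda>g. b n (\<sigma> n g v)) (\<lambda>g. P n (\<sigma> n g v)) (fst q) z
    = block_mass \<nu> c j (fst q) z)"
  proof (rule aaa_ball[OF Q(1)])
    fix q assume "q \<in> Q"
    with Q(3) have "case q of (F, z) \<Rightarrow> F \<subseteq> carrier G \<and> finite F \<and> z \<in> F \<rightarrow>\<^sub>E A" by (rule bspec)
    then have "fst q \<subseteq> carrier G" "finite (fst q)" by (simp_all add: split_beta')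
    then show "aaa (\<lambda>n v. \<forall>z. block_mass \<nu> (\<lambda>g. b n (\<sigma> n g v)) (\<lambda>g. P n (\<sigma> n g v)) (fst q) z
      = block_mass \<nu> c j (fst q) z)" by (rule aaa_block_mass)
  qed
  then show ?thesis
  proof (rule aaa_mono)
    fix n v assume v: "v \<in> V n"
      and *: "\<forall>q\<in>Q. \<forall>z. block_mass \<nu> (\<lambda>g. b n (\<sigma> n g v)) (\<lambda>g. P n (\<sigma> n g v)) (fst q) z
        = block_mass \<nu> c j (fst q) z"
    let ?D = "distr (\<mu>\<^sub>n n) (config (carrier G) A) (\<lambda>a. pullback_name G (\<sigma> n) a v)"
    have "\<bar>measure ?D {x \<in> space ?D. \<forall>g\<in>F. x g = z g}
        - measure \<mu> {x \<in> space \<mu>. \<forall>g\<in>F. x g = z g}\<bar> < \<delta>" if "(F, z) \<in> Q" for F z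
    proof -
      have F: "F \<subseteq> carrier G" "finite F" using Q(3) that by auto
      have "block_mass \<nu> (\<lambda>g. b n (\<sigma> n g v)) (\<lambda>g. P n (\<sigma> n g v)) F z = block_mass \<nu> c j F z"
        using * that by force
      then show ?thesis
        using Q(2) by (simp only: pullback_distr_cylinder(2)[OF v F] \<mu>_cylinder[OF F] diff_self abs_zero)
    qed
    then show "?D \<in> \<O>"
      using pullback_distr_cylinder(1)[OF v empty_subsetI finite.emptyI] by (intro Q(4)[rule_format]) auto
  qed
qed

lemma empirical_cylinder:
  assumes V: "V n \<noteq> {}" and a: "a \<in> V n \<rightarrow>\<^sub>E A" and F: "F \<subseteq> carrier G" "finite F"
  shows "empirical G A (V n) (\<sigma> n) a \<in> Prob (carrier G) A"
    and "measure (empirical G A (V n) (\<sigma> n) a) {x \<in> space (empirical G A (V n) (\<sigma> n) a). \<forall>g\<in>F. x g = z g}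
      = real (card {v \<in> V n. \<forall>g\<in>F. a (\<sigma> n g v) = z g}) / real (card (V n))"
proof -
  let ?U = "uniform_count_measure (V n)"
  have meas: "pullback_name G (\<sigma> n) a \<in> measurable ?U (config (carrier G) A)"
  proof (rule measurableI)
    fix v assume "v \<in> space ?U"
    then have "v \<in> V n" by (simp add: space_uniform_count_measure)
    then show "pullback_name G (\<sigma> n) a v \<in> space (config (carrier G) A)"
      using a by (auto simp: space_config pullback_name_def sofic_in_V)
  qed (auto simp: sets_uniform_count_measure space_uniform_count_measure)
  show P: "empirical G A (V n) (\<sigma> n) a \<in> Prob (carrier G) A"
    unfolding empirical_def
    by (intro Prob_distr meas prob_space_uniform_count_measure finite_V V)
  have "{x \<in> space (config (carrier G) A). \<forall>g\<in>F. x g = z g} \<in> sets (config (carrier G) A)"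
    using cylinder_in_sets[OF P F] by (simp add: empirical_def)
  then have "measure (empirical G A (V n) (\<sigma> n) a) {x \<in> space (empirical G A (V n) (\<sigma> n) a). \<forall>g\<in>F. x g = z g}
    = measure ?U {v \<in> space ?U. \<forall>g\<in>F. pullback_name G (\<sigma> n) a v g = z g}"
    unfolding empirical_def space_distr by (rule distr_Collect[OF meas])
  also have "{v \<in> space ?U. \<forall>g\<in>F. pullback_name G (\<sigma> n) a v g = z g}
    = {v \<in> V n. \<forall>g\<in>F. a (\<sigma> n g v) = z g}"
    unfolding space_uniform_count_measure
    by (intro Collect_cong conj_cong ball_cong refl) (use F(1) in \<open>simp add: pullback_name_def subset_iff\<close>)
  also have "measure ?U \<dots> = real (card {v \<in> V n. \<forall>g\<in>F. a (\<sigma> n g v) = z g}) / real (card (V n))"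
    by (rule measure_uniform_count_measure) (auto simp: finite_V)
  finally show "measure (empirical G A (V n) (\<sigma> n) a) {x \<in> space (empirical G A (V n) (\<sigma> n) a). \<forall>g\<in>F. x g = z g}
      = real (card {v \<in> V n. \<forall>g\<in>F. a (\<sigma> n g v) = z g}) / real (card (V n))" .
qed

lemma card_block_le:
  "card {w \<in> V n. b n (\<sigma> n h w) = x} \<le> 2 * L n" if h: "h \<in> carrier G"
proof -
  have "inj_on (\<lambda>w. p n (\<sigma> n h w)) {w \<in> V n. b n (\<sigma> n h w) = x}"
  proof (rule inj_onI, clarify)
    fix v w assume vw: "v \<in> V n" "w \<in> V n" "p n (\<sigma> n h v) = p n (\<sigma> n h w)"
      "x = b n (\<sigma> n h v)" "b n (\<sigma> n h w) = b n (\<sigma> n h v)"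
    have in_V: "\<sigma> n h v \<in> V n" "\<sigma> n h w \<in> V n" using vw(1,2) h by (simp_all add: sofic_in_V)
    have "\<sigma> n h v = (\<tau> n ^^ p n (\<sigma> n h v)) (b n (\<sigma> n h v))" by (rule \<tau>_p_b[OF in_V(1), symmetric])
    also have "\<dots> = (\<tau> n ^^ p n (\<sigma> n h w)) (b n (\<sigma> n h w))" unfolding vw(3,5) ..
    also have "\<dots> = \<sigma> n h w" by (rule \<tau>_p_b[OF in_V(2)])
    finally have "\<sigma> n h v = \<sigma> n h w" .
    then show "v = w" using h by (simp add: sofic_inj)
  qed
  then have "card {w \<in> V n. b n (\<sigma> n h w) = x} \<le> card {..<2 * L n}"
  proof (rule card_inj_on_le)
    show "(\<lambda>w. p n (\<sigma> n h w)) ` {w \<in> V n. b n (\<sigma> n h w) = x} \<subseteq> {..<2 * L n}"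
      by (auto simp: sofic_in_V[OF h] intro!: p_less)
  qed simp
  then show ?thesis by simp
qed

lemma cylinder_frequency_deviation:
  assumes F: "F \<subseteq> carrier G" "finite F" and \<delta>: "\<delta> > 0"
  shows "(\<lambda>n. measure (\<mu>\<^sub>n n) {a \<in> space (\<mu>\<^sub>n n). \<delta> \<le>
    \<bar>real (card {v \<in> V n. \<forall>g\<in>F. a (\<sigma> n g v) = z g}) / real (card (V n)) - block_mass \<nu> c j F z\<bar>})
    \<longlonglongrightarrow> 0"
proof -
  define good where "good n v \<longleftrightarrow>
    block_mass \<nu> (\<lambda>g. b n (\<sigma> n g v)) (\<lambda>g. P n (\<sigma> n g v)) F z = block_mass \<nu> c j F z" for n v
  have good: "aaa good" unfolding good_def
    by (rule aaa_mono[OF aaa_block_mass[OF F]]) blast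
  define B where "B n = {v \<in> V n. \<not> good n v}" for n
  define R where "R n = B n \<times> V n \<union> V n \<times> B n \<union>
    (\<Union>v\<in>V n. \<Union>g\<in>F. \<Union>h\<in>F. {v} \<times> {w \<in> V n. b n (\<sigma> n h w) = b n (\<sigma> n g v)})" for n
  let ?N = "\<lambda>n. real (card (V n))" and ?F = "real (card F)"
  have cardR: "real (card (R n)) \<le> 2 * real (card (B n)) * ?N n + ?N n * ?F * ?F * (2 * real (L n))" for n
  proof -
    have "card (\<Union>v\<in>V n. \<Union>g\<in>F. \<Union>h\<in>F. {v} \<times> {w \<in> V n. b n (\<sigma> n h w) = b n (\<sigma> n g v)})
      \<le> (\<Sum>v\<in>V n. card (\<Union>g\<in>F. \<Union>h\<in>F. {v} \<times> {w \<in> V n. b n (\<sigma> n h w) = b n (\<sigma> n g v)}))"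
      by (rule card_UN_le[OF finite_V])
    also have "\<dots> \<le> (\<Sum>v\<in>V n. \<Sum>g\<in>F. \<Sum>h\<in>F. 2 * L n)"
    proof (rule sum_mono)
      fix v assume "v \<in> V n"
      have "card (\<Union>g\<in>F. \<Union>h\<in>F. {v} \<times> {w \<in> V n. b n (\<sigma> n h w) = b n (\<sigma> n g v)})
        \<le> (\<Sum>g\<in>F. card (\<Union>h\<in>F. {v} \<times> {w \<in> V n. b n (\<sigma> n h w) = b n (\<sigma> n g v)}))"
        by (rule card_UN_le[OF F(2)])
      also have "\<dots> \<le> (\<Sum>g\<in>F. \<Sum>h\<in>F. card ({v} \<times> {w \<in> V n. b n (\<sigma> n h w) = b n (\<sigma> n g v)}))"
        by (intro sum_mono card_UN_le[OF F(2)])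
      also have "\<dots> \<le> (\<Sum>g\<in>F. \<Sum>h\<in>F. 2 * L n)"
        using F(1) by (intro sum_mono) (simp add: card_cartesian_product card_block_le subset_iff)
      finally show "card (\<Union>g\<in>F. \<Union>h\<in>F. {v} \<times> {w \<in> V n. b n (\<sigma> n h w) = b n (\<sigma> n g v)})
        \<le> (\<Sum>g\<in>F. \<Sum>h\<in>F. 2 * L n)" .
    qed
    finally have "card (\<Union>v\<in>V n. \<Union>g\<in>F. \<Union>h\<in>F. {v} \<times> {w \<in> V n. b n (\<sigma> n h w) = b n (\<sigma> n g v)})
      \<le> card (V n) * (card F * (card F * (2 * L n)))" by simp
    moreover have "card (R n) \<le> card (B n \<times> V n) + card (V n \<times> B n)
      + card (\<Union>v\<in>V n. \<Union>g\<in>F. \<Union>h\<in>F. {v} \<times> {w \<in> V n. b n (\<sigma> n h w) = b n (\<sigma> n g v)})"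
      unfolding R_def by (meson add_le_mono1 card_Un_le le_trans)
    ultimately have "card (R n) \<le> card (B n) * card (V n) + card (V n) * card (B n)
      + card (V n) * (card F * (card F * (2 * L n)))" unfolding card_cartesian_product by linarith
    then have "real (card (R n)) \<le> real (card (B n) * card (V n) + card (V n) * card (B n)
      + card (V n) * (card F * (card F * (2 * L n))))" by (simp only: of_nat_le_iff)
    also have "\<dots> = 2 * real (card (B n)) * ?N n + ?N n * ?F * ?F * (2 * real (L n))"
      by (simp add: algebra_simps)
    finally show ?thesis .
  qed
  have bound: "measure (\<mu>\<^sub>n n) {a \<in> space (\<mu>\<^sub>n n). \<delta> \<le>
      \<bar>real (card {v \<in> V n. \<forall>g\<in>F. a (\<sigma> n g v) = z g}) / ?N n - block_mass \<nu> c j F z\<bar>}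
    \<le> (2 * (real (card (B n)) / ?N n) + 2 * ?F * ?F * (real (L n) / ?N n)) / \<delta>\<^sup>2"
    if V: "card (V n) > 0" for n
  proof -
    interpret prob_space "\<mu>\<^sub>n n" using \<mu>\<^sub>n_Prob by (simp add: Prob_def)
    define E where "E v = {a \<in> space (\<mu>\<^sub>n n). \<forall>g\<in>F. a (\<sigma> n g v) = z g}" for v
    have E: "E v \<in> events" if "v \<in> V n" for v
    proof -
      have "{a \<in> space (\<mu>\<^sub>n n). \<forall>g\<in>F. True = True \<longrightarrow> a (\<sigma> n g v) = z g} \<in> events"
        by (rule block_event_sets[OF \<mu>\<^sub>n_Prob F(2)]) (use that F(1) in \<open>auto simp: sofic_in_V\<close>)
      then show ?thesis by (simp add: E_def)
    qed
    have pE: "prob (E v) = block_mass \<nu> (\<lambda>g. b n (\<sigma> n g v)) (\<lambda>g. P n (\<sigma> n g v)) F z" if "v \<in> V n" for v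
      unfolding E_def by (rule pullback_distr_cylinder(3)[OF that F])
    have m: "0 \<le> block_mass \<nu> c j F z" "block_mass \<nu> c j F z \<le> 1"
    proof -
      interpret \<mu>: prob_space \<mu> using \<mu>_Prob by (simp add: Prob_def)
      show "0 \<le> block_mass \<nu> c j F z" "block_mass \<nu> c j F z \<le> 1"
        unfolding \<mu>_cylinder[OF F, symmetric] by auto
    qed
    have "prob {a \<in> space (\<mu>\<^sub>n n). \<delta> \<le> \<bar>real (card {v \<in> V n. a \<in> E v}) / ?N n - block_mass \<nu> c j F z\<bar>}
      \<le> real (card (R n)) / (?N n * ?N n) / \<delta>\<^sup>2"
    proof (rule frequency_deviation[OF finite_V _ E _ m \<delta>])
      show "V n \<noteq> {}" using V by auto
      show "R n \<subseteq> V n \<times> V n" by (auto simp: R_def B_def)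
      fix v w assume vw: "v \<in> V n" "w \<in> V n" "(v, w) \<notin> R n"
      then have g: "good n v" "good n w" by (auto simp: R_def B_def)
      have disj: "b n (\<sigma> n g v) \<noteq> b n (\<sigma> n h w)" if "g \<in> F" "h \<in> F" for g h
      proof
        assume "b n (\<sigma> n g v) = b n (\<sigma> n h w)"
        then have "w \<in> {w \<in> V n. b n (\<sigma> n h w) = b n (\<sigma> n g v)}" using vw(2) by simp
        then have "(v, w) \<in> R n" unfolding R_def using vw(1) that by blast
        with vw(3) show False ..
      qed
      have "E v \<inter> E w = {a \<in> space (\<mu>\<^sub>n n). (\<forall>g\<in>F. a (\<sigma> n g v) = z g) \<and> (\<forall>g\<in>F. a (\<sigma> n g w) = z g)}"
        unfolding E_def by blast
      then have "prob (E v \<inter> E w) = block_mass \<nu> (\<lambda>g. b n (\<sigma> n g v)) (\<lambda>g. P n (\<sigma> n g v)) F z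
        * block_mass \<nu> (\<lambda>g. b n (\<sigma> n g w)) (\<lambda>g. P n (\<sigma> n g w)) F z"
        using vw(1,2) F disj b_in_V
        by (simp only:) (intro measure_block_measure_disjoint[OF \<nu>_Prob]; auto simp: sofic_in_V subset_iff)
      then show "prob (E v) = block_mass \<nu> c j F z \<and> prob (E w) = block_mass \<nu> c j F z \<and>
        prob (E v \<inter> E w) = block_mass \<nu> c j F z * block_mass \<nu> c j F z"
        using g unfolding pE[OF vw(1)] pE[OF vw(2)] good_def by simp
    qed
    also have "\<dots> \<le> (2 * (real (card (B n)) / ?N n) + 2 * ?F * ?F * (real (L n) / ?N n)) / \<delta>\<^sup>2"
    proof (rule divide_right_mono)
      have "real (card (R n)) / (?N n * ?N n)
        \<le> (2 * real (card (B n)) * ?N n + ?N n * ?F * ?F * (2 * real (L n))) / (?N n * ?N n)"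
        using cardR by (rule divide_right_mono) simp
      also have "\<dots> = 2 * (real (card (B n)) / ?N n) + 2 * ?F * ?F * (real (L n) / ?N n)"
        using V by (simp add: field_simps)
      finally show "real (card (R n)) / (?N n * ?N n)
        \<le> 2 * (real (card (B n)) / ?N n) + 2 * ?F * ?F * (real (L n) / ?N n)" .
    qed simp
    also have "{a \<in> space (\<mu>\<^sub>n n). \<delta> \<le> \<bar>real (card {v \<in> V n. a \<in> E v}) / ?N n - block_mass \<nu> c j F z\<bar>}
      = {a \<in> space (\<mu>\<^sub>n n). \<delta> \<le> \<bar>real (card {v \<in> V n. \<forall>g\<in>F. a (\<sigma> n g v) = z g}) / ?N n - block_mass \<nu> c j F z\<bar>}"
    proof (intro Collect_cong conj_cong refl)
      fix a assume "a \<in> space (\<mu>\<^sub>n n)"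
      then have "{v \<in> V n. a \<in> E v} = {v \<in> V n. \<forall>g\<in>F. a (\<sigma> n g v) = z g}" unfolding E_def by blast
      then show "(\<delta> \<le> \<bar>real (card {v \<in> V n. a \<in> E v}) / ?N n - block_mass \<nu> c j F z\<bar>)
        = (\<delta> \<le> \<bar>real (card {v \<in> V n. \<forall>g\<in>F. a (\<sigma> n g v) = z g}) / ?N n - block_mass \<nu> c j F z\<bar>)"
        by (simp only:)
    qed
    finally show ?thesis .
  qed
  show ?thesis
  proof (rule Lim_null_comparison)
    show "\<forall>\<^sub>F n in sequentially. norm (measure (\<mu>\<^sub>n n) {a \<in> space (\<mu>\<^sub>n n). \<delta> \<le>
        \<bar>real (card {v \<in> V n. \<forall>g\<in>F. a (\<sigma> n g v) = z g}) / ?N n - block_mass \<nu> c j F z\<bar>})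
      \<le> (2 * (real (card (B n)) / ?N n) + 2 * ?F * ?F * (real (L n) / ?N n)) / \<delta>\<^sup>2"
      using eventually_card_pos
    proof eventually_elim
      case (elim n)
      show ?case using bound[OF elim] by (simp only: real_norm_def abs_of_nonneg measure_nonneg)
    qed
    have "(\<lambda>n. real (card (B n)) / ?N n) \<longlonglongrightarrow> 0"
      using good unfolding aaa_iff B_def .
    then have "(\<lambda>n. (2 * (real (card (B n)) / ?N n) + 2 * ?F * ?F * (real (L n) / ?N n)) / \<delta>\<^sup>2)
      \<longlonglongrightarrow> (2 * 0 + 2 * ?F * ?F * 0) / \<delta>\<^sup>2"
      using \<delta> by (intro tendsto_intros L_small) auto
    then show "(\<lambda>n. (2 * (real (card (B n)) / ?N n) + 2 * ?F * ?F * (real (L n) / ?N n)) / \<delta>\<^sup>2) \<longlonglongrightarrow> 0"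
      by simp
  qed
qed

end

context block_setting
begin

lemma empirical_convergence:
  assumes "openin (weak_star G A) \<O>" "\<mu> \<in> \<O>"
  shows "(\<lambda>n. measure (\<mu>\<^sub>n n) {a \<in> space (\<mu>\<^sub>n n). empirical G A (V n) (\<sigma> n) a \<in> \<O>}) \<longlonglongrightarrow> 1"
proof -
  obtain Q \<delta> where Q: "finite Q" "\<delta> > 0"
    "\<forall>(F, z)\<in>Q. F \<subseteq> carrier G \<and> finite F \<and> z \<in> F \<rightarrow>\<^sub>E A"
    "\<forall>M\<in>Prob (carrier G) A. (\<forall>(F, z)\<in>Q. \<bar>measure M {x \<in> space M. \<forall>g\<in>F. x g = z g}
        - measure \<mu> {x \<in> space \<mu>. \<forall>g\<in>F. x g = z g}\<bar> < \<delta>) \<longrightarrow> M \<in> \<O>"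
    using weak_star_neighbourhood[OF finite_A A_nonempty \<mu>_Prob assms] by (elim exE conjE)
  have QF: "fst q \<subseteq> carrier G" "finite (fst q)" if "q \<in> Q" for q
  proof -
    have "case q of (F, z) \<Rightarrow> F \<subseteq> carrier G \<and> finite F \<and> z \<in> F \<rightarrow>\<^sub>E A" using Q(3) that by (rule bspec)
    then show "fst q \<subseteq> carrier G" "finite (fst q)" by (simp_all add: split_beta')
  qed
  define dev where "dev n q a = \<bar>real (card {v \<in> V n. \<forall>g\<in>fst q. a (\<sigma> n g v) = snd q g}) / real (card (V n))
      - block_mass \<nu> c j (fst q) (snd q)\<bar>" for n q a
  define X where "X n q = {a \<in> space (\<mu>\<^sub>n n). \<delta> \<le> dev n q a}" for n q
  define Y where "Y n = {a \<in> space (\<mu>\<^sub>n n). empirical G A (V n) (\<sigma> n) a \<in> \<O>}" for n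
  have sets: "X' \<in> sets (\<mu>\<^sub>n n)" if "X' \<subseteq> space (\<mu>\<^sub>n n)" for n X'
    using that \<mu>\<^sub>n_Prob[of n] Prob_space[OF \<mu>\<^sub>n_Prob, of n] sets_config_finite[OF finite_V finite_A, of n]
    by (simp add: Prob_def)
  have lower: "1 - (\<Sum>q\<in>Q. measure (\<mu>\<^sub>n n) (X n q)) \<le> measure (\<mu>\<^sub>n n) (Y n)" if "card (V n) > 0" for n
  proof -
    interpret prob_space "\<mu>\<^sub>n n" using \<mu>\<^sub>n_Prob by (simp add: Prob_def)
    have X: "X n q \<in> events" for q by (rule sets) (auto simp: X_def)
    have Y: "Y n \<in> events" by (rule sets) (auto simp: Y_def)
    have "space (\<mu>\<^sub>n n) - (\<Union>q\<in>Q. X n q) \<subseteq> Y n"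
    proof
      fix a assume a: "a \<in> space (\<mu>\<^sub>n n) - (\<Union>q\<in>Q. X n q)"
      have V: "V n \<noteq> {}" using that by auto
      have aV: "a \<in> V n \<rightarrow>\<^sub>E A" using a Prob_space[OF \<mu>\<^sub>n_Prob] by simp
      let ?P = "empirical G A (V n) (\<sigma> n) a"
      have "?P \<in> \<O>"
      proof (rule Q(4)[rule_format])
        show "?P \<in> Prob (carrier G) A"
          by (rule empirical_cylinder(1)[OF V aV empty_subsetI finite.emptyI])
        fix q assume q: "q \<in> Q"
        then have "a \<notin> X n q" using a by blast
        then have "dev n q a < \<delta>" using a by (simp add: X_def)
        then show "case q of (F, z) \<Rightarrow> \<bar>measure ?P {x \<in> space ?P. \<forall>g\<in>F. x g = z g}
          - measure \<mu> {x \<in> space \<mu>. \<forall>g\<in>F. x g = z g}\<bar> < \<delta>"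
          unfolding dev_def split_beta'
          by (simp only: empirical_cylinder(2)[OF V aV QF[OF q]] \<mu>_cylinder[OF QF[OF q]])
      qed
      then show "a \<in> Y n" using a by (simp add: Y_def)
    qed
    then have "prob (space (\<mu>\<^sub>n n) - (\<Union>q\<in>Q. X n q)) \<le> prob (Y n)"
      by (rule finite_measure_mono[OF _ Y])
    moreover have "prob (\<Union>q\<in>Q. X n q) \<le> (\<Sum>q\<in>Q. prob (X n q))"
      using X Q(1) by (intro finite_measure_subadditive_finite) auto
    moreover have "prob (space (\<mu>\<^sub>n n) - (\<Union>q\<in>Q. X n q)) = 1 - prob (\<Union>q\<in>Q. X n q)"
      using X Q(1) by (intro prob_compl sets.finite_UN) auto
    ultimately show ?thesis by linarith
  qed
  have "(\<lambda>n. measure (\<mu>\<^sub>n n) (Y n)) \<longlonglongrightarrow> 1"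
  proof (rule tendsto_sandwich)
    show "\<forall>\<^sub>F n in sequentially. 1 - (\<Sum>q\<in>Q. measure (\<mu>\<^sub>n n) (X n q)) \<le> measure (\<mu>\<^sub>n n) (Y n)"
      using eventually_card_pos by (rule eventually_mono) (rule lower)
    show "\<forall>\<^sub>F n in sequentially. measure (\<mu>\<^sub>n n) (Y n) \<le> 1"
      using \<mu>\<^sub>n_Prob by (intro always_eventually allI prob_space.prob_le_1) (simp add: Prob_def)
    have "(\<lambda>n. measure (\<mu>\<^sub>n n) (X n q)) \<longlonglongrightarrow> 0" if "q \<in> Q" for q
      unfolding X_def dev_def by (rule cylinder_frequency_deviation[OF QF[OF that] Q(2)])
    then have "(\<lambda>n. 1 - (\<Sum>q\<in>Q. measure (\<mu>\<^sub>n n) (X n q))) \<longlonglongrightarrow> 1 - (\<Sum>q\<in>Q. 0)"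
      by (intro tendsto_diff tendsto_sum tendsto_const) auto
    then show "(\<lambda>n. 1 - (\<Sum>q\<in>Q. measure (\<mu>\<^sub>n n) (X n q))) \<longlonglongrightarrow> 1" by simp
  qed simp
  then show ?thesis by (simp only: Y_def)
qed

lemma entropy_\<mu>:
  assumes F: "F \<subseteq> carrier G" "finite F"
  shows "shannon_entropy (marginal A F \<mu>)
    = (\<Sum>t\<in>c ` F. shannon_entropy (marginal A (j ` {g \<in> F. c g = t}) \<nu>))"
proof -
  have "inj_on (\<lambda>g. (c g, j g)) F"
    using decomposition F(1) by (intro inj_onI) (metis prod.inject subsetD)
  then show ?thesis
    using block_mass_entropy(2)[OF \<nu>_Prob finite_A F(2), of j c]
    by (simp only: shannon_entropy_marginal_cylinders[OF \<mu>_Prob F finite_A] \<mu>_cylinder[OF F] subset_UNIV simp_thms)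
qed

lemma entropy_\<mu>\<^sub>n:
  assumes U: "U \<subseteq> V n"
  shows "shannon_entropy (marginal A U (\<mu>\<^sub>n n))
    = (\<Sum>x\<in>b n ` U. shannon_entropy (marginal A (P n ` {u \<in> U. b n u = x}) \<nu>))"
proof -
  have finU: "finite U" using U finite_V finite_subset by blast
  have cyl: "measure (\<mu>\<^sub>n n) {a \<in> space (\<mu>\<^sub>n n). \<forall>u\<in>U. a u = z u} = block_mass \<nu> (b n) (P n) U z" for z
    using measure_block_measure[OF \<nu>_Prob _ _ finU, of "b n" "V n" "P n" "\<lambda>u. u" z] b_in_V U by auto
  have "inj_on (\<lambda>u. (b n u, P n u)) U"
  proof (rule inj_onI)
    fix u w assume "u \<in> U" "w \<in> U" "(b n u, P n u) = (b n w, P n w)"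
    then show "u = w" using \<tau>_p_b[of u n] \<tau>_p_b[of w n] U by auto
  qed
  then show ?thesis
    using block_mass_entropy(2)[OF \<nu>_Prob finite_A finU, of "P n" "b n"]
    by (simp only: shannon_entropy_marginal_cylinders[OF \<mu>\<^sub>n_Prob U finU finite_A] cyl subset_UNIV simp_thms)
qed

text \<open>
  For \<open>s\<close> in the good set \<open>W\<close>, a short \<open>\<tau> n\<close>-path between starting points over \<open>s'\<close> and \<open>s\<close> means that
  \<open>s\<close> and \<open>s'\<close> are joined by one of finitely many group elements.  So for separated sets the windows
  read in a common block are spread out, and uniform mixing applies to them.
\<close>

lemma model_mixing:
  assumes mix: "uniformly_mixing integer_group A \<nu>"
    and met: "proper_right_invariant_metric G \<rho>"
  shows "uniformly_model_mixing G A V \<sigma> (\<lambda>n. sofic_dist G \<rho> (V n) (\<sigma> n) (D n)) \<mu>\<^sub>n \<mu>"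
  unfolding uniformly_model_mixing_def
proof (intro allI impI)
  fix F :: "'g set" and \<epsilon> :: real
  assume FG: "F \<subseteq> carrier G" and "\<epsilon> > 0" and finF: "finite F"
  obtain m where m: "\<And>g. g \<in> F \<Longrightarrow> \<bar>j g\<bar> \<le> int m" using exponent_bound[OF finF] by blast
  define T where "T = c ` F"
  have finT: "finite T" and TG: "T \<subseteq> carrier G" using finF FG c_closed by (auto simp: T_def)
  define J where "J t = (+) (int m) ` (j ` {g \<in> F. c g = t})" for t
  define \<epsilon>' where "\<epsilon>' = \<epsilon> / (real (card T) + 1)"
  have \<epsilon>': "\<epsilon>' > 0" "real (card T) * \<epsilon>' \<le> \<epsilon>"
    using \<open>\<epsilon> > 0\<close> by (auto simp: \<epsilon>'_def field_simps)
  let ?h = "\<lambda>U. shannon_entropy (marginal A U \<nu>)"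
  have J: "J t \<subseteq> {0..2 * int m}" for t using m by (force simp: J_def abs_le_iff)
  obtain N where N: "\<forall>(I :: ('v \<times> 'g) set) (q :: 'v \<times> 'g \<Rightarrow> int) J'. finite I \<longrightarrow>
      (\<forall>i\<in>I. \<forall>i'\<in>I. i \<noteq> i' \<longrightarrow> int N < \<bar>q i - q i'\<bar>) \<longrightarrow> (\<forall>i\<in>I. J' i \<subseteq> {0..2 * int m}) \<longrightarrow>
      (\<Sum>i\<in>I. ?h (J' i) - \<epsilon>') \<le> ?h (\<Union>i\<in>I. (+) (q i) ` J' i)"
    using uniformly_mixing_windows[OF proc mix finite_A finite_atLeastAtMost_int[of 0 "2 * int m"] \<epsilon>'(1)] by (elim exE)
  have H\<mu>: "shannon_entropy (marginal A F \<mu>) = (\<Sum>t\<in>T. ?h (J t))"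
    unfolding entropy_\<mu>[OF FG finF] T_def J_def
    using finF by (intro sum.cong refl process_entropy_shift[OF proc finite_A, symmetric]) auto
  define x where "x t k t' = inv (e m t) \<otimes> (\<theta> (int k) \<otimes> e m t')" for t t' and k :: nat
  define E where "E = (\<lambda>(t, k, t'). x t k t') ` (T \<times> {..N} \<times> T)"
  define r where "r = 1 + Max (insert 0 ((\<lambda>g. \<rho> g \<one>) ` E))"
  have finE: "finite E" using finT by (simp add: E_def)
  have r: "\<rho> g \<one> < r" if "g \<in> E" for g
  proof -
    have "\<rho> g \<one> \<le> Max (insert 0 ((\<lambda>g. \<rho> g \<one>) ` E))"
      using that finE by (intro Max_ge) auto
    then show ?thesis by (simp add: r_def)
  qed
  have x_closed: "x t k t' \<in> carrier G" if "t \<in> T" "t' \<in> T" for t k t'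
    using that TG \<theta>_closed by (auto simp: x_def subset_iff)
  define good1 where "good1 n v \<longleftrightarrow> (\<forall>g\<in>F. b n (\<sigma> n g v) = b n (\<sigma> n (e m (c g)) v) \<and>
    P n (\<sigma> n g v) = P n (\<sigma> n (e m (c g)) v) + (j g + int m))" for n v
  define good2 where "good2 n v \<longleftrightarrow> (\<forall>t\<in>T. \<forall>k\<in>{..N}. \<forall>t'\<in>T.
      (\<tau> n ^^ k) (\<sigma> n (e m t') v) = \<sigma> n (\<theta> (int k) \<otimes> e m t') v \<and>
      \<sigma> n (inv (e m t)) (\<sigma> n (e m t) v) = v \<and>
      \<sigma> n (inv (e m t)) (\<sigma> n (\<theta> (int k) \<otimes> e m t') v) = \<sigma> n (x t k t') v \<and>
      (x t k t' \<noteq> \<one> \<longrightarrow> \<sigma> n (x t k t') v \<noteq> v))" for n v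
  have "aaa good1" unfolding good1_def by (rule aaa_window[OF FG finF m])
  moreover have "aaa good2" unfolding good2_def
  proof (intro aaa_ball finT finite_atMost aaa_conj)
    fix t k t' assume "t \<in> T" "t' \<in> T" and k: "k \<in> {..N}"
    then have t: "e m t \<in> carrier G" "e m t' \<in> carrier G" "\<theta> (int k) \<otimes> e m t' \<in> carrier G"
      "x t k t' \<in> carrier G"
      using TG \<theta>_closed x_closed by (auto simp: subset_iff)
    show "aaa (\<lambda>n v. (\<tau> n ^^ k) (\<sigma> n (e m t') v) = \<sigma> n (\<theta> (int k) \<otimes> e m t') v)"
      by (rule aaa_\<tau>[OF t(2)])
    show "aaa (\<lambda>n v. \<sigma> n (inv (e m t)) (\<sigma> n (e m t) v) = v)"
      by (rule aaa_inv[OF t(1)])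
    show "aaa (\<lambda>n v. \<sigma> n (inv (e m t)) (\<sigma> n (\<theta> (int k) \<otimes> e m t') v) = \<sigma> n (x t k t') v)"
      unfolding x_def by (rule aaa_mult[OF inv_closed[OF t(1)] t(3)])
    show "aaa (\<lambda>n v. x t k t' \<noteq> \<one> \<longrightarrow> \<sigma> n (x t k t') v \<noteq> v)"
    proof (cases "x t k t' = \<one>")
      case True
      then show ?thesis using aaa_True by simp
    next
      case False
      show ?thesis by (rule aaa_mono[OF aaa_free[OF t(4) False]]) simp
    qed
  qed
  ultimately have aaa_good: "aaa (\<lambda>n v. good1 n v \<and> good2 n v)" by (rule aaa_conj)
  define W where "W n = {v \<in> V n. good1 n v \<and> good2 n v}" for n
  have "shannon_entropy (marginal A (sofic_image (\<sigma> n) F S) (\<mu>\<^sub>n n))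
      \<ge> real (card S) * (shannon_entropy (marginal A F \<mu>) - \<epsilon>)"
    if S: "S \<subseteq> W n" and sep: "separated (sofic_dist G \<rho> (V n) (\<sigma> n) (D n)) r S" for n S
  proof -
    have SV: "S \<subseteq> V n" using S by (auto simp: W_def)
    have finS: "finite S" using SV finite_V finite_subset by blast
    have g1: "b n (\<sigma> n g s) = b n (\<sigma> n (e m (c g)) s)"
      "P n (\<sigma> n g s) = P n (\<sigma> n (e m (c g)) s) + (j g + int m)" if "s \<in> S" "g \<in> F" for s g
      using S that by (auto simp: W_def good1_def)
    have g2: "(\<tau> n ^^ k) (\<sigma> n (e m t') s) = \<sigma> n (\<theta> (int k) \<otimes> e m t') s"
      "\<sigma> n (inv (e m t)) (\<sigma> n (e m t) s) = s"
      "\<sigma> n (inv (e m t)) (\<sigma> n (\<theta> (int k) \<otimes> e m t') s) = \<sigma> n (x t k t') s"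
      "x t k t' \<noteq> \<one> \<Longrightarrow> \<sigma> n (x t k t') s \<noteq> s"
      if "s \<in> S" "t \<in> T" "k \<le> N" "t' \<in> T" for s t k t'
    proof -
      have "good2 n s" using S that(1) by (auto simp: W_def)
      from this[unfolded good2_def, rule_format, OF that(2) _ that(4), of k] that(3)
      show "(\<tau> n ^^ k) (\<sigma> n (e m t') s) = \<sigma> n (\<theta> (int k) \<otimes> e m t') s"
        "\<sigma> n (inv (e m t)) (\<sigma> n (e m t) s) = s"
        "\<sigma> n (inv (e m t)) (\<sigma> n (\<theta> (int k) \<otimes> e m t') s) = \<sigma> n (x t k t') s"
        "x t k t' \<noteq> \<one> \<Longrightarrow> \<sigma> n (x t k t') s \<noteq> s"
        unfolding atMost_iff by blast+
    qed
    define y where "y = (\<lambda>(s, t). \<sigma> n (e m t) s)"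
    have y_V: "y i \<in> V n" if "i \<in> S \<times> T" for i
      using that SV TG by (auto simp: y_def sofic_in_V \<theta>_closed subset_iff)
    have near: "i = i'" if i: "i \<in> S \<times> T" "i' \<in> S \<times> T" and k: "k \<le> N"
      and eq: "(\<tau> n ^^ k) (y i') = y i" for i i' k
    proof -
      obtain s t s' t' where st: "i = (s, t)" "i' = (s', t')" by (cases i, cases i')
      then have mem: "s \<in> S" "t \<in> T" "s' \<in> S" "t' \<in> T" using i by auto
      have "s = \<sigma> n (inv (e m t)) (\<sigma> n (e m t) s)" using g2(2)[OF mem(1,2) k mem(4)] by simp
      also have "\<sigma> n (e m t) s = (\<tau> n ^^ k) (\<sigma> n (e m t') s')" using eq st by (simp add: y_def)
      also have "\<dots> = \<sigma> n (\<theta> (int k) \<otimes> e m t') s'" by (rule g2(1)[OF mem(3,2) k mem(4)])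
      also have "\<sigma> n (inv (e m t)) \<dots> = \<sigma> n (x t k t') s'" by (rule g2(3)[OF mem(3,2) k mem(4)])
      finally have s: "\<sigma> n (x t k t') s' = s" by simp
      have xE: "x t k t' \<in> E" 
        unfolding E_def by (rule image_eqI[of _ _ "(t, k, t')"]) (use mem k in auto)
      have "s = s'"
      proof (rule ccontr)
        assume "s \<noteq> s'"
        then show False
          using separated_sofic_dist[OF met one_closed sep SV mem(3,1) _ x_closed[OF mem(2,4)] r[OF xE]] s
          by blast
      qed
      then have x1: "x t k t' = \<one>" using g2(4)[OF mem(3,2) k mem(4)] s by blast
      have "e m t = \<theta> (int k) \<otimes> e m t'"
      proof -
        have cl: "e m t \<in> carrier G" "\<theta> (int k) \<otimes> e m t' \<in> carrier G"
          using TG mem(2,4) \<theta>_closed by auto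
        have "\<theta> (int k) \<otimes> e m t' = e m t \<otimes> x t k t'"
          unfolding x_def using cl by (simp only: m_assoc[symmetric] inv_closed r_inv l_one)
        then show ?thesis using cl by (simp only: x1 r_one)
      qed
      moreover obtain g h where "g \<in> F" "h \<in> F" "t = c g" "t' = c h"
        using mem(2,4) unfolding T_def by blast
      ultimately have "t = t'" using c_eq_if_e[of g h m "int k"] FG by blast
      with \<open>s = s'\<close> show ?thesis using st by simp
    qed
    let ?U = "sofic_image (\<sigma> n) F S"
    have U_V: "?U \<subseteq> V n" using FG SV by (auto simp: sofic_image_def sofic_in_V subset_iff)
    have bU: "b n ` ?U = (\<lambda>i. b n (y i)) ` (S \<times> T)"
    proof (intro equalityI subsetI)
      fix z assume "z \<in> b n ` ?U"
      then obtain g s where gs: "g \<in> F" "s \<in> S" "z = b n (\<sigma> n g s)" by (auto simp: sofic_image_def)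
      then have "z = b n (y (s, c g))" using g1(1)[OF gs(2,1)] by (simp add: y_def)
      then show "z \<in> (\<lambda>i. b n (y i)) ` (S \<times> T)" using gs by (auto simp: T_def)
    next
      fix z assume "z \<in> (\<lambda>i. b n (y i)) ` (S \<times> T)"
      then obtain g s where gs: "g \<in> F" "s \<in> S" "z = b n (y (s, c g))" by (auto simp: T_def)
      then have "z = b n (\<sigma> n g s)" using g1(1)[OF gs(2,1)] by (simp add: y_def)
      then show "z \<in> b n ` ?U" using gs by (auto simp: sofic_image_def)
    qed
    have block: "(\<Sum>i\<in>{i \<in> S \<times> T. b n (y i) = z}. ?h (J (snd i)) - \<epsilon>')
      \<le> ?h (P n ` {u \<in> ?U. b n u = z})" for z
    proof -
      let ?I = "{i \<in> S \<times> T. b n (y i) = z}"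
      have "P n ` {u \<in> ?U. b n u = z} = (\<Union>i\<in>?I. (+) (P n (y i)) ` J (snd i))"
      proof (intro equalityI subsetI)
        fix k assume "k \<in> P n ` {u \<in> ?U. b n u = z}"
        then obtain g s where gs: "g \<in> F" "s \<in> S" "b n (\<sigma> n g s) = z" "k = P n (\<sigma> n g s)"
          by (auto simp: sofic_image_def)
        have "k = P n (y (s, c g)) + (int m + j g)" using g1(2)[OF gs(2,1)] gs(4) by (simp add: y_def)
        moreover have "(s, c g) \<in> ?I" using gs g1(1)[OF gs(2,1)] by (auto simp: y_def T_def)
        moreover have "int m + j g \<in> J (c g)" using gs(1) by (auto simp: J_def)
        ultimately show "k \<in> (\<Union>i\<in>?I. (+) (P n (y i)) ` J (snd i))" by force
      next
        fix k assume "k \<in> (\<Union>i\<in>?I. (+) (P n (y i)) ` J (snd i))"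
        then obtain s t g where gs: "s \<in> S" "g \<in> F" "c g = t" "b n (y (s, t)) = z"
          "k = P n (y (s, t)) + (int m + j g)" by (auto simp: J_def)
        have "k = P n (\<sigma> n g s)" using g1(2)[OF gs(1,2)] gs(3,5) by (simp add: y_def)
        moreover have "b n (\<sigma> n g s) = z" using g1(1)[OF gs(1,2)] gs(3,4) by (simp add: y_def)
        ultimately show "k \<in> P n ` {u \<in> ?U. b n u = z}" using gs(1,2) by (auto simp: sofic_image_def)
      qed
      moreover have "(\<Sum>i\<in>?I. ?h (J (snd i)) - \<epsilon>') \<le> ?h (\<Union>i\<in>?I. (+) (P n (y i)) ` J (snd i))"
      proof (rule N[THEN spec, THEN spec, THEN spec, THEN mp, THEN mp, THEN mp])
        show "finite ?I" using finS finT by simp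
        show "\<forall>i\<in>?I. J (snd i) \<subseteq> {0..2 * int m}" using J by blast
        have far: "int N < P n (y i) - P n (y i')"
          if i: "i \<in> ?I" "i' \<in> ?I" "i \<noteq> i'" and le: "p n (y i') \<le> p n (y i)" for i i'
        proof (rule ccontr)
          assume "\<not> int N < P n (y i) - P n (y i')"
          then have k: "p n (y i) - p n (y i') \<le> N" using le by linarith
          have yV: "y i \<in> V n" "y i' \<in> V n" using i y_V by auto
          have "(\<tau> n ^^ (p n (y i) - p n (y i'))) (y i')
            = (\<tau> n ^^ (p n (y i) - p n (y i'))) ((\<tau> n ^^ p n (y i')) (b n (y i')))"
            by (simp only: \<tau>_p_b[OF yV(2)])
          also have "\<dots> = (\<tau> n ^^ (p n (y i) - p n (y i') + p n (y i'))) (b n (y i'))"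
            by (simp only: funpow_add comp_def)
          also have "\<dots> = (\<tau> n ^^ p n (y i)) (b n (y i))" using i le by simp
          also have "\<dots> = y i" by (rule \<tau>_p_b[OF yV(1)])
          finally have "i = i'" using i by (intro near[OF _ _ k]) auto
          with i show False by simp
        qed
        show "\<forall>i\<in>?I. \<forall>i'\<in>?I. i \<noteq> i' \<longrightarrow> int N < \<bar>P n (y i) - P n (y i')\<bar>"
        proof (intro ballI impI)
          fix i i' assume i: "i \<in> ?I" "i' \<in> ?I" "i \<noteq> i'"
          show "int N < \<bar>P n (y i) - P n (y i')\<bar>"
          proof (cases "p n (y i') \<le> p n (y i)")
            case True
            with far[OF i] show ?thesis by linarith
          next
            case False
            with far[OF i(2,1) i(3)[symmetric]] show ?thesis by linarith
          qed
        qed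
      qed
      ultimately show ?thesis by simp
    qed
    have "real (card S) * (shannon_entropy (marginal A F \<mu>) - \<epsilon>)
      \<le> real (card S) * (\<Sum>t\<in>T. ?h (J t) - \<epsilon>')"
      unfolding H\<mu> using \<epsilon>'(2) by (intro mult_left_mono) (auto simp: sum_subtractf)
    also have "\<dots> = (\<Sum>i\<in>S \<times> T. ?h (J (snd i)) - \<epsilon>')"
      using sum.cartesian_product[of "\<lambda>s t. ?h (J t) - \<epsilon>'" T S] by (simp add: split_beta')
    also have "\<dots> = (\<Sum>z\<in>b n ` ?U. \<Sum>i\<in>{i \<in> S \<times> T. b n (y i) = z}. ?h (J (snd i)) - \<epsilon>')"
      unfolding bU using finS finT by (intro sum.image_gen) simp
    also have "\<dots> \<le> (\<Sum>z\<in>b n ` ?U. ?h (P n ` {u \<in> ?U. b n u = z}))"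
      by (intro sum_mono block)
    also have "\<dots> = shannon_entropy (marginal A ?U (\<mu>\<^sub>n n))" by (rule entropy_\<mu>\<^sub>n[OF U_V, symmetric])
    finally show ?thesis .
  qed
  moreover have "(\<lambda>n. real (card (W n)) / real (card (V n))) \<longlonglongrightarrow> 1"
    using aaa_good by (simp only: asymptotically_almost_all_def W_def)
  moreover have "W n \<subseteq> V n" for n by (auto simp: W_def)
  ultimately show "\<exists>(r :: real) W. (\<forall>n. W n \<subseteq> V n) \<and>
           (\<lambda>n. real (card (W n)) / real (card (V n))) \<longlonglongrightarrow> 1 \<and>
           (\<forall>n. \<forall>S\<subseteq>W n. separated (sofic_dist G \<rho> (V n) (\<sigma> n) (D n)) r S \<longrightarrow>
              shannon_entropy (marginal A (sofic_image (\<sigma> n) F S) (\<mu>\<^sub>n n))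
              \<ge> real (card S) * (shannon_entropy (marginal A F \<mu>) - \<epsilon>))"
    by (intro exI[of _ r] exI[of _ W]) blast
qed

end

theorem theorem1p3:
  fixes G :: "('g, 'm) monoid_scheme"
    and H T :: "'g set"
    and \<theta> :: "int \<Rightarrow> 'g"
    and A :: "'a set"
    and \<nu> :: "(int \<Rightarrow> 'a) measure"
    and V :: "nat \<Rightarrow> 'v set"
    and \<sigma> :: "nat \<Rightarrow> 'g \<Rightarrow> 'v \<Rightarrow> 'v"
    and \<rho> :: "'g \<Rightarrow> 'g \<Rightarrow> real"
    and D :: "nat \<Rightarrow> real"
  assumes "group G" and "countable (carrier G)" and "sofic G"
    and "finite A"
    and "process integer_group A \<nu>" and "uniformly_mixing integer_group A \<nu>"
    and "subgroup H G" and "\<theta> \<in> iso integer_group (G\<lparr>carrier := H\<rparr>)"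
    and "right_transversal G H T"
    and "sofic_approximation G V \<sigma>"
    and "proper_right_invariant_metric G \<rho>"
    and "\<And>n. exceeds_component_dists G \<rho> (V n) (\<sigma> n) (D n)"
  defines "\<mu> \<equiv> CInd G H T A (relabel (carrier integer_group) H \<theta> A \<nu>)"
  shows "\<exists>M. (\<forall>n. M n \<in> Prob (V n) A) \<and>
           uniformly_model_mixing G A V \<sigma> (\<lambda>n. sofic_dist G \<rho> (V n) (\<sigma> n) (D n)) M \<mu> \<and>
           locally_empirically_converges G A V \<sigma> M \<mu>"
proof -
  interpret group G by fact
  note sub = \<open>subgroup H G\<close> and trans = \<open>right_transversal G H T\<close>
  have hom: "\<theta> \<in> hom integer_group (G\<lparr>carrier := H\<rparr>)"
    and bij: "bij_betw \<theta> (carrier integer_group) (carrier (G\<lparr>carrier := H\<rparr>))"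
    using \<open>\<theta> \<in> iso integer_group (G\<lparr>carrier := H\<rparr>)\<close> unfolding iso_def by blast+
  have \<theta>_H: "range \<theta> = H" and inj: "inj \<theta>"
    using bij by (simp_all add: bij_betw_def)
  have add: "\<theta> (k + l) = \<theta> k \<otimes>\<^bsub>G\<^esub> \<theta> l" for k l
    using hom_mult[OF hom, of k l] by simp
  have \<theta>_G: "\<theta> k \<in> carrier G" for k
    using subgroup.mem_carrier[OF sub] \<theta>_H by blast
  interpret sofic_setting G V \<sigma> \<theta>
  proof unfold_locales
    fix g h n k l
    show "finite (V n)" "filterlim (\<lambda>n. card (V n)) at_top sequentially"
      using \<open>sofic_approximation G V \<sigma>\<close> by (auto simp: sofic_approximation_def)
    show "countable (carrier G)" by fact
    show "\<theta> k \<in> carrier G" "inj \<theta>" "\<theta> (k + l) = \<theta> k \<otimes>\<^bsub>G\<^esub> \<theta> l" by (fact \<theta>_G inj add)+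
    show "\<sigma> n g permutes V n" if "g \<in> carrier G"
      using that \<open>sofic_approximation G V \<sigma>\<close> by (simp add: sofic_approximation_def)
    show "asymptotically_almost_all V (\<lambda>n v. \<sigma> n g (\<sigma> n h v) = \<sigma> n (g \<otimes>\<^bsub>G\<^esub> h) v)"
      if "g \<in> carrier G" "h \<in> carrier G"
      using that \<open>sofic_approximation G V \<sigma>\<close>
      by (simp add: sofic_approximation_def asymptotically_almost_all_def)
    show "asymptotically_almost_all V (\<lambda>n v. \<sigma> n g v \<noteq> v)"
      if "g \<in> carrier G" "g \<noteq> \<one>\<^bsub>G\<^esub>"
      using that \<open>sofic_approximation G V \<sigma>\<close>
      by (simp add: sofic_approximation_def asymptotically_almost_all_def)
  qed
  show ?thesis
  proof (rule sofic_blocks)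
    fix C b p L
    assume blocks: "aaa (\<lambda>n v. v \<notin> C n)"
      "\<And>n v. v \<in> V n \<Longrightarrow> b n v \<in> V n" "\<And>n v. v \<in> V n \<Longrightarrow> p n v < 2 * L n"
      "\<And>n v. v \<in> V n \<Longrightarrow> (\<tau> n ^^ p n v) (b n v) = v"
      "\<And>n v. v \<in> V n \<Longrightarrow> \<tau> n v \<notin> C n \<Longrightarrow> b n (\<tau> n v) = b n v \<and> p n (\<tau> n v) = Suc (p n v)"
      "(\<lambda>n. real (L n) / real (card (V n))) \<longlonglongrightarrow> 0"
      "\<And>g h. g \<in> carrier G \<Longrightarrow> h \<in> carrier G \<Longrightarrow> (\<And>k. g \<noteq> \<theta> k \<otimes>\<^bsub>G\<^esub> h)
         \<Longrightarrow> aaa (\<lambda>n v. b n (\<sigma> n g v) \<noteq> b n (\<sigma> n h v))"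
    let ?c = "coset_rep G H T"
    let ?j = "\<lambda>g. inv_into UNIV \<theta> (g \<otimes>\<^bsub>G\<^esub> inv\<^bsub>G\<^esub> (?c g))"
    note \<nu> = process_integer_group(1)[OF \<open>process integer_group A \<nu>\<close>]
    note \<nu>H = relabel_Prob(1)[OF \<nu>, where H = H and \<theta> = \<theta>]
    note c = coset_rep_props[OF sub trans]
    interpret block_setting G V \<sigma> \<theta> A \<nu> ?c ?j \<mu> C b p L
    proof (unfold_locales, fact \<open>finite A\<close>, fact \<open>process integer_group A \<nu>\<close>)
      fix g h k
      show "?c g \<in> carrier G" if "g \<in> carrier G" by (rule c(2)[OF that])
      show "\<theta> (?j g) \<otimes>\<^bsub>G\<^esub> ?c g = g" if g: "g \<in> carrier G"
      proof -
        have "\<theta> (?j g) = g \<otimes>\<^bsub>G\<^esub> inv\<^bsub>G\<^esub> (?c g)" using c(3)[OF g] \<theta>_H by (intro f_inv_into_f) simp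
        then show ?thesis using g c(2)[OF g] by (simp add: m_assoc)
      qed
      show "?c g = ?c h" if "g \<in> carrier G" "h \<in> carrier G" "?c g = \<theta> k \<otimes>\<^bsub>G\<^esub> ?c h"
        using \<theta>_H that(3) by (intro coset_rep_distinct[OF sub trans that(1,2), of "\<theta> k"]) auto
      show "\<mu> \<in> Prob (carrier G) A"
        unfolding \<mu>_def carrier_integer_group by (rule CInd_Prob(1)[OF sub trans \<nu>H])
      show "measure \<mu> {x \<in> space \<mu>. \<forall>g\<in>F. x g = z g} = block_mass \<nu> ?c ?j F z"
        if F: "F \<subseteq> carrier G" "finite F" for F z
      proof -
        have "(\<lambda>g. g \<otimes>\<^bsub>G\<^esub> inv\<^bsub>G\<^esub> (?c g)) ` F \<subseteq> H" using F(1) c(3) by blast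
        then show ?thesis
          unfolding \<mu>_def carrier_integer_group CInd_Prob(2)[OF sub trans \<nu>H F]
          by (rule relabel_block_mass[OF \<nu> F(2)])
      qed
    qed (fact blocks)+
    have "locally_empirically_converges G A V \<sigma> \<mu>\<^sub>n \<mu>"
      unfolding locally_empirically_converges_def
    proof (intro allI impI conjI)
      fix \<O> assume "openin (weak_star G A) \<O> \<and> \<mu> \<in> \<O>"
      then have \<O>: "openin (weak_star G A) \<O>" "\<mu> \<in> \<O>" by blast+
      show "(\<lambda>n. real (card {v \<in> V n. distr (\<mu>\<^sub>n n) (config (carrier G) A)
          (\<lambda>a. pullback_name G (\<sigma> n) a v) \<in> \<O>}) / real (card (V n))) \<longlonglongrightarrow> 1"
        using local_convergence[OF \<O>] unfolding asymptotically_almost_all_def .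
      show "(\<lambda>n. measure (\<mu>\<^sub>n n) {a \<in> space (\<mu>\<^sub>n n). empirical G A (V n) (\<sigma> n) a \<in> \<O>}) \<longlonglongrightarrow> 1"
        by (rule empirical_convergence[OF \<O>])
    qed
    moreover have "uniformly_model_mixing G A V \<sigma> (\<lambda>n. sofic_dist G \<rho> (V n) (\<sigma> n) (D n)) \<mu>\<^sub>n \<mu>"
      by (rule model_mixing[OF \<open>uniformly_mixing integer_group A \<nu>\<close> \<open>proper_right_invariant_metric G \<rho>\<close>])
    ultimately show ?thesis using \<mu>\<^sub>n_Prob by (intro exI[of _ \<mu>\<^sub>n] conjI allI)
  qed
qed

end
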